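(* Let $p\in\mathbb{N}^+$, $T_0>0$, let $\phi,\gamma$ be real-valued functions on $[a,b]$ independent of $\varepsilon$, and for every $\varepsilon\in(0,1]$ let $v$ (depending on $\varepsilon$) be the exact solution of the oscillatory nonlinear Klein-Gordon equation $$\varepsilon^{2p}\partial_{ss}v-\partial_{xx}v+v+\varepsilon^pv^{p+1}=0,\quad x\in(a,b),\ s>0,\qquad v(x,0)=\phi(x),\ \ \partial_sv(x,0)=\varepsilon^{-p}\gamma(x),\ \ x\in[a,b],$$ with periodic boundary conditions. Assume that $$v\in C([0,T_0];W^{6,\infty}_p)\cap C^2([0,T_0];W^{4,\infty})\cap C^4([0,T_0];W^{2,\infty}),$$ $$\left\|\frac{\partial^{r+q}}{\partial s^r\partial x^q}v(x,s)\right\|_{L^\infty}\lesssim\frac1{\varepsilon^{pr}},\qquad 0\le r\le4,\ 0\le r+q\le6,$$ on $[a,b]\times[0,T_0]$. Let $M_0=\sup_{\varepsilon\in(0,1]}\|v(x,s)\|_{L^\infty}$. Let $v^n\in X_M$ be the numerical solution given by the semi-implicit fourth-order compact finite difference scheme $$\varepsilon^{2p}\delta_s^2v^n_j-\mathcal{A}^{-1}\delta_x^2v^{[n]}_j+v^{[n]}_j+\varepsilon^p(v^n_j)^{p+1}=0,\qquad 0\le j\le M-1,\ n\ge1,$$ with $v^0_j=\phi(x_j)$ and $$v^1_j=\phi(x_j)+\frac{k}{\varepsilon^p}\gamma(x_j)+\frac{k^2}{2\varepsilon^{2p}}\left[\phi''(x_j)-\phi(x_j)-\varepsilon^p(\phi(x_j))^{p+1}\right],\qquad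 0\le j\le M,$$ and let $\tilde e^n_j=v(x_j,s_n)-v^n_j$. Let $\tilde\sigma_{\max}=\max_{0\le n\le T_0/k}\|v^n\|_{l^\infty}^p$. Then there exist constants $h_0>0$ and $k_0>0$, sufficiently small and independent of $\varepsilon$, such that for any $0<\varepsilon\le1$, whenever $0<h\le h_0\varepsilon^{p/4}$, $0<k\le k_0\varepsilon^{3p/2}$ and the stability condition $$0<k<\frac{2\varepsilon^p}{\sqrt{\varepsilon^p\tilde\sigma_{\max}-1}}\qquad(\text{required only when }\tilde\sigma_{\max}>\varepsilon^{-p})$$ holds, one has $$\|\tilde e^n\|_{l^2}+\|\delta_x^+\tilde e^n\|_{l^2}\lesssim\frac{h^4}{\varepsilon^p}+\frac{k^2}{\varepsilon^{3p}},\qquad\|v^n\|_{l^\infty}\le1+M_0,\qquad0\le n\le\frac{T_0}{k}.$$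
   Context: Notation. $A\lesssim B$ means $|A|\le CB$ with a constant $C>0$ independent of the mesh size $h$, the time step $k$ and $\varepsilon$. $k>0$ is the time step, $h=(b-a)/M>0$ the mesh size with $M$ a positive integer, $x_j=a+jh$ ($0\le j\le M$), $s_n=nk$ ($n\ge 0$). $X_M=\{u=(u_0,\dots,u_M)^T\in\mathbb{R}^{M+1}: u_0=u_M\}$, with the periodic convention $u_{-1}=u_{M-1}$, $u_{M+1}=u_1$. Norms: $\|u\|_{l^2}^2=h\sum_{j=0}^{M-1}|u_j|^2$, $\|\delta_x^+u\|_{l^2}^2=h\sum_{j=0}^{M-1}|\delta_x^+u_j|^2$, $\|u\|_{l^\infty}=\max_{0\le j\le M-1}|u_j|$. Difference operators: $\delta_x^+u_j=(u_{j+1}-u_j)/h$, $\delta_x^2u_j=(u_{j+1}-2u_j+u_{j-1})/h^2$, $\delta_s^2v^n_j=(v^{n+1}_j-2v^n_j+v^{n-1}_j)/k^2$, $\mathcal{A}u_j=(1+\frac{h^2}{12}\delta_x^2)u_j=\frac1{12}(u_{j-1}+10u_j+u_{j+1})$; $\mathcal{A}^{-1}$ is the inverse of $\mathcal{A}$ on $X_M$. Also $v^{[n]}_j=(v^{n+1}_j+v^{n-1}_j)/2$. $W^{m,\infty}_p=\{u\in W^{m,\infty}(a,b): \frac{\partial^l}{\partial x^l}u(a)=\frac{\partial^l}{\partial x^l}u(b),\ 0\le l<m\}$ for $m\ge1$ (this subscript $p$ means "periodic"). *)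

theory Defs
  imports "HOL-Analysis.Analysis" "HOL-Probability.Essential_Supremum"
begin

section \<open>Sobolev spaces on an interval\<close>

definition test_function :: "real \<Rightarrow> real \<Rightarrow> (real \<Rightarrow> real) \<Rightarrow> bool" where
  "test_function a b \<psi> \<longleftrightarrow>
     (\<forall>n x. (deriv ^^ n) \<psi> field_differentiable at x) \<and>
     compact (closure {x. \<psi> x \<noteq> 0}) \<and> closure {x. \<psi> x \<noteq> 0} \<subseteq> {a<..<b}"

definition locally_integrable :: "real \<Rightarrow> real \<Rightarrow> (real \<Rightarrow> real) \<Rightarrow> bool" where
  "locally_integrable a b u \<longleftrightarrow>
     (\<forall>K. compact K \<and> K \<subseteq> {a<..<b} \<longrightarrow> set_integrable lebesgue K u)"

definition has_weak_deriv ::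
  "real \<Rightarrow> real \<Rightarrow> nat \<Rightarrow> (real \<Rightarrow> real) \<Rightarrow> (real \<Rightarrow> real) \<Rightarrow> bool" where
  "has_weak_deriv a b l u g \<longleftrightarrow>
     locally_integrable a b u \<and> locally_integrable a b g \<and>
     (\<forall>\<psi>. test_function a b \<psi> \<longrightarrow>
        (LINT x:{a<..<b}|lebesgue. u x * (deriv ^^ l) \<psi> x)
          = (- 1) ^ l * (LINT x:{a<..<b}|lebesgue. g x * \<psi> x))"

text \<open>A representative; weak derivatives are unique only up to null sets.\<close>

definition weak_deriv :: "real \<Rightarrow> real \<Rightarrow> nat \<Rightarrow> (real \<Rightarrow> real) \<Rightarrow> real \<Rightarrow> real" where
  "weak_deriv a b l u = (SOME g. has_weak_deriv a b l u g)"

definition Linf_norm :: "real \<Rightarrow> real \<Rightarrow> (real \<Rightarrow> real) \<Rightarrow> ereal" where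
  "Linf_norm a b u = esssup (lebesgue_on {a<..<b}) (\<lambda>x. ereal \<bar>u x\<bar>)"

definition sobolev :: "real \<Rightarrow> real \<Rightarrow> nat \<Rightarrow> (real \<Rightarrow> real) set" where
  "sobolev a b m = {u. \<forall>l\<le>m. \<exists>g. has_weak_deriv a b l u g \<and> Linf_norm a b g < \<infinity>}"

definition sobolev_norm :: "real \<Rightarrow> real \<Rightarrow> nat \<Rightarrow> (real \<Rightarrow> real) \<Rightarrow> ereal" where
  "sobolev_norm a b m u = (SUP l\<in>{..m}. Linf_norm a b (weak_deriv a b l u))"

text \<open>The boundary values of the derivatives of order \<open>l < m\<close> are those of their
  representatives that are continuous on the closed interval.\<close>

definition sobolev_periodic :: "real \<Rightarrow> real \<Rightarrow> nat \<Rightarrow> (real \<Rightarrow> real) set" where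
  "sobolev_periodic a b m = {u \<in> sobolev a b m.
     \<forall>l<m. \<exists>g. continuous_on {a..b} g \<and> has_weak_deriv a b l u g \<and> g a = g b}"


section \<open>Functions of time with values in a function space\<close>

text \<open>\<open>D 0, \<dots>, D r\<close> are continuous from \<open>[0, T]\<close> to the space \<open>X\<close> normed by \<open>N\<close>, and each is the
  derivative, in the norm \<open>N\<close>, of the one before it (one-sided at \<open>0\<close> and \<open>T\<close>).\<close>

definition time_derivs ::
  "nat \<Rightarrow> real \<Rightarrow> (real \<Rightarrow> real) set \<Rightarrow> ((real \<Rightarrow> real) \<Rightarrow> ereal)
     \<Rightarrow> (nat \<Rightarrow> real \<Rightarrow> real \<Rightarrow> real) \<Rightarrow> bool" where
  "time_derivs r T X N D \<longleftrightarrow>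
     (\<forall>i\<le>r. \<forall>s\<in>{0..T}. D i s \<in> X \<and>
        ((\<lambda>t. N (\<lambda>x. D i t x - D i s x)) \<longlongrightarrow> 0) (at s within {0..T})) \<and>
     (\<forall>i<r. \<forall>s\<in>{0..T}.
        ((\<lambda>t. N (\<lambda>x. (D i t x - D i s x) / (t - s) - D (Suc i) s x)) \<longlongrightarrow> 0)
          (at s within {0..T}))"

definition C_space ::
  "nat \<Rightarrow> real \<Rightarrow> (real \<Rightarrow> real) set \<Rightarrow> ((real \<Rightarrow> real) \<Rightarrow> ereal)
     \<Rightarrow> (real \<Rightarrow> real \<Rightarrow> real) set" where
  "C_space r T X N = {f. \<exists>D. D 0 = f \<and> time_derivs r T X N D}"

text \<open>The mixed derivative of order \<open>(r, q)\<close> is the weak \<open>x\<close>-derivative of order \<open>q\<close> of the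
  \<open>r\<close>-th time derivative, the latter taken in \<open>L\<^sup>\<infinity>(a,b)\<close> (the weakest of the spaces in use);
  the \<open>L\<^sup>\<infinity>\<close> norm over \<open>[a,b] \<times> [0,T]\<close> is the supremum over \<open>s\<close> of the norms over \<open>x\<close>.\<close>

definition mixed_derivs_bounded ::
  "nat \<Rightarrow> real \<Rightarrow> real \<Rightarrow> real \<Rightarrow> real \<Rightarrow> (real \<Rightarrow> real \<Rightarrow> real) \<Rightarrow> real \<Rightarrow> bool" where
  "mixed_derivs_bounded p a b T \<epsilon> v C \<longleftrightarrow>
     (\<exists>D. D 0 = (\<lambda>s x. v x s) \<and>
        time_derivs 4 T (sobolev a b 0) (sobolev_norm a b 0) D \<and>
        (\<forall>r q. r \<le> 4 \<and> r + q \<le> 6 \<longrightarrow>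
           (\<forall>s\<in>{0..T}. \<exists>g. has_weak_deriv a b q (D r s) g \<and>
              Linf_norm a b g \<le> ereal (C / \<epsilon> ^ (p * r)))))"


section \<open>The oscillatory Klein-Gordon equation\<close>

definition klein_gordon_solution ::
  "nat \<Rightarrow> real \<Rightarrow> real \<Rightarrow> real \<Rightarrow> real \<Rightarrow> (real \<Rightarrow> real) \<Rightarrow> (real \<Rightarrow> real)
     \<Rightarrow> (real \<Rightarrow> real \<Rightarrow> real) \<Rightarrow> bool" where
  "klein_gordon_solution p \<epsilon> a b T \<phi> \<gamma> v \<longleftrightarrow>
     continuous_on ({a..b} \<times> {0..T}) (\<lambda>(x, s). v x s) \<and>
     (\<exists>vs vss vx vxx.
        (\<forall>x\<in>{a..b}. \<forall>s\<in>{0..T}.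
           ((\<lambda>t. v x t) has_real_derivative vs x s) (at s within {0..T}) \<and>
           ((\<lambda>y. v y s) has_real_derivative vx x s) (at x within {a..b})) \<and>
        (\<forall>x\<in>{a<..<b}. \<forall>s\<in>{0<..T}.
           ((\<lambda>t. vs x t) has_real_derivative vss x s) (at s within {0..T}) \<and>
           ((\<lambda>y. vx y s) has_real_derivative vxx x s) (at x) \<and>
           \<epsilon> ^ (2 * p) * vss x s - vxx x s + v x s + \<epsilon> ^ p * v x s ^ (p + 1) = 0) \<and>
        (\<forall>x\<in>{a..b}. v x 0 = \<phi> x \<and> vs x 0 = \<gamma> x / \<epsilon> ^ p) \<and>
        (\<forall>s\<in>{0..T}. v a s = v b s \<and> vx a s = vx b s))"


section \<open>Periodic grid functions\<close>

text \<open>A vector \<open>(u\<^sub>0, \<dots>, u\<^sub>M)\<close> with \<open>u\<^sub>0 = u\<^sub>M\<close> is encoded as its \<open>M\<close>-periodic extension to all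
  integer indices, so that \<open>u\<^sub>-\<^sub>1 = u\<^bsub>M-1\<^esub>\<close> and \<open>u\<^bsub>M+1\<^esub> = u\<^sub>1\<close>.\<close>

definition grid_space :: "nat \<Rightarrow> (int \<Rightarrow> real) set" where
  "grid_space M = {u. \<forall>j. u (j + int M) = u j}"

definition dx_plus :: "real \<Rightarrow> (int \<Rightarrow> real) \<Rightarrow> int \<Rightarrow> real" where
  "dx_plus h u j = (u (j + 1) - u j) / h"

definition dx2 :: "real \<Rightarrow> (int \<Rightarrow> real) \<Rightarrow> int \<Rightarrow> real" where
  "dx2 h u j = (u (j + 1) - 2 * u j + u (j - 1)) / h ^ 2"

definition ds2 :: "real \<Rightarrow> (nat \<Rightarrow> int \<Rightarrow> real) \<Rightarrow> nat \<Rightarrow> int \<Rightarrow> real" where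
  "ds2 k w n j = (w (n + 1) j - 2 * w n j + w (n - 1) j) / k ^ 2"

definition compact_op :: "real \<Rightarrow> (int \<Rightarrow> real) \<Rightarrow> int \<Rightarrow> real" where
  "compact_op h u j = u j + h ^ 2 / 12 * dx2 h u j"

definition compact_inv :: "nat \<Rightarrow> real \<Rightarrow> (int \<Rightarrow> real) \<Rightarrow> int \<Rightarrow> real" where
  "compact_inv M h = inv_into (grid_space M) (compact_op h)"

definition time_avg :: "(nat \<Rightarrow> int \<Rightarrow> real) \<Rightarrow> nat \<Rightarrow> int \<Rightarrow> real" where
  "time_avg w n j = (w (n + 1) j + w (n - 1) j) / 2"

definition l2_norm :: "nat \<Rightarrow> real \<Rightarrow> (int \<Rightarrow> real) \<Rightarrow> real" where
  "l2_norm M h u = sqrt (h * (\<Sum>j\<in>{0..<int M}. \<bar>u j\<bar> ^ 2))"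

definition linf_norm :: "nat \<Rightarrow> (int \<Rightarrow> real) \<Rightarrow> real" where
  "linf_norm M u = Max ((\<lambda>j. \<bar>u j\<bar>) ` {0..<int M})"


section \<open>The compact finite difference scheme\<close>

text \<open>Derivatives within \<open>[a,b]\<close>, because \<open>\<phi>\<close> is only given there and \<open>\<phi>''\<close> is used at the end points.\<close>

definition second_deriv :: "real \<Rightarrow> real \<Rightarrow> (real \<Rightarrow> real) \<Rightarrow> real \<Rightarrow> real" where
  "second_deriv a b \<phi> x =
     vector_derivative (\<lambda>y. vector_derivative \<phi> (at y within {a..b})) (at x within {a..b})"

definition numerical_solution ::
  "nat \<Rightarrow> real \<Rightarrow> real \<Rightarrow> real \<Rightarrow> (real \<Rightarrow> real) \<Rightarrow> (real \<Rightarrow> real)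
     \<Rightarrow> nat \<Rightarrow> real \<Rightarrow> real \<Rightarrow> (nat \<Rightarrow> int \<Rightarrow> real) \<Rightarrow> bool" where
  "numerical_solution p \<epsilon> a b \<phi> \<gamma> M h k w \<longleftrightarrow>
     (\<forall>n. w n \<in> grid_space M) \<and>
     (\<forall>n\<ge>1. \<forall>j\<in>{0..int M - 1}.
        \<epsilon> ^ (2 * p) * ds2 k w n j - compact_inv M h (dx2 h (time_avg w n)) j
          + time_avg w n j + \<epsilon> ^ p * w n j ^ (p + 1) = 0) \<and>
     (\<forall>j\<in>{0..int M}. let x = a + of_int j * h in
        w 0 j = \<phi> x \<and>
        w 1 j = \<phi> x + k / \<epsilon> ^ p * \<gamma> x
          + k ^ 2 / (2 * \<epsilon> ^ (2 * p)) * (second_deriv a b \<phi> x - \<phi> x - \<epsilon> ^ p * \<phi> x ^ (p + 1)))"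

definition grid_error ::
  "real \<Rightarrow> real \<Rightarrow> real \<Rightarrow> (real \<Rightarrow> real \<Rightarrow> real) \<Rightarrow> (nat \<Rightarrow> int \<Rightarrow> real) \<Rightarrow> nat \<Rightarrow> int \<Rightarrow> real" where
  "grid_error a h k v w n j = v (a + of_int j * h) (of_nat n * k) - w n j"

definition sigma_max :: "nat \<Rightarrow> real \<Rightarrow> real \<Rightarrow> nat \<Rightarrow> (nat \<Rightarrow> int \<Rightarrow> real) \<Rightarrow> real" where
  "sigma_max p T k M w = Max ((\<lambda>n. linf_norm M (w n) ^ p) ` {n. of_nat n \<le> T / k})"

end

theory Submission
  imports Defs
begin

text \<open>The error satisfies the linearised scheme with the truncation error as source, and an energy
estimate turns smallness of the source into smallness of the error.

\<^emph>\<open>Stability.\<close> Multiply the error equation by the compact averaging operator \<open>A\<close>, which removes \<open>A\<^sup>-\<^sup>1\<close>, and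
pair it with \<open>e\<^bsub>n+1\<^esub> - e\<^bsub>n-1\<^esub>\<close>. Summation by parts gives an exact balance for
\<open>\<epsilon>\<^bsup>2p\<^esup> (A q, q) + (|\<delta> e\<^bsub>n+1\<^esub>|\<^sup>2 + (A e\<^bsub>n+1\<^esub>, e\<^bsub>n+1\<^esub>) + |\<delta> e\<^sub>n|\<^sup>2 + (A e\<^sub>n, e\<^sub>n)) / 2\<close>, where \<open>q = (e\<^bsub>n+1\<^esub> - e\<^sub>n) / k\<close>
(\<open>scheme_energy_step\<close>). Since \<open>A \<ge> 2/3\<close>, this energy controls the discrete \<open>H\<^sup>1\<close> norm of the error and
\<open>\<epsilon>\<^bsup>p\<^esup> |q|\<close>; so its square root grows in one step by the factor \<open>1 + O(k)\<close> and by
\<open>2 k \<epsilon>\<^bsup>-p\<^esup>\<close> times the size of the source (\<open>scheme_energy_growth\<close>). The division by \<open>\<epsilon>\<^bsup>p\<^esup>\<close> in the final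
rate comes from here. The nonlinear term is explicit, so at step \<open>n+1\<close> it only needs the bound on \<open>w\<^sub>n\<close>, which
the discrete Sobolev inequality supplies inductively as long as the rate is small; this smallness is what the
restrictions on \<open>h\<close> and \<open>k\<close> are for (\<open>energy_bound\<close>).

\<^emph>\<open>Consistency.\<close> The truncation error is \<open>O(h\<^sup>4 + k\<^sup>2 \<epsilon>\<^bsup>-2p\<^esup>)\<close> (\<open>truncation_error\<close>). The spatial part,
\<open>\<delta>\<^sub>x\<^sup>2 v - A v\<^sub>x\<^sub>x = O(h\<^sup>4)\<close>, is Taylor expansion to order six across the periodic boundary. For the temporal part
\<open>v\<^sub>x\<^sub>x\<close> at the two outer time levels is eliminated with the equation; what remains are Taylor remainders
in time at fixed \<open>x\<close>. The bound for \<open>\<partial>\<^sub>x \<partial>\<^sub>s\<^sup>3 v\<close>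
controls the discrete gradient of the error of the first step.

\<^emph>\<open>Regularity.\<close> The hypotheses speak of weak derivatives and of limits in \<open>L\<^sup>\<infinity>\<close>, the Taylor expansions of
classical ones. The bridge is a mean value inequality for a continuous function with bounded weak derivative
(\<open>weak_derivative_mean_value_inequality\<close>), proved by testing with a smoothed indicator function of an interval.
It makes \<open>v\<close> five times continuously differentiable in \<open>x\<close>. The \<open>L\<^sup>\<infinity>\<close> time derivatives
have continuous representatives because difference quotients of continuous functions that converge
in \<open>L\<^sup>\<infinity>\<close> converge uniformly (\<open>time_derivative_continuous_representative\<close>). Functions are compared only
through their pairings with test functions, so that \<open>L\<^sup>\<infinity>\<close> classes are never identified almost everywhere.\<close>

section \<open>Smooth cut-off functions\<close>

text \<open>The factor \<open>P / q\<^sup>m\<close> with \<open>q = (z - x)(y - z)\<close> is carried along because the functions of this form are closed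
under differentiation; so the smoothness of \<open>exp (-1/q)\<close> needs no formula for its higher derivatives.\<close>

definition bump :: "real \<Rightarrow> real \<Rightarrow> real poly \<Rightarrow> nat \<Rightarrow> real \<Rightarrow> real" where
  "bump x y P m z =
     (if x < z \<and> z < y
      then poly P z / ((z - x) * (y - z)) ^ m * exp (- 1 / ((z - x) * (y - z))) else 0)"

lemma exp_minus_inverse_le:
  fixes q :: real
  assumes "q > 0"
  shows "exp (- 1 / q) / q ^ m \<le> real (m + 2) ^ (m + 2) * q\<^sup>2"
proof -
  let ?N = "m + 2"
  have "(1 / (real ?N * q)) ^ ?N \<le> (1 + (1 / q) / real ?N) ^ ?N"
    using assms by (intro power_mono) (auto simp: field_simps)
  also have "\<dots> \<le> exp (1 / q)"
    using assms by (intro exp_ge_one_plus_x_over_n_power_n) (auto intro: order_trans[of _ 0])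
  finally have "1 \<le> exp (1 / q) * (real ?N * q) ^ ?N"
    using assms by (simp add: power_one_over pos_divide_le_eq del: power_Suc power_Suc2 of_nat_add)
  hence "exp (- 1 / q) \<le> (real ?N * q) ^ ?N"
    using assms by (simp add: exp_minus field_simps del: power_Suc of_nat_add)
  also have "\<dots> = real ?N ^ ?N * q\<^sup>2 * q ^ m"
    by (simp add: power_mult_distrib power_add power2_eq_square del: of_nat_add)
  finally show ?thesis using assms by (simp add: pos_divide_le_eq)
qed

text \<open>The exponential beats the poles at \<open>x\<close> and \<open>y\<close>. The quadratic rate makes the bump differentiable at every point
outside \<open>(x, y)\<close>, the two end points included, with derivative zero.\<close>

lemma bump_quadratic_bound:
  assumes "x < y"
  shows "\<exists>C. \<forall>t z. (z \<le> x \<or> y \<le> z) \<longrightarrow> \<bar>bump x y P m t\<bar> \<le> C * (t - z)\<^sup>2"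
proof -
  have "continuous_on {x..y} (poly P)" by (intro continuous_intros)
  hence "bounded (poly P ` {x..y})" by (simp add: compact_imp_bounded compact_continuous_image)
  then obtain K where K: "\<And>t. t \<in> {x..y} \<Longrightarrow> \<bar>poly P t\<bar> \<le> K"
    by (metis bounded_iff image_eqI real_norm_def)
  define N where "N = real (m + 2) ^ (m + 2)"
  have "K \<ge> 0" using K[of x] assms by auto
  have "\<bar>bump x y P m t\<bar> \<le> K * N * (y - x)\<^sup>2 * (t - z)\<^sup>2" if z: "z \<le> x \<or> y \<le> z" for t z
  proof (cases "x < t \<and> t < y")
    case True
    let ?q = "(t - x) * (y - t)"
    have q: "?q > 0" using True by simp
    have "\<bar>bump x y P m t\<bar> = \<bar>poly P t\<bar> * (exp (- 1 / ?q) / ?q ^ m)"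
      using True q by (simp add: bump_def abs_mult)
    also have "\<dots> \<le> K * (N * ?q\<^sup>2)"
      using K[of t] True exp_minus_inverse_le[OF q] q unfolding N_def
      by (intro mult_mono) auto
    also have "?q \<le> \<bar>(y - x) * (t - z)\<bar>"
    proof -
      from z consider "z \<le> x" | "y \<le> z" by blast
      thus ?thesis
      proof cases
        case 1
        have "?q \<le> (t - z) * (y - x)" using True 1 by (intro mult_mono) auto
        thus ?thesis by (simp add: mult.commute)
      next
        case 2
        have "?q \<le> (y - x) * (z - t)" using True 2 by (intro mult_mono) auto
        also have "\<dots> \<le> \<bar>(y - x) * (t - z)\<bar>" using abs_ge_minus_self[of "(y - x) * (t - z)"]
          by (simp add: algebra_simps)
        finally show ?thesis .
      qed
    qed
    hence "?q\<^sup>2 \<le> ((y - x) * (t - z))\<^sup>2" using q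
      using abs_le_square_iff[of ?q "(y - x) * (t - z)"] by simp
    hence "K * (N * ?q\<^sup>2) \<le> K * (N * ((y - x) * (t - z))\<^sup>2)"
      using \<open>K \<ge> 0\<close> by (intro mult_left_mono) (auto simp: N_def)
    finally show ?thesis by (simp add: power_mult_distrib mult_ac)
  next
    case False
    thus ?thesis using \<open>K \<ge> 0\<close> by (auto simp: bump_def N_def)
  qed
  thus ?thesis by blast
qed

lemma bump_has_derivative:
  assumes "x < y"
  shows "\<exists>P'. \<forall>z. (bump x y P m has_real_derivative bump x y P' (m + 2) z) (at z)"
proof -
  define Q where "Q = [:- (x * y), x + y, - 1:]"
  define P' where "P' = pderiv Q * P + pderiv P * Q\<^sup>2 - smult (real m) (P * pderiv Q * Q)"
  have Q: "poly Q z = (z - x) * (y - z)" for z by (simp add: Q_def algebra_simps)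
  have "(bump x y P m has_real_derivative bump x y P' (m + 2) z) (at z)" for z
  proof (cases "x < z \<and> z < y")
    case True
    define q q' where "q = poly Q z" and "q' = poly (pderiv Q) z"
    have q: "q > 0" using True by (simp add: q_def Q)
    have "((\<lambda>z. poly P z / poly Q z ^ m * exp (- 1 / poly Q z)) has_real_derivative
        (poly (pderiv P) z * q ^ m - poly P z * (real m * q ^ (m - 1) * q')) / (q ^ m * q ^ m)
          * exp (- 1 / q) + poly P z / q ^ m * (exp (- 1 / q) * (q' / q\<^sup>2))) (at z)"
      unfolding q_def q'_def using q[unfolded q_def]
      by (auto intro!: derivative_eq_intros poly_DERIV simp: power2_eq_square divide_simps)
         (auto simp: algebra_simps)
    also have "(poly (pderiv P) z * q ^ m - poly P z * (real m * q ^ (m - 1) * q')) / (q ^ m * q ^ m)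
          * exp (- 1 / q) + poly P z / q ^ m * (exp (- 1 / q) * (q' / q\<^sup>2))
        = poly P' z / q ^ (m + 2) * exp (- 1 / q)"
    proof (cases m)
      case 0
      thus ?thesis using q by (simp add: P'_def q_def[symmetric] q'_def[symmetric] power2_eq_square field_simps)
    next
      case (Suc i)
      thus ?thesis using q
        by (simp add: P'_def q_def[symmetric] q'_def[symmetric] power2_eq_square field_simps)
    qed
    also have "\<dots> = bump x y P' (m + 2) z" using True by (simp add: bump_def q_def Q)
    finally have *: "((\<lambda>z. poly P z / poly Q z ^ m * exp (- 1 / poly Q z)) has_real_derivative
      bump x y P' (m + 2) z) (at z)" .
    show ?thesis
    proof (rule has_field_derivative_transform_within_open[OF *])
      show "open {x<..<y}" "z \<in> {x<..<y}" using True by auto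
    qed (auto simp: bump_def Q)
  next
    case False
    then obtain C where C: "\<And>t. \<bar>bump x y P m t\<bar> \<le> C * (t - z)\<^sup>2"
      using bump_quadratic_bound[OF assms, of P m] by (metis linorder_not_le)
    have "((\<lambda>t. (bump x y P m t - bump x y P m z) / (t - z)) \<longlongrightarrow> 0) (at z)"
    proof (rule Lim_null_comparison)
      show "((\<lambda>t. C * \<bar>t - z\<bar>) \<longlongrightarrow> 0) (at z)"
        by (auto intro!: tendsto_eq_intros)
      show "\<forall>\<^sub>F t in at z. norm ((bump x y P m t - bump x y P m z) / (t - z)) \<le> C * \<bar>t - z\<bar>"
        using eventually_neq_at_within[of z z UNIV]
      proof eventually_elim
        case (elim t)
        have "bump x y P m z = 0" using False by (auto simp: bump_def)
        thus ?case using C[of t] elim by (simp add: pos_divide_le_eq power2_eq_square mult.assoc flip: abs_mult)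
      qed
    qed
    hence "(bump x y P m has_real_derivative 0) (at z)" by (simp add: has_field_derivative_iff)
    moreover have "bump x y P' (m + 2) z = 0" using False by (auto simp: bump_def)
    ultimately show ?thesis by simp
  qed
  thus ?thesis by blast
qed

definition smooth :: "(real \<Rightarrow> real) \<Rightarrow> bool" where
  "smooth f \<longleftrightarrow> (\<forall>n x. (deriv ^^ n) f field_differentiable at x)"

lemma smooth_iff_deriv: "smooth f \<longleftrightarrow> (\<forall>x. f field_differentiable at x) \<and> smooth (deriv f)"
proof -
  have "(\<forall>n. Q n) \<longleftrightarrow> Q 0 \<and> (\<forall>n. Q (Suc n))" for Q :: "nat \<Rightarrow> bool" by (metis not0_implies_Suc)
  from this[of "\<lambda>n. \<forall>x. (deriv ^^ n) f field_differentiable at x"] show ?thesis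
    unfolding smooth_def by (simp add: funpow_swap1)
qed

lemma smooth_has_derivative: "smooth f \<Longrightarrow> (f has_real_derivative deriv f x) (at x)"
  using smooth_iff_deriv[of f] by (simp add: DERIV_deriv_iff_field_differentiable)

lemma smooth_antiderivative:
  assumes "\<And>x. (f has_real_derivative g x) (at x)" and "smooth g"
  shows "smooth f"
proof -
  have "deriv f = g" using assms(1) by (auto intro: DERIV_imp_deriv)
  thus ?thesis using assms smooth_iff_deriv[of f] by (auto simp: field_differentiable_def)
qed

lemma deriv_funpow_diff:
  assumes "smooth f" and "smooth g"
  shows "(deriv ^^ n) (\<lambda>x. f x - g x) = (\<lambda>x. (deriv ^^ n) f x - (deriv ^^ n) g x)"
  using assms
proof (induction n arbitrary: f g)
  case (Suc n)
  have "deriv (\<lambda>x. f x - g x) = (\<lambda>x. deriv f x - deriv g x)"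
    using smooth_has_derivative[OF Suc.prems(1)] smooth_has_derivative[OF Suc.prems(2)]
    by (intro ext DERIV_imp_deriv derivative_intros)
  moreover have "smooth (deriv f)" "smooth (deriv g)" using Suc.prems smooth_iff_deriv by blast+
  ultimately show ?case using Suc.IH[of "deriv f" "deriv g"] by (simp add: funpow_swap1)
qed simp

lemma smooth_diff: "smooth f \<Longrightarrow> smooth g \<Longrightarrow> smooth (\<lambda>x. f x - g x)"
  using deriv_funpow_diff[of f g] unfolding smooth_def[of "\<lambda>x. f x - g x"]
  by (auto simp: smooth_def intro!: field_differentiable_diff)

lemma smooth_bump:
  assumes "x < y"
  shows "smooth (bump x y P m)"
proof -
  have "\<exists>P' m'. (deriv ^^ n) (bump x y P m) = bump x y P' m'" for n
  proof (induction n)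
    case (Suc n)
    then obtain P1 m1 where 1: "(deriv ^^ n) (bump x y P m) = bump x y P1 m1" by blast
    obtain P2 where "\<And>z. (bump x y P1 m1 has_real_derivative bump x y P2 (m1 + 2) z) (at z)"
      using bump_has_derivative[OF assms] by blast
    hence "deriv (bump x y P1 m1) = bump x y P2 (m1 + 2)" by (auto intro: DERIV_imp_deriv)
    thus ?case using 1 by auto
  qed auto
  thus ?thesis unfolding smooth_def field_differentiable_def
    by (metis bump_has_derivative[OF assms])
qed

text \<open>The step is the normalised antiderivative of a bump.\<close>

lemma smooth_step_exists:
  assumes "x < y"
  obtains S where "smooth S" "\<And>z. z \<le> x \<Longrightarrow> S z = 0" "\<And>z. y \<le> z \<Longrightarrow> S z = 1"
    "\<And>z. 0 \<le> S z" "\<And>z. S z \<le> 1" "\<And>z. 0 \<le> deriv S z"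
    "\<And>z. z \<le> x \<or> y \<le> z \<Longrightarrow> deriv S z = 0"
proof -
  let ?\<beta> = "bump x y 1 0"
  have \<beta>: "?\<beta> z \<ge> 0" "x < z \<Longrightarrow> z < y \<Longrightarrow> ?\<beta> z > 0" "z \<le> x \<or> y \<le> z \<Longrightarrow> ?\<beta> z = 0" for z
    by (auto simp: bump_def)
  have cont: "continuous_on UNIV ?\<beta>"
    using smooth_has_derivative[OF smooth_bump[OF assms]]
    by (meson DERIV_isCont continuous_at_imp_continuous_on)
  have "\<exists>F. \<forall>z. (F has_real_derivative ?\<beta> z) (at z)"
    using einterval_antiderivative[of "- \<infinity>" "\<infinity>" ?\<beta>] cont
    by (simp add: continuous_on_eq_continuous_at has_real_derivative_iff_has_vector_derivative)
  then obtain F where F: "\<And>z. (F has_real_derivative ?\<beta> z) (at z)" by blast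
  have mono: "F u \<le> F w" if "u \<le> w" for u w
    using that by (rule DERIV_nonneg_imp_nondecreasing) (use F \<beta>(1) in blast)
  have "continuous_on {x..y} F" by (meson F DERIV_isCont continuous_at_imp_continuous_on)
  hence lt: "F x < F y"
    using F \<beta>(2) by (intro DERIV_pos_imp_increasing_open[OF assms]) blast+
  have const: "F u = F w" if "u \<le> w" "w \<le> x \<or> y \<le> u" for u w
  proof (cases "u = w")
    case False
    hence "u < w" using that by simp
    then obtain z where "z > u" "z < w" "F w - F u = (w - u) * ?\<beta> z"
      using MVT2[of u w F ?\<beta>] F by blast
    thus ?thesis using \<beta>(3)[of z] that by auto
  qed simp
  define S where "S z = (1 / (F y - F x)) * (F z - F x)" for z
  have S': "(S has_real_derivative (1 / (F y - F x)) * ?\<beta> z) (at z)" for z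
    unfolding S_def using lt by (auto intro!: derivative_eq_intros F)
  hence dS: "deriv S z = (1 / (F y - F x)) * ?\<beta> z" for z by (rule DERIV_imp_deriv)
  have smooth: "smooth S"
  proof (rule smooth_antiderivative[OF S'])
    have "(\<lambda>z. (1 / (F y - F x)) * ?\<beta> z) = bump x y [:1 / (F y - F x):] 0"
      by (simp add: fun_eq_iff bump_def)
    thus "smooth (\<lambda>z. (1 / (F y - F x)) * ?\<beta> z)" by (simp only: smooth_bump[OF assms])
  qed
  have left: "S z = 0" if "z \<le> x" for z
  proof -
    have "F z = F x" using that by (intro const) auto
    thus ?thesis by (simp add: S_def)
  qed
  have right: "S z = 1" if "y \<le> z" for z
  proof -
    have "F y = F z" using that by (intro const) auto
    thus ?thesis using lt by (simp add: S_def)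
  qed
  have nonneg: "0 \<le> S z" for z
  proof (cases "z \<le> x")
    case False
    hence "F x \<le> F z" by (intro mono) simp
    thus ?thesis using lt by (simp add: S_def)
  qed (simp add: left)
  have le_one: "S z \<le> 1" for z
  proof (cases "y \<le> z")
    case False
    hence "F z \<le> F y" by (intro mono) simp
    thus ?thesis using lt by (simp add: S_def)
  qed (simp add: right)
  have "0 \<le> 1 / (F y - F x)" using lt by simp
  hence d_nonneg: "0 \<le> deriv S z" for z unfolding dS using \<beta>(1) by (rule mult_nonneg_nonneg)
  have d_zero: "deriv S z = 0" if "z \<le> x \<or> y \<le> z" for z
    unfolding dS using \<beta>(3)[OF that] by simp
  show thesis
    by (rule that[OF smooth left right nonneg le_one d_nonneg d_zero])
qed


section \<open>Weak derivatives tested against cut-off functions\<close>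

definition test_pairing :: "real \<Rightarrow> real \<Rightarrow> (real \<Rightarrow> real) \<Rightarrow> (real \<Rightarrow> real) \<Rightarrow> real" where
  "test_pairing a b u \<psi> = (LINT x:{a<..<b}|lebesgue. u x * \<psi> x)"

lemma has_weak_derivD:
  "has_weak_deriv a b l u g \<Longrightarrow> test_function a b \<psi> \<Longrightarrow>
     test_pairing a b u ((deriv ^^ l) \<psi>) = (- 1) ^ l * test_pairing a b g \<psi>"
  by (simp add: has_weak_deriv_def test_pairing_def)

lemma has_weak_derivI:
  assumes "locally_integrable a b u" "locally_integrable a b g"
    and "\<And>\<psi>. test_function a b \<psi> \<Longrightarrow>
           test_pairing a b u ((deriv ^^ l) \<psi>) = (- 1) ^ l * test_pairing a b g \<psi>"
  shows "has_weak_deriv a b l u g"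
  using assms by (simp add: has_weak_deriv_def test_pairing_def)

lemma has_weak_deriv_locally_integrable:
  assumes "has_weak_deriv a b l u g"
  shows "locally_integrable a b u" "locally_integrable a b g"
  using assms by (simp_all add: has_weak_deriv_def)

lemma test_function_smooth: "test_function a b \<psi> \<Longrightarrow> smooth \<psi>"
  by (simp add: test_function_def smooth_def)

lemma smooth_continuous: "smooth f \<Longrightarrow> continuous_on S f"
  by (meson smooth_has_derivative DERIV_isCont continuous_at_imp_continuous_on)

lemma test_function_continuous: "test_function a b \<psi> \<Longrightarrow> continuous_on S \<psi>"
  by (rule smooth_continuous[OF test_function_smooth])

lemma test_function_deriv:
  assumes "test_function a b \<psi>"
  shows "test_function a b (deriv \<psi>)"
proof -
  let ?S = "closure {x. \<psi> x \<noteq> 0}"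
  have "deriv \<psi> z = 0" if "z \<notin> ?S" for z
  proof -
    have "((\<lambda>_. 0) has_real_derivative 0) (at z)" by simp
    hence "(\<psi> has_real_derivative 0) (at z)"
      by (rule has_field_derivative_transform_within_open[of _ _ _ "- ?S"])
         (use that closure_subset[of "{x. \<psi> x \<noteq> 0}"] in auto)
    thus ?thesis by (rule DERIV_imp_deriv)
  qed
  hence sub: "closure {x. deriv \<psi> x \<noteq> 0} \<subseteq> ?S"
    by (intro closure_minimal) auto
  have "smooth (deriv \<psi>)" using test_function_smooth[OF assms] smooth_iff_deriv by blast
  moreover have "compact (closure {x. deriv \<psi> x \<noteq> 0})"
    using assms sub by (metis closed_closure compact_Int_closed inf.absorb_iff2 test_function_def)
  ultimately show ?thesis using assms sub unfolding test_function_def smooth_def by blast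
qed

lemma test_function_funpow_deriv: "test_function a b \<psi> \<Longrightarrow> test_function a b ((deriv ^^ n) \<psi>)"
  by (induction n) (auto intro: test_function_deriv)

lemma set_integrable_mult_test_function:
  assumes u: "locally_integrable a b u" and \<psi>: "test_function a b \<psi>"
  shows "set_integrable lebesgue {a<..<b} (\<lambda>x. u x * \<psi> x)"
proof -
  define K where "K = closure {x. \<psi> x \<noteq> 0}"
  have K: "compact K" "K \<subseteq> {a<..<b}" using \<psi> by (auto simp: K_def test_function_def)
  have uK: "set_integrable lebesgue K u" using u K by (auto simp: locally_integrable_def)
  have zero: "\<psi> x = 0" if "x \<notin> K" for x
    using that closure_subset[of "{x. \<psi> x \<noteq> 0}"] by (auto simp: K_def)
  have "bounded (\<psi> ` K)"
    by (intro compact_imp_bounded compact_continuous_image K(1) test_function_continuous[OF \<psi>])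
  then obtain B where B: "\<And>x. x \<in> K \<Longrightarrow> \<bar>\<psi> x\<bar> \<le> B"
    by (metis bounded_iff image_eqI real_norm_def)
  have eq: "(\<lambda>x. indicator {a<..<b} x *\<^sub>R (u x * \<psi> x)) = (\<lambda>x. \<psi> x * (indicator K x *\<^sub>R u x))"
    using K(2) zero by (intro ext) (auto simp: indicator_def)
  have "\<psi> \<in> borel_measurable borel"
    by (intro borel_measurable_continuous_onI test_function_continuous[OF \<psi>])
  hence m: "\<psi> \<in> borel_measurable lebesgue"
    by (simp add: measurable_completion)
  show ?thesis unfolding set_integrable_def eq
  proof (rule Bochner_Integration.integrable_bound)
    show "integrable lebesgue (\<lambda>x. B * (indicator K x *\<^sub>R u x))"
      using uK unfolding set_integrable_def by (intro integrable_mult_right)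
    show "(\<lambda>x. \<psi> x * (indicator K x *\<^sub>R u x)) \<in> borel_measurable lebesgue"
      using uK m unfolding set_integrable_def by (intro borel_measurable_times) auto
    show "AE x in lebesgue. norm (\<psi> x * (indicator K x *\<^sub>R u x)) \<le> norm (B * (indicator K x *\<^sub>R u x))"
      by (intro AE_I2) (auto simp: abs_mult indicator_def intro!: mult_right_mono order_trans[OF B])
  qed
qed

lemma continuous_imp_locally_integrable:
  fixes u :: "real \<Rightarrow> real"
  assumes "continuous_on {a..b} u"
  shows "locally_integrable a b u"
  unfolding locally_integrable_def
proof safe
  fix K assume K: "compact K" "K \<subseteq> {a<..<b}"
  have "continuous_on K u" using K(2) by (intro continuous_on_subset[OF assms]) auto
  hence "integrable lborel (\<lambda>x. indicator K x *\<^sub>R u x)"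
    by (rule borel_integrable_compact[OF K(1)])
  thus "set_integrable lebesgue K u"
    unfolding set_integrable_def
    by (subst integrable_completion) auto
qed

lemma locally_integrable_diff:
  "locally_integrable a b u \<Longrightarrow> locally_integrable a b w \<Longrightarrow> locally_integrable a b (\<lambda>x. u x - w x)"
  unfolding locally_integrable_def by (auto intro: set_integral_diff)

lemma locally_integrable_divide:
  "locally_integrable a b u \<Longrightarrow> locally_integrable a b (\<lambda>x. u x / c)"
  unfolding locally_integrable_def by auto

lemma test_pairing_diff:
  assumes "locally_integrable a b u" "locally_integrable a b w" "test_function a b \<psi>"
  shows "test_pairing a b (\<lambda>x. u x - w x) \<psi> = test_pairing a b u \<psi> - test_pairing a b w \<psi>"
  using set_integral_diff(2)[OF set_integrable_mult_test_function[OF assms(1,3)]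
      set_integrable_mult_test_function[OF assms(2,3)]]
  by (simp add: test_pairing_def left_diff_distrib)

lemma test_pairing_divide:
  "test_pairing a b (\<lambda>x. u x / c) \<psi> = test_pairing a b u \<psi> / c"
  by (simp add: test_pairing_def)

lemma has_weak_deriv_diff:
  assumes "has_weak_deriv a b l u g" "has_weak_deriv a b l w k"
  shows "has_weak_deriv a b l (\<lambda>x. u x - w x) (\<lambda>x. g x - k x)"
  using has_weak_deriv_locally_integrable[OF assms(1)] has_weak_deriv_locally_integrable[OF assms(2)]
  by (intro has_weak_derivI locally_integrable_diff)
     (auto simp: test_pairing_diff test_function_funpow_deriv has_weak_derivD[OF assms(1)]
        has_weak_derivD[OF assms(2)] right_diff_distrib)

text \<open>If \<open>\<psi>\<close> is a test function, so is \<open>\<psi>'\<close>. A ladder of weak derivatives of one function is therefore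
a chain of first-order weak derivatives.\<close>

lemma has_weak_deriv_Suc:
  assumes "has_weak_deriv a b l u g" "has_weak_deriv a b (Suc l) u k"
  shows "has_weak_deriv a b 1 g k"
proof (rule has_weak_derivI)
  fix \<psi> assume \<psi>: "test_function a b \<psi>"
  have "(- 1) ^ l * test_pairing a b g (deriv \<psi>) = test_pairing a b u ((deriv ^^ l) (deriv \<psi>))"
    using has_weak_derivD[OF assms(1) test_function_deriv[OF \<psi>]] by simp
  also have "\<dots> = (- 1) ^ l * ((- 1) ^ 1 * test_pairing a b k \<psi>)"
    using has_weak_derivD[OF assms(2) \<psi>] by (simp add: funpow_swap1)
  finally show "test_pairing a b g ((deriv ^^ 1) \<psi>) = (- 1) ^ 1 * test_pairing a b k \<psi>"
    by (subst (asm) mult_left_cancel) auto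
qed (use assms has_weak_deriv_locally_integrable in blast)+

lemma has_weak_deriv_cong_test:
  assumes "has_weak_deriv a b 0 u w" "has_weak_deriv a b l u g"
  shows "has_weak_deriv a b l w g"
  using has_weak_deriv_locally_integrable[OF assms(1)] has_weak_deriv_locally_integrable[OF assms(2)]
    has_weak_derivD[OF assms(1) test_function_funpow_deriv] has_weak_derivD[OF assms(2)]
  by (intro has_weak_derivI) auto

lemma has_weak_deriv_refl: "locally_integrable a b u \<Longrightarrow> has_weak_deriv a b 0 u u"
  by (rule has_weak_derivI) auto

lemma test_pairing_continuous:
  assumes "continuous_on {a..b} u" "continuous_on {a..b} \<psi>"
  shows "test_pairing a b u \<psi> = integral {a..b} (\<lambda>x. u x * \<psi> x)"
proof -
  have "continuous_on {a..b} (\<lambda>x. u x * \<psi> x)" by (intro continuous_intros assms)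
  hence "set_integrable lborel {a..b} (\<lambda>x. u x * \<psi> x)"
    unfolding set_integrable_def by (intro borel_integrable_compact) auto
  hence "set_integrable lborel {a<..<b} (\<lambda>x. u x * \<psi> x)"
    by (rule set_integrable_subset) auto
  hence "set_integrable lebesgue {a<..<b} (\<lambda>x. u x * \<psi> x)"
    unfolding set_integrable_def by (subst integrable_completion) auto
  thus ?thesis
    by (simp add: test_pairing_def set_lebesgue_integral_eq_integral integral_open_interval_real)
qed

lemma Linf_norm_le_imp_AE:
  assumes "Linf_norm a b g \<le> ereal K"
  shows "AE x in lebesgue. x \<in> {a<..<b} \<longrightarrow> \<bar>g x\<bar> \<le> K"
proof -
  have "AE x in lebesgue_on {a<..<b}. ereal \<bar>g x\<bar> \<le> ereal K"
    using esssup_AE[of "\<lambda>x. ereal \<bar>g x\<bar>" "lebesgue_on {a<..<b}"] assms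
    unfolding Linf_norm_def by (elim eventually_mono) (rule order_trans)
  thus ?thesis by (subst (asm) AE_restrict_space_iff) auto
qed

lemma abs_test_pairing_le:
  assumes g: "locally_integrable a b g" and \<psi>: "test_function a b \<psi>"
    and le: "Linf_norm a b g \<le> ereal K"
  shows "\<bar>test_pairing a b g \<psi>\<bar> \<le> K * integral {a..b} (\<lambda>x. \<bar>\<psi> x\<bar>)"
proof -
  note ae = Linf_norm_le_imp_AE[OF le]
  have c: "continuous_on {a..b} (\<lambda>x. \<bar>\<psi> x\<bar>)"
    by (intro continuous_intros test_function_continuous[OF \<psi>])
  have i: "set_integrable lebesgue {a<..<b} (\<lambda>x. K * \<bar>\<psi> x\<bar>)"
  proof -
    have "set_integrable lborel {a..b} (\<lambda>x. K * \<bar>\<psi> x\<bar>)"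
      unfolding set_integrable_def by (intro borel_integrable_compact continuous_intros c) auto
    hence "set_integrable lborel {a<..<b} (\<lambda>x. K * \<bar>\<psi> x\<bar>)"
      by (rule set_integrable_subset) auto
    thus ?thesis unfolding set_integrable_def by (subst integrable_completion) auto
  qed
  have "\<bar>test_pairing a b g \<psi>\<bar> \<le> (LINT x:{a<..<b}|lebesgue. \<bar>g x * \<psi> x\<bar>)"
    using set_integral_norm_bound[OF set_integrable_mult_test_function[OF g \<psi>]]
    by (simp add: test_pairing_def)
  also have "\<dots> \<le> (LINT x:{a<..<b}|lebesgue. K * \<bar>\<psi> x\<bar>)"
    using ae by (intro set_integral_mono_AE set_integrable_abs set_integrable_mult_test_function[OF g \<psi>] i)
      (auto simp: abs_mult elim!: eventually_mono intro: mult_right_mono)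
  also have "\<dots> = K * integral {a..b} (\<lambda>x. \<bar>\<psi> x\<bar>)"
    using test_pairing_continuous[of a b "\<lambda>_. K" "\<lambda>x. \<bar>\<psi> x\<bar>"] c
    by (simp add: test_pairing_def)
  finally show ?thesis .
qed

text \<open>The norm is that of the representative chosen by \<open>weak_deriv\<close>; every other weak derivative \<open>g\<close> has the same pairings.\<close>

lemma sobolev_norm_test_bound:
  assumes "has_weak_deriv a b l f g" and "l \<le> m" and "sobolev_norm a b m f \<le> ereal K"
    and \<psi>: "test_function a b \<psi>"
  shows "\<bar>test_pairing a b g \<psi>\<bar> \<le> K * integral {a..b} (\<lambda>x. \<bar>\<psi> x\<bar>)"
proof -
  have w: "has_weak_deriv a b l f (weak_deriv a b l f)"
    unfolding weak_deriv_def by (rule someI[of "has_weak_deriv a b l f", OF assms(1)])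
  have "test_pairing a b g \<psi> = test_pairing a b (weak_deriv a b l f) \<psi>"
    using has_weak_derivD[OF assms(1) \<psi>] has_weak_derivD[OF w \<psi>] by simp
  moreover have "Linf_norm a b (weak_deriv a b l f) \<le> ereal K"
    using assms(2,3) unfolding sobolev_norm_def
    by (meson SUP_upper atMost_iff order_trans)
  ultimately show ?thesis
    using abs_test_pairing_le[OF has_weak_deriv_locally_integrable(2)[OF w] \<psi>] by simp
qed

text \<open>The difference of an upward step on \<open>(x, x')\<close> and one on \<open>(y', y)\<close> is a smoothed indicator function of \<open>[x, y]\<close>.\<close>

lemma plateau_test_function:
  assumes "a < x" "x < x'" "x' \<le> y'" "y' < y" "y < b"
    and S: "smooth S" "\<And>z. z \<le> x \<Longrightarrow> S z = 0" "\<And>z. x' \<le> z \<Longrightarrow> S z = 1" "\<And>z. 0 \<le> S z" "\<And>z. S z \<le> 1"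
    and R: "smooth R" "\<And>z. z \<le> y' \<Longrightarrow> R z = 0" "\<And>z. y \<le> z \<Longrightarrow> R z = 1" "\<And>z. 0 \<le> R z" "\<And>z. R z \<le> 1"
  shows "test_function a b (\<lambda>z. S z - R z)" "0 \<le> S z - R z" "S z - R z \<le> 1"
    "z \<in> {x'..y'} \<Longrightarrow> S z - R z = 1" "z \<notin> {x<..<y} \<Longrightarrow> S z - R z = 0"
proof -
  have zero: "S z - R z = 0" if "z \<notin> {x<..<y}" for z
    using that S(2)[of z] R(2)[of z] S(3)[of z] R(3)[of z] assms(1-5) by force
  have sub: "closure {z. S z - R z \<noteq> 0} \<subseteq> {x..y}"
  proof (rule closure_minimal)
    show "{z. S z - R z \<noteq> 0} \<subseteq> {x..y}"
    proof
      fix t assume "t \<in> {z. S z - R z \<noteq> 0}"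
      thus "t \<in> {x..y}" using zero[of t] by force
    qed
  qed simp
  moreover have "compact (closure {z. S z - R z \<noteq> 0})"
    using sub by (metis closed_closure compact_Icc compact_Int_closed inf.absorb_iff2)
  moreover have "{x..y} \<subseteq> {a<..<b}" using assms by auto
  ultimately show "test_function a b (\<lambda>z. S z - R z)"
    using smooth_diff[OF S(1) R(1)] unfolding test_function_def smooth_def by blast
  show "0 \<le> S z - R z"
    using S(3)[of z] S(4)[of z] R(5)[of z] R(2)[of z] assms by (cases "z \<le> y'") auto
  show "S z - R z \<le> 1" using S(5)[of z] R(4)[of z] by linarith
  show "z \<in> {x'..y'} \<Longrightarrow> S z - R z = 1" using S(3)[of z] R(2)[of z] by simp
  show "z \<notin> {x<..<y} \<Longrightarrow> S z - R z = 0" by (rule zero)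
qed

lemma continuous_le_on_Icc:
  fixes u :: "real \<Rightarrow> real"
  assumes "a < b" "continuous_on {a..b} u" "\<And>x. x \<in> {a<..<b} \<Longrightarrow> u x \<le> K" "x \<in> {a..b}"
  shows "u x \<le> K"
proof -
  have "closure {a<..<b} = {a..b}" using assms(1) by simp
  thus ?thesis using continuous_le_on_closure[of "{a<..<b}" u x K] assms by simp
qed

text \<open>For continuous functions a bound in the sense of distributions is a pointwise one. This replaces the fundamental
lemma of the calculus of variations.\<close>

lemma continuous_le_if_test_le:
  assumes "a < b" and u: "continuous_on {a..b} u"
    and test: "\<And>\<psi>. test_function a b \<psi> \<Longrightarrow> (\<And>z. 0 \<le> \<psi> z) \<Longrightarrow>
      test_pairing a b u \<psi> \<le> K * integral {a..b} \<psi>"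
    and "x \<in> {a..b}"
  shows "u x \<le> K"
proof -
  have "u x \<le> K" if x: "x \<in> {a<..<b}" for x
  proof (rule ccontr)
    assume "\<not> u x \<le> K"
    define e where "e = (u x - K) / 2"
    have e: "e > 0" using \<open>\<not> u x \<le> K\<close> by (simp add: e_def)
    have "isCont u x" using u x by (simp add: continuous_on_interior)
    then obtain d0 where d0: "d0 > 0" "\<And>z. \<bar>z - x\<bar> < d0 \<Longrightarrow> \<bar>u z - u x\<bar> < e"
      using e unfolding continuous_at_eps_delta by (auto simp: dist_real_def)
    define d where "d = min (d0 / 2) (min ((x - a) / 2) ((b - x) / 2))"
    have d: "d > 0" "d < d0" "a < x - d" "x + d < b"
      using d0(1) x by (auto simp: d_def min_def field_simps)
    have less: "x - d < x - d / 2" "x + d / 2 < x + d" using d(1) by simp_all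
    obtain S where S: "smooth S" "\<And>z. z \<le> x - d \<Longrightarrow> S z = 0" "\<And>z. x - d / 2 \<le> z \<Longrightarrow> S z = 1"
      "\<And>z. 0 \<le> S z" "\<And>z. S z \<le> 1"
      by (rule smooth_step_exists[OF less(1)]) (rule that)
    obtain R where R: "smooth R" "\<And>z. z \<le> x + d / 2 \<Longrightarrow> R z = 0" "\<And>z. x + d \<le> z \<Longrightarrow> R z = 1"
      "\<And>z. 0 \<le> R z" "\<And>z. R z \<le> 1"
      by (rule smooth_step_exists[OF less(2)]) (rule that)
    define \<psi> where "\<psi> z = S z - R z" for z
    have "x - d / 2 \<le> x + d / 2" using d(1) by simp
    note \<psi> = plateau_test_function[OF d(3) less(1) this less(2) d(4) S R, folded \<psi>_def]
    have c: "continuous_on {a..b} \<psi>" by (rule test_function_continuous[OF \<psi>(1)])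
    have "(K + e) * integral {a..b} \<psi> = integral {a..b} (\<lambda>z. (K + e) * \<psi> z)" by simp
    also have "\<dots> \<le> integral {a..b} (\<lambda>z. u z * \<psi> z)"
    proof (rule integral_le)
      show "(\<lambda>z. (K + e) * \<psi> z) integrable_on {a..b}" "(\<lambda>z. u z * \<psi> z) integrable_on {a..b}"
        by (intro integrable_continuous_interval continuous_intros u c)+
      fix z assume "z \<in> {a..b}"
      show "(K + e) * \<psi> z \<le> u z * \<psi> z"
      proof (cases "z \<in> {x - d<..<x + d}")
        case True
        hence "\<bar>u z - u x\<bar> < e" using d(2) by (intro d0(2)) auto
        moreover have "u x = K + 2 * e" unfolding e_def by argo
        ultimately have "K + e \<le> u z" by linarith
        thus ?thesis using \<psi>(2)[of z] by (intro mult_right_mono) auto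
      qed (use \<psi>(5)[of z] in auto)
    qed
    also have "\<dots> \<le> K * integral {a..b} \<psi>"
      using test[OF \<psi>(1,2)] test_pairing_continuous[OF u c] by simp
    finally have "e * integral {a..b} \<psi> \<le> 0" by (simp add: algebra_simps)
    moreover have "integral {x - d / 2..x + d / 2} (\<lambda>_. 1 :: real) \<le> integral {a..b} \<psi>"
    proof -
      have "integral {x - d / 2..x + d / 2} (\<lambda>_. 1 :: real) = integral {x - d / 2..x + d / 2} \<psi>"
        using \<psi>(4) by (intro integral_cong) auto
      also have "\<dots> \<le> integral {a..b} \<psi>"
        using d \<psi>(2) by (intro integral_subset_le integrable_continuous_interval
            continuous_on_subset[OF c]) auto
      finally show ?thesis .
    qed
    ultimately show False using e d(1) by (simp add: mult_le_0_iff)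
  qed
  thus ?thesis using continuous_le_on_Icc[OF assms(1) u] assms(4) by blast
qed

lemma continuous_abs_le_if_test_le:
  assumes "a < b" and u: "continuous_on {a..b} u"
    and test: "\<And>\<psi>. test_function a b \<psi> \<Longrightarrow>
      \<bar>test_pairing a b u \<psi>\<bar> \<le> K * integral {a..b} (\<lambda>x. \<bar>\<psi> x\<bar>)"
    and "x \<in> {a..b}"
  shows "\<bar>u x\<bar> \<le> K"
proof -
  have "u x \<le> K"
  proof (rule continuous_le_if_test_le[OF assms(1) u _ assms(4)])
    fix \<psi> :: "real \<Rightarrow> real" assume "test_function a b \<psi>" "\<And>z. 0 \<le> \<psi> z"
    thus "test_pairing a b u \<psi> \<le> K * integral {a..b} \<psi>"
      using test[of \<psi>] by (simp add: abs_le_iff)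
  qed
  moreover have "- u x \<le> K"
  proof (rule continuous_le_if_test_le[OF assms(1) _ _ assms(4)])
    show "continuous_on {a..b} (\<lambda>x. - u x)" by (intro continuous_intros u)
    fix \<psi> :: "real \<Rightarrow> real" assume "test_function a b \<psi>" "\<And>z. 0 \<le> \<psi> z"
    thus "test_pairing a b (\<lambda>x. - u x) \<psi> \<le> K * integral {a..b} \<psi>"
      using test[of \<psi>] by (simp add: test_pairing_def abs_le_iff set_lebesgue_integral_def)
  qed
  ultimately show ?thesis by (simp add: abs_le_iff)
qed

lemma integral_zero_outside:
  fixes f :: "real \<Rightarrow> real"
  assumes "f integrable_on S" "\<And>x. x \<notin> S \<Longrightarrow> f x = 0" "S \<subseteq> T"
  shows "integral T f = integral S f"
  using has_integral_on_superset[OF integrable_integral[OF assms(1)] assms(2,3)]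
  by (simp add: integral_unique)

text \<open>The derivative of a steep step is an approximate unit mass.\<close>

lemma integral_smooth_step_deriv:
  fixes u :: "real \<Rightarrow> real"
  assumes "a < x" "x < x'" "x' < b" and S: "smooth S" "S x = 0" "S x' = 1"
    "\<And>z. 0 \<le> deriv S z" "\<And>z. z \<le> x \<or> x' \<le> z \<Longrightarrow> deriv S z = 0"
    and u: "continuous_on {a..b} u" and e: "\<And>z. z \<in> {x..x'} \<Longrightarrow> \<bar>u z - c\<bar> \<le> e"
  shows "\<bar>integral {a..b} (\<lambda>z. u z * deriv S z) - c\<bar> \<le> e"
proof -
  have cS: "continuous_on A (deriv S)" for A
    using S(1) smooth_iff_deriv smooth_continuous by blast
  have c: "continuous_on {x..x'} u" using assms(1,3) by (intro continuous_on_subset[OF u]) auto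
  have one: "(deriv S has_integral 1) {x..x'}"
    using fundamental_theorem_of_calculus[of x x' S "deriv S"] assms(2) S(2,3)
      smooth_has_derivative[OF S(1)]
    by (auto simp: has_real_derivative_iff_has_vector_derivative[symmetric]
        intro: has_field_derivative_at_within)
  have "integral {a..b} (\<lambda>z. u z * deriv S z) = integral {x..x'} (\<lambda>z. u z * deriv S z)"
    using assms(1,3) S(5)
    by (intro integral_zero_outside integrable_continuous_interval continuous_intros c cS) force+
  hence "integral {a..b} (\<lambda>z. u z * deriv S z) - c
      = integral {x..x'} (\<lambda>z. u z * deriv S z) - c * integral {x..x'} (deriv S)"
    using one by (simp add: integral_unique)
  also have "\<dots> = integral {x..x'} (\<lambda>z. (u z - c) * deriv S z)"
    by (simp add: left_diff_distrib)
       (subst integral_diff, auto intro!: integrable_continuous_interval continuous_intros c cS)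
  also have "\<bar>\<dots>\<bar> \<le> integral {x..x'} (\<lambda>z. e * deriv S z)"
  proof -
    have "norm (integral {x..x'} (\<lambda>z. (u z - c) * deriv S z)) \<le> integral {x..x'} (\<lambda>z. e * deriv S z)"
      using S(4) e by (intro integral_norm_bound_integral integrable_continuous_interval
          continuous_intros c cS) (auto simp: abs_mult intro!: mult_right_mono)
    thus ?thesis by simp
  qed
  also have "\<dots> = e" using one by (simp add: integral_unique)
  finally show ?thesis .
qed

text \<open>Testing with a smoothed indicator function \<open>\<psi>\<close> of \<open>[x, y]\<close>: the derivative \<open>\<psi>'\<close> is a unit mass near \<open>x\<close> minus
one near \<open>y\<close>, so \<open>- \<integral>u \<psi>'\<close> is close to \<open>u y - u x\<close>, while \<open>\<integral>g \<psi> \<le> K \<integral>\<psi>\<close> is close to \<open>K (y - x)\<close>.\<close>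

lemma weak_derivative_mean_value_inequality:
  assumes "a < b" and w: "has_weak_deriv a b 1 u g" and u: "continuous_on {a..b} u"
    and g: "AE z in lebesgue. z \<in> {x<..<y} \<longrightarrow> g z \<le> K"
    and "a < x" "x < y" "y < b"
  shows "u y - u x \<le> K * (y - x)"
proof (rule field_le_epsilon)
  fix e0 :: real assume e0: "e0 > 0"
  define e where "e = e0 / 4"
  have e: "e > 0" using e0 by (simp add: e_def)
  have "isCont u x" "isCont u y" using u assms(5-7) by (simp_all add: continuous_on_interior)
  then obtain d1 d2 where d1: "d1 > 0" "\<And>z. \<bar>z - x\<bar> < d1 \<Longrightarrow> \<bar>u z - u x\<bar> < e"
    and d2: "d2 > 0" "\<And>z. \<bar>z - y\<bar> < d2 \<Longrightarrow> \<bar>u z - u y\<bar> < e"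
    using e unfolding continuous_at_eps_delta by (metis dist_real_def)
  \<comment> \<open>The width of the two transition zones: \<open>u\<close> varies by at most \<open>e\<close> on each, and \<open>|K|\<close> times their total width is at most \<open>2 e\<close>.\<close>
  define d where "d = min (min (d1 / 2) (d2 / 2)) (min ((y - x) / 2) (e / (\<bar>K\<bar> + 1)))"
  have d: "d > 0" "d < d1" "d < d2" "2 * d \<le> y - x" "d * (\<bar>K\<bar> + 1) \<le> e"
  proof -
    show "d > 0" "d < d1" "d < d2" using d1(1) d2(1) assms(6) e by (auto simp: d_def)
    have "d \<le> (y - x) / 2" "d \<le> e / (\<bar>K\<bar> + 1)" unfolding d_def by linarith+
    thus "2 * d \<le> y - x" "d * (\<bar>K\<bar> + 1) \<le> e" by (auto simp: pos_le_divide_eq)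
  qed
  have less: "x < x + d" "x + d \<le> y - d" "y - d < y" using d(1,4) by simp_all
  obtain S where S: "smooth S" "\<And>z. z \<le> x \<Longrightarrow> S z = 0" "\<And>z. x + d \<le> z \<Longrightarrow> S z = 1"
    "\<And>z. 0 \<le> S z" "\<And>z. S z \<le> 1"
    and S': "\<And>z. 0 \<le> deriv S z" "\<And>z. z \<le> x \<or> x + d \<le> z \<Longrightarrow> deriv S z = 0"
    by (rule smooth_step_exists[OF less(1)]) (rule that)
  obtain R where R: "smooth R" "\<And>z. z \<le> y - d \<Longrightarrow> R z = 0" "\<And>z. y \<le> z \<Longrightarrow> R z = 1"
    "\<And>z. 0 \<le> R z" "\<And>z. R z \<le> 1"
    and R': "\<And>z. 0 \<le> deriv R z" "\<And>z. z \<le> y - d \<or> y \<le> z \<Longrightarrow> deriv R z = 0"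
    by (rule smooth_step_exists[OF less(3)]) (rule that)
  define \<psi> where "\<psi> z = S z - R z" for z
  note \<psi> = plateau_test_function[OF assms(5) less assms(7) S R, folded \<psi>_def]
  have d\<psi>: "deriv \<psi> = (\<lambda>z. deriv S z - deriv R z)"
    using deriv_funpow_diff[OF S(1) R(1), of 1] by (simp add: \<psi>_def[abs_def])
  have c: "continuous_on A \<psi>" "continuous_on A (deriv S)" "continuous_on A (deriv R)" for A
    using test_function_continuous[OF \<psi>(1)] S(1) R(1) smooth_iff_deriv smooth_continuous by blast+
  have "test_pairing a b u (deriv \<psi>) = integral {a..b} (\<lambda>z. u z * deriv \<psi> z)"
    using c unfolding d\<psi> by (intro test_pairing_continuous[OF u] continuous_intros)
  also have "\<dots> = integral {a..b} (\<lambda>z. u z * deriv S z) - integral {a..b} (\<lambda>z. u z * deriv R z)"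
    unfolding d\<psi> right_diff_distrib
    by (intro integral_diff integrable_continuous_interval continuous_intros u c)
  finally have A: "test_pairing a b u (deriv \<psi>)
      = integral {a..b} (\<lambda>z. u z * deriv S z) - integral {a..b} (\<lambda>z. u z * deriv R z)" .
  have B: "\<bar>integral {a..b} (\<lambda>z. u z * deriv S z) - u x\<bar> \<le> e"
    using d assms(5-7) S' S(1,2,3) d1(2)
    by (intro integral_smooth_step_deriv[of a x "x + d"] u) (auto intro!: less_imp_le[OF d1(2)])
  have C: "\<bar>integral {a..b} (\<lambda>z. u z * deriv R z) - u y\<bar> \<le> e"
    using d assms(5-7) R' R(1,2,3) d2(2)
    by (intro integral_smooth_step_deriv[of a "y - d" y] u) (auto intro!: less_imp_le[OF d2(2)])
  have int\<psi>: "\<bar>integral {a..b} \<psi> - (y - x)\<bar> \<le> 2 * d"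
  proof -
    have "integral {x + d..y - d} (\<lambda>_. 1 :: real) = integral {x + d..y - d} \<psi>"
      using \<psi>(4) by (intro integral_cong) auto
    also have "\<dots> \<le> integral {a..b} \<psi>"
      using d \<psi>(2) assms(5-7) by (intro integral_subset_le integrable_continuous_interval c) auto
    finally have 1: "y - x - 2 * d \<le> integral {a..b} \<psi>" using d by simp
    have "integral {a..b} \<psi> = integral {x..y} \<psi>"
      using assms(5,7) \<psi>(5)
      by (intro integral_zero_outside integrable_continuous_interval c) (force simp del: not_less)+
    also have "\<dots> \<le> integral {x..y} (\<lambda>_. 1)"
      using \<psi>(3) by (intro integral_le integrable_continuous_interval c) auto
    finally show ?thesis using 1 d(1) assms(6) by simp
  qed
  have "- test_pairing a b u (deriv \<psi>) = test_pairing a b g \<psi>"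
    using has_weak_derivD[OF w \<psi>(1)] by simp
  also have "\<dots> \<le> test_pairing a b (\<lambda>_. K) \<psi>"
    unfolding test_pairing_def
  proof (rule set_integral_mono_AE)
    show "set_integrable lebesgue {a<..<b} (\<lambda>z. g z * \<psi> z)"
      by (rule set_integrable_mult_test_function[OF has_weak_deriv_locally_integrable(2)[OF w] \<psi>(1)])
    show "set_integrable lebesgue {a<..<b} (\<lambda>z. K * \<psi> z)"
      by (rule set_integrable_mult_test_function[OF continuous_imp_locally_integrable \<psi>(1)])
         (rule continuous_on_const)
    show "AE z\<in>{a<..<b} in lebesgue. g z * \<psi> z \<le> K * \<psi> z"
      using g
    proof eventually_elim
      case (elim z)
      show ?case
      proof
        show "g z * \<psi> z \<le> K * \<psi> z"
        proof (cases "z \<in> {x<..<y}")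
          case True
          thus ?thesis using elim \<psi>(2)[of z] by (intro mult_right_mono) auto
        qed (use \<psi>(5)[of z] in auto)
      qed
    qed
  qed
  also have "\<dots> = K * integral {a..b} \<psi>"
    using test_pairing_continuous[of a b "\<lambda>_. K" \<psi>] c by simp
  also have "\<dots> \<le> K * (y - x) + 2 * e"
  proof -
    have "K * (integral {a..b} \<psi> - (y - x)) \<le> \<bar>K\<bar> * (2 * d)"
      using int\<psi> by (metis abs_ge_self abs_ge_zero abs_mult mult_left_mono order_trans)
    also have "\<dots> \<le> 2 * e" using d(1,5) by (simp add: algebra_simps)
    finally show ?thesis by (simp add: algebra_simps)
  qed
  finally show "u y - u x \<le> K * (y - x) + e0"
    using A B C by (simp only: e_def abs_le_iff) argo
qed


section \<open>From weak to classical regularity\<close>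

lemma continuous_eq_on_Icc:
  fixes u :: "real \<Rightarrow> real"
  assumes "a < b" "continuous_on {a..b} u" "\<And>x. x \<in> {a<..<b} \<Longrightarrow> u x = K" "x \<in> {a..b}"
  shows "u x = K"
proof -
  have "u x \<le> K" by (rule continuous_le_on_Icc[OF assms(1,2) _ assms(4)]) (simp add: assms(3))
  moreover have "- u x \<le> - K"
    by (rule continuous_le_on_Icc[OF assms(1) _ _ assms(4)])
       (simp_all add: assms(3) continuous_on_minus[OF assms(2)])
  ultimately show ?thesis by simp
qed

lemma has_real_derivative_unique_Icc:
  fixes f :: "real \<Rightarrow> real"
  assumes "a < b" "x \<in> {a..b}" "(f has_real_derivative D) (at x within {a..b})"
    "(f has_real_derivative E) (at x within {a..b})"
  shows "D = E"
proof -
  have "at x within {a..b} \<noteq> bot" using assms(1,2) by (simp add: trivial_limit_within)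
  thus ?thesis using has_field_derivative_unique assms(3,4) by blast
qed

lemma continuous_eq_if_test_eq:
  assumes "a < b" "continuous_on {a..b} u" "continuous_on {a..b} w"
    and "\<And>\<psi>. test_function a b \<psi> \<Longrightarrow> test_pairing a b u \<psi> = test_pairing a b w \<psi>"
    and "x \<in> {a..b}"
  shows "u x = w x"
proof -
  have "\<bar>u x - w x\<bar> \<le> 0"
    by (rule continuous_abs_le_if_test_le[OF assms(1) _ _ assms(5)])
       (simp_all add: continuous_on_diff assms test_pairing_diff continuous_imp_locally_integrable)
  thus ?thesis by simp
qed

lemma abs_test_pairing_continuous_le:
  assumes u: "continuous_on {a..b} u" and le: "\<And>x. x \<in> {a..b} \<Longrightarrow> \<bar>u x\<bar> \<le> K"
    and \<psi>: "test_function a b \<psi>"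
  shows "\<bar>test_pairing a b u \<psi>\<bar> \<le> K * integral {a..b} (\<lambda>x. \<bar>\<psi> x\<bar>)"
proof -
  note c = test_function_continuous[OF \<psi>]
  have "norm (integral {a..b} (\<lambda>x. u x * \<psi> x)) \<le> integral {a..b} (\<lambda>x. K * \<bar>\<psi> x\<bar>)"
    by (intro integral_norm_bound_integral integrable_continuous_interval continuous_intros u c)
       (auto simp: abs_mult intro!: mult_right_mono le)
  thus ?thesis using test_pairing_continuous[OF u c] by simp
qed

text \<open>By continuity the interval may reach the boundary, where no test function lives.\<close>

lemma weak_derivative_mean_value_inequality_closed:
  assumes "a < b" and w: "has_weak_deriv a b 1 u g" and u: "continuous_on {a..b} u"
    and g: "AE z in lebesgue. z \<in> {x<..<y} \<longrightarrow> g z \<le> K"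
    and "a \<le> x" "x < y" "y \<le> b"
  shows "u y - u x \<le> K * (y - x)"
proof -
  have 1: "u y' - K * y' \<le> u x' - K * x'" if "x < x'" "x' < y'" "y' < y" for x' y'
  proof -
    have "AE z in lebesgue. z \<in> {x'<..<y'} \<longrightarrow> g z \<le> K" using g by eventually_elim (use that in auto)
    hence "u y' - u x' \<le> K * (y' - x')"
      by (rule weak_derivative_mean_value_inequality[OF assms(1) w u]) (use that assms in auto)
    thus ?thesis by (simp add: right_diff_distrib)
  qed
  have c: "continuous_on {x'..y'} (\<lambda>z. u z - K * z)" if "a \<le> x'" "y' \<le> b" for x' y'
    by (intro continuous_intros continuous_on_subset[OF u]) (use that in auto)
  have 2: "u y - K * y \<le> u x' - K * x'" if "x < x'" "x' < y" for x'
    by (rule continuous_le_on_Icc[where a = x' and b = y and u = "\<lambda>z. u z - K * z", OF that(2) c])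
       (use 1[of x'] assms that in auto)
  have 3: "- (u z - K * z) \<le> - (u y - K * y)" if "z \<in> {x<..<y}" for z
    using 2[of z] that by simp
  have "- (u x - K * x) \<le> - (u y - K * y)"
    by (rule continuous_le_on_Icc[where a = x and b = y and u = "\<lambda>z. - (u z - K * z)",
          OF assms(6) continuous_on_minus[OF c] 3]) (use assms in auto)
  thus ?thesis by (simp add: algebra_simps)
qed

lemma has_weak_deriv_minus:
  assumes "has_weak_deriv a b l u g"
  shows "has_weak_deriv a b l (\<lambda>x. - u x) (\<lambda>x. - g x)"
proof -
  have z: "locally_integrable a b (\<lambda>_. 0)" by (intro continuous_imp_locally_integrable continuous_intros)
  have "has_weak_deriv a b l (\<lambda>_. 0) (\<lambda>_. 0)"
    using z by (intro has_weak_derivI) (auto simp: test_pairing_def)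
  from has_weak_deriv_diff[OF this assms] show ?thesis by simp
qed

lemma weak_deriv_bounded_imp_lipschitz:
  assumes "a < b" and w: "has_weak_deriv a b 1 u g" and u: "continuous_on {a..b} u"
    and g: "Linf_norm a b g \<le> ereal K" and "x \<in> {a..b}" "y \<in> {a..b}"
  shows "\<bar>u x - u y\<bar> \<le> K * \<bar>x - y\<bar>"
proof -
  note ae = Linf_norm_le_imp_AE[OF g]
  have *: "\<bar>u x - u y\<bar> \<le> K * (y - x)" if "a \<le> x" "x < y" "y \<le> b" for x y
  proof -
    have "AE z in lebesgue. z \<in> {x<..<y} \<longrightarrow> g z \<le> K"
      using ae by eventually_elim (use that in auto)
    hence "u y - u x \<le> K * (y - x)"
      by (rule weak_derivative_mean_value_inequality_closed[OF assms(1) w u _ that])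
    moreover have "AE z in lebesgue. z \<in> {x<..<y} \<longrightarrow> - g z \<le> K"
      using ae by eventually_elim (use that in auto)
    hence "- u y - - u x \<le> K * (y - x)"
      by (rule weak_derivative_mean_value_inequality_closed[OF assms(1) has_weak_deriv_minus[OF w]
            continuous_on_minus[OF u] _ that])
    ultimately show ?thesis by (simp add: abs_le_iff)
  qed
  consider "x < y" | "x = y" | "y < x" by linarith
  thus ?thesis
  proof cases
    case 1
    thus ?thesis using *[of x y] assms(5,6) by simp
  next
    case 3
    thus ?thesis using *[of y x] assms(5,6) by (simp add: abs_minus_commute)
  qed simp
qed

text \<open>Near \<open>x\<close> the weak derivative lies between \<open>g x - e/2\<close> and \<open>g x + e/2\<close>, and the mean value inequality passes
this on to the difference quotients.\<close>

lemma continuous_weak_deriv_imp_derivative: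
  assumes "a < b" and w: "has_weak_deriv a b 1 u g"
    and u: "continuous_on {a..b} u" and g: "continuous_on {a..b} g" and x: "x \<in> {a..b}"
  shows "(u has_real_derivative g x) (at x within {a..b})"
proof -
  have "\<forall>\<^sub>F y in at x within {a..b}. dist ((u y - u x) / (y - x)) (g x) < e" if e: "e > 0" for e
  proof -
    have "e / 2 > 0" using e by simp
    then obtain d where d: "d > 0"
      "\<And>y. y \<in> {a..b} \<Longrightarrow> \<bar>y - x\<bar> < d \<Longrightarrow> \<bar>g y - g x\<bar> < e / 2"
      using g x unfolding continuous_on_iff dist_real_def by meson
    have key: "\<bar>u z - u y - g x * (z - y)\<bar> \<le> e / 2 * (z - y)"
      if "a \<le> y" "y < z" "z \<le> b" "\<bar>y - x\<bar> < d" "\<bar>z - x\<bar> < d" for y z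
    proof -
      have near: "\<bar>g t - g x\<bar> < e / 2" if "t \<in> {y<..<z}" for t
        by (rule d(2)) (use that \<open>a \<le> y\<close> \<open>z \<le> b\<close> \<open>\<bar>y - x\<bar> < d\<close> \<open>\<bar>z - x\<bar> < d\<close> in auto)
      have "AE t in lebesgue. t \<in> {y<..<z} \<longrightarrow> g t \<le> g x + e / 2"
        using near by (intro AE_I2 impI) (smt (verit))
      hence "u z - u y \<le> (g x + e / 2) * (z - y)"
        by (rule weak_derivative_mean_value_inequality_closed[OF assms(1) w u _ that(1-3)])
      moreover have "AE t in lebesgue. t \<in> {y<..<z} \<longrightarrow> - g t \<le> - g x + e / 2"
        using near by (intro AE_I2 impI) (smt (verit))
      hence "- u z - - u y \<le> (- g x + e / 2) * (z - y)"
        by (rule weak_derivative_mean_value_inequality_closed[OF assms(1) has_weak_deriv_minus[OF w]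
              continuous_on_minus[OF u] _ that(1-3)])
      ultimately show ?thesis unfolding distrib_right abs_le_iff mult_minus_left by linarith
    qed
    have "dist ((u y - u x) / (y - x)) (g x) < e"
      if y: "y \<in> {a..b}" "y \<noteq> x" "\<bar>y - x\<bar> < d" for y
    proof -
      have "\<bar>u y - u x - g x * (y - x)\<bar> \<le> e / 2 * \<bar>y - x\<bar>"
      proof (cases "x < y")
        case True
        thus ?thesis using key[of x y] x y d(1) by simp
      next
        case False
        hence "\<bar>u x - u y - g x * (x - y)\<bar> \<le> e / 2 * (x - y)" using key[of y x] x y d(1) by simp
        moreover have "\<bar>u y - u x - g x * (y - x)\<bar> = \<bar>u x - u y - g x * (x - y)\<bar>"
          using abs_minus_cancel[of "u x - u y - g x * (x - y)"] by (simp add: algebra_simps)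
        ultimately show ?thesis using False by simp
      qed
      also have "\<dots> < e * \<bar>y - x\<bar>" using e y(2) by simp
      finally have "\<bar>u y - u x - g x * (y - x)\<bar> / \<bar>y - x\<bar> < e"
        using y(2) by (simp add: pos_divide_less_eq)
      moreover have "(u y - u x - g x * (y - x)) / (y - x) = (u y - u x) / (y - x) - g x"
        using y(2) by (simp add: diff_divide_distrib)
      ultimately show ?thesis by (simp add: dist_real_def flip: abs_divide)
    qed
    thus ?thesis using d(1) unfolding eventually_at by (auto simp: dist_real_def)
  qed
  thus ?thesis unfolding has_field_derivative_iff by (intro tendstoI) auto
qed

lemma sobolev_periodic_derivative_chain:
  assumes "a < b" and v: "continuous_on {a..b} v" and sp: "v \<in> sobolev_periodic a b (Suc m)"
    and top: "has_weak_deriv a b (Suc m) v g" "Linf_norm a b g \<le> ereal K"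
  obtains G where
    "\<And>x. x \<in> {a..b} \<Longrightarrow> G 0 x = v x"
    "\<And>l. l \<le> m \<Longrightarrow> continuous_on {a..b} (G l)"
    "\<And>l. l \<le> m \<Longrightarrow> has_weak_deriv a b l v (G l)"
    "\<And>l. l \<le> m \<Longrightarrow> G l a = G l b"
    "\<And>l x. l < m \<Longrightarrow> x \<in> {a..b} \<Longrightarrow> (G l has_real_derivative G (Suc l) x) (at x within {a..b})"
    "\<And>x y. x \<in> {a..b} \<Longrightarrow> y \<in> {a..b} \<Longrightarrow> \<bar>G m x - G m y\<bar> \<le> K * \<bar>x - y\<bar>"
proof -
  have "\<forall>l. \<exists>g. l \<le> m \<longrightarrow> continuous_on {a..b} g \<and> has_weak_deriv a b l v g \<and> g a = g b"
    using sp by (auto simp: sobolev_periodic_def less_Suc_eq_le)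
  then obtain G where G: "\<And>l. l \<le> m \<Longrightarrow> continuous_on {a..b} (G l)"
    "\<And>l. l \<le> m \<Longrightarrow> has_weak_deriv a b l v (G l)" "\<And>l. l \<le> m \<Longrightarrow> G l a = G l b"
    by metis
  have eq: "G 0 x = v x" if "x \<in> {a..b}" for x
    by (rule continuous_eq_if_test_eq[OF assms(1) G(1) v _ that])
       (use has_weak_derivD[OF G(2)[of 0]] in auto)
  have chain: "(G l has_real_derivative G (Suc l) x) (at x within {a..b})"
    if "l < m" "x \<in> {a..b}" for l x
    using that by (intro continuous_weak_deriv_imp_derivative[OF assms(1)]
        has_weak_deriv_Suc[OF G(2) G(2)] G(1)) auto
  have lip: "\<bar>G m x - G m y\<bar> \<le> K * \<bar>x - y\<bar>" if "x \<in> {a..b}" "y \<in> {a..b}" for x y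
    using that by (intro weak_deriv_bounded_imp_lipschitz[OF assms(1) has_weak_deriv_Suc[OF G(2) top(1)] _ top(2)]
        G(1)) auto
  show thesis by (rule that[OF eq G chain lip])
qed

text \<open>The difference quotients \<open>q t\<close> of the continuous representatives are Cauchy in the sense of distributions with bounds in
\<open>L\<^sup>\<infinity>\<close>, hence uniformly Cauchy by \<open>continuous_abs_le_if_test_le\<close>. Their uniform limit represents \<open>D'\<close> and is at
the same time the pointwise time derivative.\<close>

lemma time_derivative_continuous_representative:
  fixes D f :: "real \<Rightarrow> real \<Rightarrow> real"
  assumes "a < b" "0 < T" "s \<in> {0..T}"
    and f: "\<And>t. t \<in> {0..T} \<Longrightarrow> continuous_on {a..b} (f t)"
           "\<And>t. t \<in> {0..T} \<Longrightarrow> has_weak_deriv a b 0 (D t) (f t)"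
    and D': "locally_integrable a b D'"
    and lim: "((\<lambda>t. sobolev_norm a b 0 (\<lambda>x. (D t x - D s x) / (t - s) - D' x)) \<longlongrightarrow> 0)
                (at s within {0..T})"
  obtains f' where "continuous_on {a..b} f'" "has_weak_deriv a b 0 D' f'"
    "\<And>x. x \<in> {a..b} \<Longrightarrow> ((\<lambda>t. f t x) has_real_derivative f' x) (at s within {0..T})"
proof -
  let ?F = "at s within {0..T}"
  have nt: "?F \<noteq> bot" using assms(2,3) by (simp add: trivial_limit_within)
  define q where "q t x = (f t x - f s x) / (t - s)" for t x
  define I where "I \<psi> = integral {a..b} (\<lambda>x. \<bar>\<psi> x\<bar>)" for \<psi> :: "real \<Rightarrow> real"
  \<comment> \<open>\<open>P e t\<close>: the distance of \<open>q t\<close> to \<open>D'\<close>, measured by test functions, is at most \<open>e\<close>.\<close>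
  define P where "P e t \<longleftrightarrow> t \<in> {0..T} \<and>
    (\<forall>\<psi>. test_function a b \<psi> \<longrightarrow> \<bar>test_pairing a b (q t) \<psi> - test_pairing a b D' \<psi>\<bar> \<le> e * I \<psi>)"
    for e t
  have qc: "continuous_on {a..b} (q t)" if "t \<in> {0..T}" for t
    unfolding q_def divide_inverse using f(1)[OF that] f(1)[OF assms(3)] by (intro continuous_intros)
  have evP: "\<forall>\<^sub>F t in ?F. P e t" if e: "e > 0" for e
  proof -
    have "\<forall>\<^sub>F t in ?F. sobolev_norm a b 0 (\<lambda>x. (D t x - D s x) / (t - s) - D' x) < ereal e"
      using lim e by (intro order_tendstoD) auto
    moreover have "\<forall>\<^sub>F t in ?F. t \<in> {0..T}" by (simp add: eventually_at_filter)
    ultimately show ?thesis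
    proof eventually_elim
      case (elim t)
      note li = has_weak_deriv_locally_integrable
      have l1: "locally_integrable a b (\<lambda>x. (D t x - D s x) / (t - s))"
        using li(1)[OF f(2)[OF elim(2)]] li(1)[OF f(2)[OF assms(3)]]
        by (intro locally_integrable_divide locally_integrable_diff)
      have "\<bar>test_pairing a b (q t) \<psi> - test_pairing a b D' \<psi>\<bar> \<le> e * I \<psi>"
        if \<psi>: "test_function a b \<psi>" for \<psi>
      proof -
        have "test_pairing a b (\<lambda>x. (D t x - D s x) / (t - s) - D' x) \<psi>
            = (test_pairing a b (D t) \<psi> - test_pairing a b (D s) \<psi>) / (t - s) - test_pairing a b D' \<psi>"
          using li(1)[OF f(2)[OF elim(2)]] li(1)[OF f(2)[OF assms(3)]]
          by (simp add: test_pairing_diff[OF l1 D' \<psi>] test_pairing_divide test_pairing_diff \<psi>)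
        also have "\<dots> = (test_pairing a b (f t) \<psi> - test_pairing a b (f s) \<psi>) / (t - s)
            - test_pairing a b D' \<psi>"
          using has_weak_derivD[OF f(2)[OF elim(2)] \<psi>] has_weak_derivD[OF f(2)[OF assms(3)] \<psi>] by simp
        also have "\<dots> = test_pairing a b (q t) \<psi> - test_pairing a b D' \<psi>"
          using li(2)[OF f(2)[OF elim(2)]] li(2)[OF f(2)[OF assms(3)]]
          unfolding q_def by (simp add: test_pairing_divide test_pairing_diff \<psi>)
        finally show ?thesis
          using sobolev_norm_test_bound[OF has_weak_deriv_refl[OF locally_integrable_diff[OF l1 D']]
              _ less_imp_le[OF elim(1)] \<psi>] by (simp add: I_def)
      qed
      thus ?case using elim(2) by (simp add: P_def)
    qed
  qed
  have cauchy: "\<bar>q t x - q t' x\<bar> \<le> e + e'" if "P e t" "P e' t'" "x \<in> {a..b}" for e e' t t' x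
  proof (rule continuous_abs_le_if_test_le[OF assms(1) _ _ that(3)])
    have t: "t \<in> {0..T}" "t' \<in> {0..T}" using that by (auto simp: P_def)
    show "continuous_on {a..b} (\<lambda>x. q t x - q t' x)" using qc t by (intro continuous_on_diff) auto
    fix \<psi> assume \<psi>: "test_function a b \<psi>"
    have "\<bar>test_pairing a b (q t) \<psi> - test_pairing a b D' \<psi>\<bar> \<le> e * I \<psi>"
      "\<bar>test_pairing a b (q t') \<psi> - test_pairing a b D' \<psi>\<bar> \<le> e' * I \<psi>"
      using that \<psi> by (auto simp: P_def)
    thus "\<bar>test_pairing a b (\<lambda>x. q t x - q t' x) \<psi>\<bar> \<le> (e + e') * integral {a..b} (\<lambda>x. \<bar>\<psi> x\<bar>)"
      using t by (simp add: test_pairing_diff continuous_imp_locally_integrable qc \<psi> distrib_right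
          flip: I_def)
  qed
  have "\<exists>t. P (inverse (real (Suc n))) t" for n
    using eventually_happens'[OF nt evP[of "inverse (real (Suc n))"]] by simp
  then obtain \<tau> where \<tau>: "\<And>n. P (inverse (real (Suc n))) (\<tau> n)" by metis
  have "uniformly_Cauchy_on {a..b} (\<lambda>n. q (\<tau> n))"
    unfolding uniformly_Cauchy_on_def
  proof (intro allI impI)
    fix e :: real assume "e > 0"
    then obtain N where N: "inverse (real (Suc N)) < e / 2" using reals_Archimedean[of "e / 2"] by auto
    have "dist (q (\<tau> m) x) (q (\<tau> n) x) < e" if "x \<in> {a..b}" "m \<ge> N" "n \<ge> N" for x m n
    proof -
      have "inverse (real (Suc m)) \<le> inverse (real (Suc N))" "inverse (real (Suc n)) \<le> inverse (real (Suc N))"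
        using that by (auto intro!: le_imp_inverse_le)
      thus ?thesis using cauchy[OF \<tau>[of m] \<tau>[of n] that(1)] N by (simp only: dist_real_def)
    qed
    thus "\<exists>M. \<forall>x\<in>{a..b}. \<forall>m\<ge>M. \<forall>n\<ge>M. dist (q (\<tau> m) x) (q (\<tau> n) x) < e" by blast
  qed
  then obtain f' where f': "uniform_limit {a..b} (\<lambda>n. q (\<tau> n)) f' sequentially"
    using Cauchy_uniformly_convergent uniformly_convergent_on_def by blast
  have f'c: "continuous_on {a..b} f'"
    by (rule uniform_limit_theorem[OF _ f']) (use \<tau> qc in \<open>auto simp: P_def\<close>)
  have close: "\<bar>q t x - f' x\<bar> \<le> e" if "P e t" "x \<in> {a..b}" for e t x
  proof (rule LIMSEQ_le[of "\<lambda>n. \<bar>q t x - q (\<tau> n) x\<bar>" _ "\<lambda>n. e + inverse (real (Suc n))"])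
    show "(\<lambda>n. \<bar>q t x - q (\<tau> n) x\<bar>) \<longlonglongrightarrow> \<bar>q t x - f' x\<bar>"
      by (intro tendsto_intros tendsto_uniform_limitI[OF f' that(2)])
    show "(\<lambda>n. e + inverse (real (Suc n))) \<longlonglongrightarrow> e"
      using tendsto_add[OF tendsto_const LIMSEQ_inverse_real_of_nat, of e] by simp
    show "\<exists>N. \<forall>n\<ge>N. \<bar>q t x - q (\<tau> n) x\<bar> \<le> e + inverse (real (Suc n))"
      using cauchy[OF that(1) \<tau> that(2)] by blast
  qed
  have deriv: "((\<lambda>t. f t x) has_real_derivative f' x) ?F" if x: "x \<in> {a..b}" for x
    unfolding has_field_derivative_iff
  proof (rule tendstoI)
    fix e :: real assume "e > 0"
    hence "\<forall>\<^sub>F t in ?F. P (e / 2) t" by (intro evP) simp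
    thus "\<forall>\<^sub>F t in ?F. dist ((f t x - f s x) / (t - s)) (f' x) < e"
    proof eventually_elim
      case (elim t)
      thus ?case using close[OF elim x] \<open>e > 0\<close> by (simp add: q_def dist_real_def)
    qed
  qed
  have "has_weak_deriv a b 0 D' f'"
  proof (rule has_weak_derivI[OF D' continuous_imp_locally_integrable[OF f'c]])
    fix \<psi> assume \<psi>: "test_function a b \<psi>"
    have "\<bar>test_pairing a b D' \<psi> - test_pairing a b f' \<psi>\<bar> \<le> 0 + e" if e: "e > 0" for e
    proof -
      define e' where "e' = e / (2 * (\<bar>I \<psi>\<bar> + 1))"
      have e': "e' > 0" using e by (auto simp: e'_def intro!: divide_pos_pos)
      then obtain t where t: "P e' t" using eventually_happens'[OF nt evP] by blast
      hence tT: "t \<in> {0..T}" by (simp add: P_def)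
      have "\<bar>test_pairing a b (\<lambda>x. q t x - f' x) \<psi>\<bar> \<le> e' * I \<psi>"
        unfolding I_def using close[OF t] qc[OF tT] f'c
        by (intro abs_test_pairing_continuous_le \<psi> continuous_on_diff) auto
      moreover have "\<bar>test_pairing a b (q t) \<psi> - test_pairing a b D' \<psi>\<bar> \<le> e' * I \<psi>"
        using t \<psi> by (simp add: P_def)
      ultimately have "\<bar>test_pairing a b D' \<psi> - test_pairing a b f' \<psi>\<bar> \<le> 2 * (e' * I \<psi>)"
        using qc[OF tT] f'c by (simp add: test_pairing_diff continuous_imp_locally_integrable \<psi>)
      also have "\<dots> \<le> 2 * (e' * (\<bar>I \<psi>\<bar> + 1))" using e' by simp
      also have "\<dots> = e" by (simp add: e'_def field_simps)
      finally show ?thesis by simp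
    qed
    hence "\<bar>test_pairing a b D' \<psi> - test_pairing a b f' \<psi>\<bar> \<le> 0" by (rule field_le_epsilon)
    thus "test_pairing a b D' ((deriv ^^ 0) \<psi>) = (- 1) ^ 0 * test_pairing a b f' \<psi>" by simp
  qed
  from that[OF f'c this deriv] show thesis .
qed

text \<open>The representatives are constructed for each order separately; continuous representatives are unique,
so that they fit together to a chain of classical time derivatives.\<close>

lemma time_derivs_continuous_representatives:
  assumes "a < b" "0 < T"
    and D0: "\<And>s. s \<in> {0..T} \<Longrightarrow> continuous_on {a..b} (D 0 s)"
    and D: "time_derivs r T (sobolev a b 0) (sobolev_norm a b 0) D"
  obtains d where
    "\<And>s x. s \<in> {0..T} \<Longrightarrow> x \<in> {a..b} \<Longrightarrow> d 0 s x = D 0 s x"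
    "\<And>i s. i \<le> r \<Longrightarrow> s \<in> {0..T} \<Longrightarrow> continuous_on {a..b} (d i s)"
    "\<And>i s. i \<le> r \<Longrightarrow> s \<in> {0..T} \<Longrightarrow> has_weak_deriv a b 0 (D i s) (d i s)"
    "\<And>i s x. i < r \<Longrightarrow> s \<in> {0..T} \<Longrightarrow> x \<in> {a..b} \<Longrightarrow>
       ((\<lambda>t. d i t x) has_real_derivative d (Suc i) s x) (at s within {0..T})"
proof -
  have li: "locally_integrable a b (D i s)" if "i \<le> r" "s \<in> {0..T}" for i s
    using D that by (fastforce simp: time_derivs_def sobolev_def dest: has_weak_deriv_locally_integrable)
  have lim: "((\<lambda>t. sobolev_norm a b 0 (\<lambda>x. (D i t x - D i s x) / (t - s) - D (Suc i) s x)) \<longlongrightarrow> 0)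
                (at s within {0..T})" if "i < r" "s \<in> {0..T}" for i s
    using D that by (auto simp: time_derivs_def)
  have "\<forall>s\<in>{0..T}. \<exists>f. continuous_on {a..b} f \<and> has_weak_deriv a b 0 (D i s) f" if "i \<le> r" for i
    using that
  proof (induction i)
    case 0
    show ?case using D0 has_weak_deriv_refl[OF li[of 0]] by blast
  next
    case (Suc i)
    then obtain f where f: "\<And>t. t \<in> {0..T} \<Longrightarrow> continuous_on {a..b} (f t)"
           "\<And>t. t \<in> {0..T} \<Longrightarrow> has_weak_deriv a b 0 (D i t) (f t)"
      by (metis Suc_leD)
    show ?case
    proof
      fix s assume s: "s \<in> {0..T}"
      show "\<exists>f. continuous_on {a..b} f \<and> has_weak_deriv a b 0 (D (Suc i) s) f"
        by (rule time_derivative_continuous_representative[OF assms(1,2) s f li[OF Suc.prems s] lim])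
           (use Suc.prems s in auto)
    qed
  qed
  hence "\<forall>i s. \<exists>f. i \<le> r \<longrightarrow> s \<in> {0..T} \<longrightarrow> continuous_on {a..b} f \<and> has_weak_deriv a b 0 (D i s) f"
    by blast
  then obtain d where d: "\<And>i s. i \<le> r \<Longrightarrow> s \<in> {0..T} \<Longrightarrow> continuous_on {a..b} (d i s)"
    "\<And>i s. i \<le> r \<Longrightarrow> s \<in> {0..T} \<Longrightarrow> has_weak_deriv a b 0 (D i s) (d i s)"
    by metis
  have d0: "d 0 s x = D 0 s x" if "s \<in> {0..T}" "x \<in> {a..b}" for s x
    by (rule continuous_eq_if_test_eq[OF assms(1) d(1) D0 _ that(2)])
       (use that has_weak_derivD[OF d(2)[of 0 s]] in auto)
  have deriv: "((\<lambda>t. d i t x) has_real_derivative d (Suc i) s x) (at s within {0..T})"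
    if i: "i < r" and s: "s \<in> {0..T}" and x: "x \<in> {a..b}" for i s x
  proof -
    have i': "i \<le> r" "Suc i \<le> r" using i by auto
    obtain f' where f': "continuous_on {a..b} f'" "has_weak_deriv a b 0 (D (Suc i) s) f'"
      "\<And>x. x \<in> {a..b} \<Longrightarrow> ((\<lambda>t. d i t x) has_real_derivative f' x) (at s within {0..T})"
      by (rule time_derivative_continuous_representative[OF assms(1,2) s d(1)[OF i'(1)] d(2)[OF i'(1)]
            li[OF i'(2) s] lim[OF i s]]) (assumption | rule that)+
    have "d (Suc i) s x = f' x"
      by (rule continuous_eq_if_test_eq[OF assms(1) d(1)[OF i'(2) s] f'(1) _ x])
         (use has_weak_derivD[OF d(2)[OF i'(2) s]] has_weak_derivD[OF f'(2)] in auto)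
    thus ?thesis using f'(3)[OF x] by simp
  qed
  show thesis by (rule that[OF d0 d deriv])
qed


section \<open>Classical derivatives of the exact solution\<close>

text \<open>What the convergence proof uses of the exact solution: \<open>d i s\<close> is its \<open>i\<close>-th time derivative and \<open>G l s\<close> its \<open>l\<close>-th space
derivative at time \<open>s\<close>, all classical and up to the boundary of \<open>[a, b] \<times> [0, T]\<close>. The Lipschitz
condition on \<open>d 3 s\<close> stands for the mixed derivative \<open>\<partial>\<^sub>x \<partial>\<^sub>s\<^sup>3 v\<close>.\<close>

locale smooth_klein_gordon =
  fixes p :: nat and \<epsilon> a b T C :: real and v :: "real \<Rightarrow> real \<Rightarrow> real"
    and d G :: "nat \<Rightarrow> real \<Rightarrow> real \<Rightarrow> real"
  assumes a_less_b: "a < b" and T_pos: "0 < T" and \<epsilon>_pos: "0 < \<epsilon>" and \<epsilon>_le_1: "\<epsilon> \<le> 1" and C_pos: "0 < C"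
    and d_0: "s \<in> {0..T} \<Longrightarrow> x \<in> {a..b} \<Longrightarrow> d 0 s x = v x s"
    and d_derivative: "i < 4 \<Longrightarrow> s \<in> {0..T} \<Longrightarrow> x \<in> {a..b} \<Longrightarrow>
       ((\<lambda>t. d i t x) has_real_derivative d (Suc i) s x) (at s within {0..T})"
    and d_bound: "i \<le> 4 \<Longrightarrow> s \<in> {0..T} \<Longrightarrow> x \<in> {a..b} \<Longrightarrow> \<bar>d i s x\<bar> \<le> C / \<epsilon> ^ (p * i)"
    and d_3_lipschitz: "s \<in> {0..T} \<Longrightarrow> x \<in> {a..b} \<Longrightarrow> y \<in> {a..b} \<Longrightarrow>
       \<bar>d 3 s x - d 3 s y\<bar> \<le> C / \<epsilon> ^ (p * 3) * \<bar>x - y\<bar>"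
    and G_0: "s \<in> {0..T} \<Longrightarrow> x \<in> {a..b} \<Longrightarrow> G 0 s x = v x s"
    and G_derivative: "l < 5 \<Longrightarrow> s \<in> {0..T} \<Longrightarrow> x \<in> {a..b} \<Longrightarrow>
       ((\<lambda>y. G l s y) has_real_derivative G (Suc l) s x) (at x within {a..b})"
    and G_5_lipschitz: "s \<in> {0..T} \<Longrightarrow> x \<in> {a..b} \<Longrightarrow> y \<in> {a..b} \<Longrightarrow>
       \<bar>G 5 s x - G 5 s y\<bar> \<le> C * \<bar>x - y\<bar>"
    and G_periodic: "l \<le> 5 \<Longrightarrow> s \<in> {0..T} \<Longrightarrow> G l s a = G l s b"
    and pde: "s \<in> {0..T} \<Longrightarrow> x \<in> {a..b} \<Longrightarrow>
       \<epsilon> ^ (2 * p) * d 2 s x = G 2 s x - v x s - \<epsilon> ^ p * v x s ^ (p + 1)"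

text \<open>The equation is given for \<open>a < x < b\<close> and \<open>s > 0\<close>. It extends to \<open>x = a, b\<close> by continuity in \<open>x\<close>, and to \<open>s = 0\<close> by
continuity in \<open>s\<close>; the continuity of \<open>v\<^sub>x\<^sub>x\<close> in time comes from \<open>v \<in> C([0,T]; W\<^bsup>6,\<infinity>\<^esup>)\<close>. At \<open>s = 0\<close> the equation identifies the
second-order term in the starting value of the scheme.\<close>

lemma smooth_klein_gordon_exists:
  assumes ab: "a < b" and T: "0 < T" and \<epsilon>: "0 < \<epsilon>" "\<epsilon> \<le> 1" and C: "0 < C"
    and sol: "klein_gordon_solution p \<epsilon> a b T \<phi> \<gamma> v"
    and reg: "(\<lambda>s x. v x s) \<in> C_space 0 T (sobolev_periodic a b 6) (sobolev_norm a b 6)"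
    and bd: "mixed_derivs_bounded p a b T \<epsilon> v C"
  obtains d G where "smooth_klein_gordon p \<epsilon> a b T C v d G"
    "\<And>x. x \<in> {a..b} \<Longrightarrow> v x 0 = \<phi> x"
    "\<And>x. x \<in> {a..b} \<Longrightarrow> d 1 0 x = \<gamma> x / \<epsilon> ^ p"
    "\<And>x. x \<in> {a..b} \<Longrightarrow> G 2 0 x = second_deriv a b \<phi> x"
proof -
  have vc: "continuous_on {a..b} (\<lambda>x. v x s)" if "s \<in> {0..T}" for s
  proof -
    have "continuous_on ({a..b} \<times> {0..T}) (\<lambda>(x, s). v x s)"
      using sol by (simp add: klein_gordon_solution_def)
    hence "continuous_on {a..b} ((\<lambda>(x, s). v x s) \<circ> (\<lambda>x. (x, s)))"
      by (intro continuous_on_compose continuous_intros continuous_on_subset[of _ _ "(\<lambda>x. (x, s)) ` {a..b}"])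
         (use that in auto)
    thus ?thesis by (simp add: o_def)
  qed
  obtain D where D: "D 0 = (\<lambda>s x. v x s)"
    "time_derivs 4 T (sobolev a b 0) (sobolev_norm a b 0) D"
    "\<And>r q s. r \<le> 4 \<Longrightarrow> r + q \<le> 6 \<Longrightarrow> s \<in> {0..T} \<Longrightarrow>
       \<exists>g. has_weak_deriv a b q (D r s) g \<and> Linf_norm a b g \<le> ereal (C / \<epsilon> ^ (p * r))"
    using bd unfolding mixed_derivs_bounded_def by metis
  have D0c: "continuous_on {a..b} (D 0 s)" if "s \<in> {0..T}" for s
    using vc[OF that] by (simp add: D(1))
  obtain d where d:
    "\<And>s x. s \<in> {0..T} \<Longrightarrow> x \<in> {a..b} \<Longrightarrow> d 0 s x = D 0 s x"
    "\<And>i s. i \<le> 4 \<Longrightarrow> s \<in> {0..T} \<Longrightarrow> continuous_on {a..b} (d i s)"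
    "\<And>i s. i \<le> 4 \<Longrightarrow> s \<in> {0..T} \<Longrightarrow> has_weak_deriv a b 0 (D i s) (d i s)"
    "\<And>i s x. i < 4 \<Longrightarrow> s \<in> {0..T} \<Longrightarrow> x \<in> {a..b} \<Longrightarrow>
       ((\<lambda>t. d i t x) has_real_derivative d (Suc i) s x) (at s within {0..T})"
    by (rule time_derivs_continuous_representatives[OF ab T D0c D(2)]) (assumption | rule that)+
  have d_bound: "\<bar>d i s x\<bar> \<le> C / \<epsilon> ^ (p * i)" if "i \<le> 4" "s \<in> {0..T}" "x \<in> {a..b}" for i s x
  proof -
    obtain g where g: "has_weak_deriv a b 0 (D i s) g" "Linf_norm a b g \<le> ereal (C / \<epsilon> ^ (p * i))"
      using D(3)[of i 0 s] \<open>i \<le> 4\<close> \<open>s \<in> {0..T}\<close> by auto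
    show ?thesis
    proof (rule continuous_abs_le_if_test_le[OF ab d(2)[OF that(1,2)] _ that(3)])
      fix \<psi> assume \<psi>: "test_function a b \<psi>"
      show "\<bar>test_pairing a b (d i s) \<psi>\<bar> \<le> C / \<epsilon> ^ (p * i) * integral {a..b} (\<lambda>x. \<bar>\<psi> x\<bar>)"
        using abs_test_pairing_le[OF has_weak_deriv_locally_integrable(2)[OF g(1)] \<psi> g(2)]
          has_weak_derivD[OF g(1) \<psi>] has_weak_derivD[OF d(3)[OF that(1,2)] \<psi>] by simp
    qed
  qed
  have d3: "\<bar>d 3 s x - d 3 s y\<bar> \<le> C / \<epsilon> ^ (p * 3) * \<bar>x - y\<bar>"
    if "s \<in> {0..T}" "x \<in> {a..b}" "y \<in> {a..b}" for s x y
  proof -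
    obtain g where g: "has_weak_deriv a b 1 (D 3 s) g" "Linf_norm a b g \<le> ereal (C / \<epsilon> ^ (p * 3))"
      using D(3)[of 3 1 s] \<open>s \<in> {0..T}\<close> by auto
    show ?thesis
      by (rule weak_deriv_bounded_imp_lipschitz[OF ab has_weak_deriv_cong_test[OF d(3) g(1)] d(2) g(2)])
         (use that in auto)
  qed
  obtain D' where D': "D' 0 = (\<lambda>s x. v x s)"
    "time_derivs 0 T (sobolev_periodic a b 6) (sobolev_norm a b 6) D'"
    using reg by (auto simp: C_space_def)
  have sp: "(\<lambda>x. v x s) \<in> sobolev_periodic a b (Suc 5)" if "s \<in> {0..T}" for s
    using D' that by (simp add: time_derivs_def)
  have reg0: "((\<lambda>t. sobolev_norm a b 6 (\<lambda>x. v x t - v x s)) \<longlongrightarrow> 0) (at s within {0..T})"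
    if "s \<in> {0..T}" for s
    using D' that by (simp add: time_derivs_def)
  have "\<exists>G. (\<forall>x\<in>{a..b}. G 0 x = v x s) \<and>
      (\<forall>l\<le>5. continuous_on {a..b} (G l) \<and> has_weak_deriv a b l (\<lambda>x. v x s) (G l) \<and> G l a = G l b) \<and>
      (\<forall>l x. l < 5 \<longrightarrow> x \<in> {a..b} \<longrightarrow> (G l has_real_derivative G (Suc l) x) (at x within {a..b})) \<and>
      (\<forall>x\<in>{a..b}. \<forall>y\<in>{a..b}. \<bar>G 5 x - G 5 y\<bar> \<le> C * \<bar>x - y\<bar>)" if s: "s \<in> {0..T}" for s
  proof -
    obtain g where g: "has_weak_deriv a b (Suc 5) (\<lambda>x. v x s) g" "Linf_norm a b g \<le> ereal C"
      using D(3)[of 0 6 s] s by (auto simp: D(1))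
    show ?thesis
      by (rule sobolev_periodic_derivative_chain[OF ab vc[OF s] sp[OF s] g]) blast
  qed
  then obtain G0 where G0: "\<And>s. s \<in> {0..T} \<Longrightarrow> (\<forall>x\<in>{a..b}. G0 s 0 x = v x s) \<and>
      (\<forall>l\<le>5. continuous_on {a..b} (G0 s l) \<and> has_weak_deriv a b l (\<lambda>x. v x s) (G0 s l) \<and> G0 s l a = G0 s l b) \<and>
      (\<forall>l x. l < 5 \<longrightarrow> x \<in> {a..b} \<longrightarrow> (G0 s l has_real_derivative G0 s (Suc l) x) (at x within {a..b})) \<and>
      (\<forall>x\<in>{a..b}. \<forall>y\<in>{a..b}. \<bar>G0 s 5 x - G0 s 5 y\<bar> \<le> C * \<bar>x - y\<bar>)"
    by metis
  define G where "G l s = G0 s l" for l s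
  have G: "s \<in> {0..T} \<Longrightarrow> x \<in> {a..b} \<Longrightarrow> G 0 s x = v x s"
    "l \<le> 5 \<Longrightarrow> s \<in> {0..T} \<Longrightarrow> continuous_on {a..b} (G l s)"
    "l \<le> 5 \<Longrightarrow> s \<in> {0..T} \<Longrightarrow> has_weak_deriv a b l (\<lambda>x. v x s) (G l s)"
    "l \<le> 5 \<Longrightarrow> s \<in> {0..T} \<Longrightarrow> G l s a = G l s b"
    "l < 5 \<Longrightarrow> s \<in> {0..T} \<Longrightarrow> x \<in> {a..b} \<Longrightarrow> (G l s has_real_derivative G (Suc l) s x) (at x within {a..b})"
    "s \<in> {0..T} \<Longrightarrow> x \<in> {a..b} \<Longrightarrow> y \<in> {a..b} \<Longrightarrow> \<bar>G 5 s x - G 5 s y\<bar> \<le> C * \<bar>x - y\<bar>"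
    for l s x y using G0[of s] by (auto simp: G_def)
  \<comment> \<open>Convergence in \<open>W\<^bsup>6,\<infinity>\<^esup>\<close> includes uniform convergence of the second space derivatives.\<close>
  have G2_cont: "continuous_on {0..T} (\<lambda>s. G 2 s x)" if x: "x \<in> {a..b}" for x
    unfolding continuous_on_def
  proof (intro ballI tendstoI)
    fix s e :: real assume s: "s \<in> {0..T}" and e: "e > 0"
    have "\<forall>\<^sub>F t in at s within {0..T}. sobolev_norm a b 6 (\<lambda>x. v x t - v x s) < ereal (e / 2)"
      using reg0[OF s] e by (intro order_tendstoD) auto
    moreover have "\<forall>\<^sub>F t in at s within {0..T}. t \<in> {0..T}" by (simp add: eventually_at_filter)
    ultimately show "\<forall>\<^sub>F t in at s within {0..T}. dist (G 2 t x) (G 2 s x) < e"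
    proof eventually_elim
      case (elim t)
      have w: "has_weak_deriv a b 2 (\<lambda>x. v x t - v x s) (\<lambda>x. G 2 t x - G 2 s x)"
        using s elim(2) by (intro has_weak_deriv_diff G(3)) auto
      have "\<bar>G 2 t x - G 2 s x\<bar> \<le> e / 2"
        by (rule continuous_abs_le_if_test_le[OF ab _ sobolev_norm_test_bound[OF w _ less_imp_le[OF elim(1)]] x])
           (use s elim(2) in \<open>auto intro!: continuous_on_diff G(2)\<close>)
      thus ?case using e by (simp add: dist_real_def)
    qed
  qed
  obtain vs vss vx vxx where first: "\<forall>x\<in>{a..b}. \<forall>s\<in>{0..T}.
        ((\<lambda>t. v x t) has_real_derivative vs x s) (at s within {0..T}) \<and>
        ((\<lambda>y. v y s) has_real_derivative vx x s) (at x within {a..b})"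
    and second: "\<forall>x\<in>{a<..<b}. \<forall>s\<in>{0<..T}.
        ((\<lambda>t. vs x t) has_real_derivative vss x s) (at s within {0..T}) \<and>
        ((\<lambda>y. vx y s) has_real_derivative vxx x s) (at x) \<and>
        \<epsilon> ^ (2 * p) * vss x s - vxx x s + v x s + \<epsilon> ^ p * v x s ^ (p + 1) = 0"
    and init: "\<forall>x\<in>{a..b}. v x 0 = \<phi> x \<and> vs x 0 = \<gamma> x / \<epsilon> ^ p"
    using sol unfolding klein_gordon_solution_def by (elim conjE exE) (rule that)
  have vs: "((\<lambda>t. v x t) has_real_derivative vs x s) (at s within {0..T})"
    and vx: "((\<lambda>y. v y s) has_real_derivative vx x s) (at x within {a..b})"
    if "x \<in> {a..b}" "s \<in> {0..T}" for x s using first that by blast+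
  have vss: "((\<lambda>t. vs x t) has_real_derivative vss x s) (at s within {0..T})"
    and vxx: "((\<lambda>y. vx y s) has_real_derivative vxx x s) (at x)"
    and eq: "\<epsilon> ^ (2 * p) * vss x s - vxx x s + v x s + \<epsilon> ^ p * v x s ^ (p + 1) = 0"
    if "x \<in> {a<..<b}" "s \<in> {0<..T}" for x s using second that by blast+
  have vs_eq: "vs x s = d 1 s x" if "x \<in> {a..b}" "s \<in> {0..T}" for x s
  proof (rule has_real_derivative_unique_Icc[OF T that(2) vs[OF that]])
    have "((\<lambda>t. d 0 t x) has_real_derivative d 1 s x) (at s within {0..T})"
      using d(4)[of 0 s x] that by simp
    thus "((\<lambda>t. v x t) has_real_derivative d 1 s x) (at s within {0..T})"
      by (rule has_field_derivative_transform_within[OF _ zero_less_one]) (use that d(1) D(1) in auto)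
  qed
  have vx_eq: "vx x s = G 1 s x" if "x \<in> {a..b}" "s \<in> {0..T}" for x s
  proof (rule has_real_derivative_unique_Icc[OF ab that(1) vx[OF that]])
    have "(G 0 s has_real_derivative G 1 s x) (at x within {a..b})"
      using G(5)[of 0 s x] that by simp
    thus "((\<lambda>y. v y s) has_real_derivative G 1 s x) (at x within {a..b})"
      by (rule has_field_derivative_transform_within[OF _ zero_less_one]) (use that G(1) in auto)
  qed
  \<comment> \<open>The residual of the equation, zero first inside, then for all \<open>x\<close>, then for all \<open>s\<close>.\<close>
  define E where "E s x = \<epsilon> ^ (2 * p) * d 2 s x - G 2 s x + d 0 s x + \<epsilon> ^ p * d 0 s x ^ (p + 1)" for s x
  have E1: "E s x = 0" if x: "x \<in> {a<..<b}" and s: "s \<in> {0<..T}" for x s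
  proof -
    have s': "s \<in> {0..T}" and x': "x \<in> {a..b}" using x s by auto
    have "vss x s = d 2 s x"
    proof (rule has_real_derivative_unique_Icc[OF T s' vss[OF x s]])
      have "((\<lambda>t. d 1 t x) has_real_derivative d 2 s x) (at s within {0..T})"
        using d(4)[of 1 s x] s' x' by (simp add: numeral_2_eq_2)
      thus "((\<lambda>t. vs x t) has_real_derivative d 2 s x) (at s within {0..T})"
        by (rule has_field_derivative_transform_within[OF _ zero_less_one]) (use s' vs_eq[OF x'] in auto)
    qed
    moreover have "vxx x s = G 2 s x"
    proof (rule has_real_derivative_unique_Icc[OF ab x' has_field_derivative_at_within[OF vxx[OF x s]]])
      have "(G 1 s has_real_derivative G 2 s x) (at x within {a..b})"
        using G(5)[of 1 s x] s' x' by (simp add: numeral_2_eq_2)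
      thus "((\<lambda>y. vx y s) has_real_derivative G 2 s x) (at x within {a..b})"
        by (rule has_field_derivative_transform_within[OF _ zero_less_one]) (use s' x' vx_eq in auto)
    qed
    ultimately show ?thesis using eq[OF x s] d(1)[OF s' x'] by (simp add: E_def D(1))
  qed
  have E2: "E s x = 0" if x: "x \<in> {a..b}" and s: "s \<in> {0<..T}" for x s
  proof (rule continuous_eq_on_Icc[OF ab _ E1[OF _ s] x])
    show "continuous_on {a..b} (E s)"
      unfolding E_def by (intro continuous_intros d(2) G(2)) (use s in auto)
  qed
  have E3: "E s x = 0" if x: "x \<in> {a..b}" and s: "s \<in> {0..T}" for x s
  proof (rule continuous_eq_on_Icc[OF T _ _ s])
    have "continuous_on {0..T} (\<lambda>t. d i t x)" if "i < 4" for i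
      using d(4)[OF that _ x] by (intro DERIV_continuous_on)
    thus "continuous_on {0..T} (\<lambda>s. E s x)"
      unfolding E_def by (intro continuous_intros G2_cont x) auto
  qed (use E2 x in auto)
  show thesis
  proof (rule that)
    show "smooth_klein_gordon p \<epsilon> a b T C v d G"
    proof
      fix s x assume "s \<in> {0..T}" "x \<in> {a..b}"
      thus "\<epsilon> ^ (2 * p) * d 2 s x = G 2 s x - v x s - \<epsilon> ^ p * v x s ^ (p + 1)"
        using E3[of x s] d(1)[of s x] by (simp add: E_def D(1))
    qed (use ab T \<epsilon> C d(1,4) d_bound d3 G(1,4,5,6) in \<open>auto simp: D(1)\<close>)
    show "v x 0 = \<phi> x" "d 1 0 x = \<gamma> x / \<epsilon> ^ p" if "x \<in> {a..b}" for x
      using bspec[OF init that] vs_eq[OF that, of 0] T by auto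
    show "G 2 0 x = second_deriv a b \<phi> x" if x: "x \<in> {a..b}" for x
    proof -
      have vd: "vector_derivative f (at y within {a..b}) = f'"
        if "(f has_real_derivative f') (at y within {a..b})" "y \<in> {a..b}" for f f' y
        using that by (intro vector_derivative_within_closed_interval ab)
          (auto simp: has_real_derivative_iff_has_vector_derivative)
      have z: "0 \<in> {0..T}" using T by simp
      have 1: "vector_derivative \<phi> (at y within {a..b}) = G 1 0 y" if y: "y \<in> {a..b}" for y
      proof (rule vd[OF _ y])
        have "(G 0 0 has_real_derivative G 1 0 y) (at y within {a..b})" using G(5)[of 0 0 y] z y by simp
        thus "(\<phi> has_real_derivative G 1 0 y) (at y within {a..b})"
          by (rule has_field_derivative_transform_within[OF _ zero_less_one]) (use y z G(1) init in auto)
      qed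
      have "vector_derivative (\<lambda>y. vector_derivative \<phi> (at y within {a..b})) (at x within {a..b}) = G 2 0 x"
      proof (rule vd[OF _ x])
        have "(G 1 0 has_real_derivative G 2 0 x) (at x within {a..b})"
          using G(5)[of 1 0 x] z x by (simp add: numeral_2_eq_2)
        thus "((\<lambda>y. vector_derivative \<phi> (at y within {a..b})) has_real_derivative G 2 0 x) (at x within {a..b})"
          by (rule has_field_derivative_transform_within[OF _ zero_less_one]) (use x 1 in auto)
      qed
      thus ?thesis by (simp add: second_deriv_def)
    qed
  qed
qed


section \<open>Periodic grid functions and the compact operator\<close>

lemma grid_space_add_mult:
  assumes "u \<in> grid_space M"
  shows "u (j + int M * i) = u j"
proof (induction i rule: int_induct[of _ 0])
  case (step1 i)
  have "u (j + int M * i + int M) = u (j + int M * i)" using assms by (simp add: grid_space_def)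
  thus ?case using step1 by (simp add: algebra_simps)
next
  case (step2 i)
  have "u (j + int M * (i - 1) + int M) = u (j + int M * (i - 1))"
    using assms by (simp only: grid_space_def mem_Collect_eq)
  thus ?case using step2 by (simp add: algebra_simps)
qed simp

lemma grid_space_mod: "u \<in> grid_space M \<Longrightarrow> u (j mod int M) = u j"
  using grid_space_add_mult[of u M "j mod int M" "j div int M"] by simp

lemma grid_space_shift: "u \<in> grid_space M \<Longrightarrow> (\<lambda>j. u (j + i)) \<in> grid_space M"
  unfolding grid_space_def by simp (metis add.commute add.left_commute)

lemma grid_space_reflect: "u \<in> grid_space M \<Longrightarrow> (\<lambda>j. u (- j)) \<in> grid_space M"
  using grid_space_add_mult[of u M _ "-1"] by (simp add: grid_space_def)

lemma dx2_grid_space: "u \<in> grid_space M \<Longrightarrow> dx2 h u \<in> grid_space M"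
  using grid_space_shift[of u M "-1"] grid_space_shift[of u M 1]
  unfolding dx2_def[abs_def] by (simp add: grid_space_def)

lemma compact_op_eq:
  "h \<noteq> 0 \<Longrightarrow> compact_op h u j = (u (j + 1) + 10 * u j + u (j - 1)) / 12"
  by (simp add: compact_op_def dx2_def power2_eq_square field_simps)

lemma grid_space_bounded:
  assumes "u \<in> grid_space M" "M \<ge> 1"
  obtains B where "\<And>j. \<bar>u j\<bar> \<le> B"
proof
  fix j
  have "\<bar>u j\<bar> = \<bar>u (j mod int M)\<bar>" by (simp add: grid_space_mod[OF assms(1)])
  also have "\<dots> \<le> (\<Sum>i\<in>{0..<int M}. \<bar>u i\<bar>)"
    using assms(2) by (intro member_le_sum) auto
  finally show "\<bar>u j\<bar> \<le> (\<Sum>i\<in>{0..<int M}. \<bar>u i\<bar>)" .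
qed

text \<open>A geometric series solves the recurrence on all of \<open>\<int>\<close> and inherits the period of \<open>f\<close>.\<close>

lemma periodic_recurrence_solvable:
  assumes f: "f \<in> grid_space M" and "M \<ge> 1" and r: "\<bar>r\<bar> < (1::real)"
  obtains g where "g \<in> grid_space M" "\<And>j. g j = f j + r * g (j - 1)"
proof
  define g where "g j = (\<Sum>m. r ^ m * f (j - int m))" for j
  obtain B where B: "\<And>j. \<bar>f j\<bar> \<le> B" using grid_space_bounded[OF assms(1,2)] by blast
  have sum: "summable (\<lambda>m. r ^ m * f (j - int m))" for j
  proof (rule summable_comparison_test')
    show "summable (\<lambda>m. \<bar>r\<bar> ^ m * B)" using r by (intro summable_mult2 summable_geometric) auto
    show "norm (r ^ n * f (j - int n)) \<le> \<bar>r\<bar> ^ n * B" if "n \<ge> 0" for n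
      using B[of "j - int n"] by (simp add: abs_mult power_abs mult_left_mono)
  qed
  show "g \<in> grid_space M"
  proof -
    have "f (j + int M - int m) = f (j - int m)" for j m
      using f by (simp add: grid_space_def) (metis diff_add_eq)
    thus ?thesis by (simp add: grid_space_def g_def)
  qed
  show "g j = f j + r * g (j - 1)" for j
  proof -
    have "g j = r ^ 0 * f (j - int 0) + (\<Sum>m. r ^ Suc m * f (j - int (Suc m)))"
      unfolding g_def using suminf_split_head[OF sum[of j]] by simp
    also have "(\<Sum>m. r ^ Suc m * f (j - int (Suc m))) = (\<Sum>m. r * (r ^ m * f (j - 1 - int m)))"
      by (simp add: algebra_simps)
    also have "\<dots> = r * g (j - 1)" unfolding g_def by (rule suminf_mult[OF sum])
    finally show ?thesis by simp
  qed
qed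

text \<open>With the shift \<open>S\<close> and the root \<open>r = 2 \<surd>6 - 5\<close> of \<open>r\<^sup>2 + 10 r + 1 = 0\<close> the operator factors as
\<open>- 12 r A = (1 - r S)(1 - r S\<^sup>-\<^sup>1)\<close>. Since \<open>|r| < 1\<close>, both factors are inverted by \<open>periodic_recurrence_solvable\<close>, the second
one after a reflection.\<close>

lemma compact_op_surj:
  assumes f: "f \<in> grid_space M" and "M \<ge> 1" and h: "h \<noteq> 0"
  shows "\<exists>u\<in>grid_space M. compact_op h u = f"
proof -
  define r where "r = 2 * sqrt 6 - 5"
  have s: "sqrt 6 * sqrt 6 = (6::real)" by simp
  have "2 < sqrt 6" "sqrt 6 < 3" by (auto intro: real_less_rsqrt real_less_lsqrt)
  hence r: "\<bar>r\<bar> < 1" unfolding r_def by (simp add: abs_less_iff)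
  have r2: "1 + r * r = - 10 * r" unfolding r_def using s by (simp add: algebra_simps)
  obtain L where L: "L \<in> grid_space M" "\<And>j. L j = f j + r * L (j - 1)"
    using periodic_recurrence_solvable[OF f assms(2) r] by blast
  obtain U' where U': "U' \<in> grid_space M" "\<And>j. U' j = L (- j) + r * U' (j - 1)"
    using periodic_recurrence_solvable[OF grid_space_reflect[OF L(1)] assms(2) r] by blast
  define U where "U j = U' (- j)" for j
  have U: "U \<in> grid_space M" "\<And>j. U j = L j + r * U (j + 1)"
  proof -
    show "U \<in> grid_space M" using grid_space_reflect[OF U'(1)] by (simp add: U_def[abs_def])
    show "U j = L j + r * U (j + 1)" for j
      unfolding U_def using U'(2)[of "- j"] by (simp only: minus_add_distrib minus_minus diff_conv_add_uminus)
  qed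
  define u where "u j = - 12 * r * U j" for j
  have "compact_op h u j = f j" for j
  proof -
    have "f j = L j - r * L (j - 1)" using L(2)[of j] by simp
    also have "L j = U j - r * U (j + 1)" using U(2)[of j] by simp
    also have "L (j - 1) = U (j - 1) - r * U j" using U(2)[of "j - 1"] by simp
    also have "U j - r * U (j + 1) - r * (U (j - 1) - r * U j)
        = (1 + r * r) * U j - r * (U (j + 1) + U (j - 1))" by (simp add: algebra_simps)
    also have "\<dots> = compact_op h u j" unfolding r2 by (simp add: compact_op_eq[OF h] u_def algebra_simps)
    finally show ?thesis by simp
  qed
  moreover have "u \<in> grid_space M" using U(1) by (simp add: u_def[abs_def] grid_space_def)
  ultimately show ?thesis by blast
qed

lemma compact_inv:
  assumes "f \<in> grid_space M" "M \<ge> 1" "h \<noteq> 0"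
  shows "compact_inv M h f \<in> grid_space M" "compact_op h (compact_inv M h f) = f"
proof -
  have "f \<in> compact_op h ` grid_space M" using compact_op_surj[OF assms] by blast
  thus "compact_inv M h f \<in> grid_space M" "compact_op h (compact_inv M h f) = f"
    unfolding compact_inv_def by (rule inv_into_into, rule f_inv_into_f)
qed

lemma grid_sum_shift:
  assumes "u \<in> grid_space M"
  shows "(\<Sum>j\<in>{0..<int M}. u (j + 1)) = (\<Sum>j\<in>{0..<int M}. u j :: real)"
proof (cases "M = 0")
  case False
  have "(\<Sum>j\<in>{0..<int M}. u (j + 1)) = (\<Sum>j\<in>{1..<int M + 1}. u j)"
    by (rule sum.reindex_bij_witness[of _ "\<lambda>j. j - 1" "\<lambda>j. j + 1"]) auto
  also have "{1..<int M + 1} = insert (int M) {1..<int M}" using False by auto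
  also have "(\<Sum>j\<in>\<dots>. u j) = u 0 + (\<Sum>j\<in>{1..<int M}. u j)"
    using assms grid_space_mod[OF assms, of "int M"] by (subst sum.insert) auto
  also have "\<dots> = (\<Sum>j\<in>insert 0 {1..<int M}. u j)" by (subst sum.insert) auto
  also have "insert 0 {1..<int M} = {0..<int M}" using False by auto
  finally show ?thesis .
qed simp

lemma summation_by_parts:
  assumes "u \<in> grid_space M" "w \<in> grid_space M" "h \<noteq> 0"
  shows "(\<Sum>j\<in>{0..<int M}. dx2 h u j * w j) = - (\<Sum>j\<in>{0..<int M}. dx_plus h u j * dx_plus h w j)"
proof -
  define z where "z j = (u j - u (j - 1)) * w j / h\<^sup>2" for j
  have z: "z \<in> grid_space M"
    using assms(1,2) grid_space_shift[OF assms(1), of "-1"] by (simp add: grid_space_def z_def)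
  have "dx_plus h u j * dx_plus h w j = z (j + 1) - (z j + dx2 h u j * w j)" for j
    using assms(3) by (simp add: z_def dx_plus_def dx2_def power2_eq_square field_simps)
  hence "(\<Sum>j\<in>{0..<int M}. dx_plus h u j * dx_plus h w j)
      = (\<Sum>j\<in>{0..<int M}. z (j + 1)) - (\<Sum>j\<in>{0..<int M}. z j) - (\<Sum>j\<in>{0..<int M}. dx2 h u j * w j)"
    by (simp add: sum_subtractf sum.distrib)
  thus ?thesis using grid_sum_shift[OF z] by simp
qed

section \<open>The discrete energy\<close>

definition sq_sum :: "nat \<Rightarrow> real \<Rightarrow> (int \<Rightarrow> real) \<Rightarrow> real" where
  "sq_sum M h u = h * (\<Sum>j\<in>{0..<int M}. (u j)\<^sup>2)"

text \<open>The quadratic form \<open>(A u, u)\<close> of the compact operator, with one summation by parts carried out.\<close>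

definition compact_form :: "nat \<Rightarrow> real \<Rightarrow> (int \<Rightarrow> real) \<Rightarrow> real" where
  "compact_form M h u = sq_sum M h u - h\<^sup>2 / 12 * sq_sum M h (dx_plus h u)"

lemma l2_norm_eq: "l2_norm M h u = sqrt (sq_sum M h u)"
  by (simp add: l2_norm_def sq_sum_def)

lemma l2_norm_L2_set: "h \<ge> 0 \<Longrightarrow> l2_norm M h u = sqrt h * L2_set u {0..<int M}"
  by (simp add: l2_norm_def L2_set_def real_sqrt_mult)

lemma sq_sum_nonneg: "h \<ge> 0 \<Longrightarrow> 0 \<le> sq_sum M h u"
  by (simp add: sq_sum_def sum_nonneg)

lemma l2_norm_nonneg: "h \<ge> 0 \<Longrightarrow> 0 \<le> l2_norm M h u"
  by (simp add: l2_norm_eq sq_sum_nonneg)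

lemma sum_compact_op_mult:
  assumes "u \<in> grid_space M" "w \<in> grid_space M" "h \<noteq> 0"
  shows "(\<Sum>j\<in>{0..<int M}. compact_op h u j * w j)
    = (\<Sum>j\<in>{0..<int M}. u j * w j) - h\<^sup>2 / 12 * (\<Sum>j\<in>{0..<int M}. dx_plus h u j * dx_plus h w j)"
proof -
  have "(\<Sum>j\<in>{0..<int M}. compact_op h u j * w j)
    = (\<Sum>j\<in>{0..<int M}. u j * w j) + h\<^sup>2 / 12 * (\<Sum>j\<in>{0..<int M}. dx2 h u j * w j)"
    by (simp add: compact_op_def distrib_right sum.distrib sum_distrib_left mult.assoc)
  thus ?thesis by (simp add: summation_by_parts[OF assms])
qed

lemma dx_plus_diff: "dx_plus h (\<lambda>j. u j - w j) j = dx_plus h u j - dx_plus h w j"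
  by (simp add: dx_plus_def diff_divide_distrib)

lemma dx_plus_add: "dx_plus h (\<lambda>j. u j + w j) j = dx_plus h u j + dx_plus h w j"
  by (simp add: dx_plus_def add_divide_distrib[symmetric])

lemma sum_dx2_diff_mult_sum:
  assumes "u \<in> grid_space M" "w \<in> grid_space M" "h \<noteq> 0"
  shows "h * (\<Sum>j\<in>{0..<int M}. dx2 h (\<lambda>j. u j + w j) j * (u j - w j))
    = - (sq_sum M h (dx_plus h u) - sq_sum M h (dx_plus h w))"
proof -
  have "(\<Sum>j\<in>{0..<int M}. dx2 h (\<lambda>j. u j + w j) j * (u j - w j))
    = - (\<Sum>j\<in>{0..<int M}. dx_plus h (\<lambda>j. u j + w j) j * dx_plus h (\<lambda>j. u j - w j) j)"
    using assms by (intro summation_by_parts) (auto simp: grid_space_def)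
  also have "\<dots> = - (\<Sum>j\<in>{0..<int M}. (dx_plus h u j)\<^sup>2 - (dx_plus h w j)\<^sup>2)"
    by (simp add: dx_plus_diff dx_plus_add power2_eq_square algebra_simps)
  finally have "(\<Sum>j\<in>{0..<int M}. dx2 h (\<lambda>j. u j + w j) j * (u j - w j))
    = - ((\<Sum>j\<in>{0..<int M}. (dx_plus h u j)\<^sup>2) - (\<Sum>j\<in>{0..<int M}. (dx_plus h w j)\<^sup>2))"
    by (simp only: sum_subtractf)
  thus ?thesis by (simp only: sq_sum_def) (simp add: right_diff_distrib)
qed

lemma sum_compact_op_diff_mult_sum:
  assumes "u \<in> grid_space M" "w \<in> grid_space M" "h \<noteq> 0"
  shows "h * (\<Sum>j\<in>{0..<int M}. compact_op h (\<lambda>j. u j - w j) j * (u j + w j))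
    = compact_form M h u - compact_form M h w"
    and "h * (\<Sum>j\<in>{0..<int M}. compact_op h (\<lambda>j. u j + w j) j * (u j - w j))
    = compact_form M h u - compact_form M h w"
proof -
  have g: "(\<lambda>j. u j + w j) \<in> grid_space M" "(\<lambda>j. u j - w j) \<in> grid_space M"
    using assms by (auto simp: grid_space_def)
  have 1: "(\<Sum>j\<in>{0..<int M}. (u j - w j) * (u j + w j)) = (\<Sum>j\<in>{0..<int M}. (u j)\<^sup>2) - (\<Sum>j\<in>{0..<int M}. (w j)\<^sup>2)"
    unfolding sum_subtractf[symmetric] by (simp add: power2_eq_square algebra_simps)
  have 2: "(\<Sum>j\<in>{0..<int M}. (dx_plus h u j - dx_plus h w j) * (dx_plus h u j + dx_plus h w j))
      = (\<Sum>j\<in>{0..<int M}. (dx_plus h u j)\<^sup>2) - (\<Sum>j\<in>{0..<int M}. (dx_plus h w j)\<^sup>2)"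
    unfolding sum_subtractf[symmetric] by (simp add: power2_eq_square algebra_simps)
  show "h * (\<Sum>j\<in>{0..<int M}. compact_op h (\<lambda>j. u j - w j) j * (u j + w j))
      = compact_form M h u - compact_form M h w"
    unfolding sum_compact_op_mult[OF g(2,1) assms(3)] dx_plus_diff dx_plus_add 1 2
    by (simp add: compact_form_def sq_sum_def algebra_simps)
  show "h * (\<Sum>j\<in>{0..<int M}. compact_op h (\<lambda>j. u j + w j) j * (u j - w j))
      = compact_form M h u - compact_form M h w"
    unfolding sum_compact_op_mult[OF g(1,2) assms(3)] dx_plus_diff dx_plus_add
      mult.commute[of "u _ + w _"] mult.commute[of "dx_plus h u _ + dx_plus h w _"] 1 2
    by (simp add: compact_form_def sq_sum_def algebra_simps)
qed

lemma sq_sum_dx_plus_le: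
  assumes "u \<in> grid_space M" "h > 0"
  shows "h\<^sup>2 * sq_sum M h (dx_plus h u) \<le> 4 * sq_sum M h u"
proof -
  have *: "h\<^sup>2 * (dx_plus h u j)\<^sup>2 \<le> 2 * (u (j + 1))\<^sup>2 + 2 * (u j)\<^sup>2" for j
  proof -
    have "h\<^sup>2 * (dx_plus h u j)\<^sup>2 = (u (j + 1) - u j)\<^sup>2" using assms(2) by (simp add: dx_plus_def power_divide)
    also have "\<dots> \<le> 2 * (u (j + 1))\<^sup>2 + 2 * (u j)\<^sup>2"
      using zero_le_power2[of "u (j + 1) + u j"] by (simp add: power2_eq_square algebra_simps)
    finally show ?thesis .
  qed
  have "(\<lambda>j. (u j)\<^sup>2) \<in> grid_space M" using assms by (simp add: grid_space_def)
  note sh = grid_sum_shift[OF this]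
  have "(\<Sum>j\<in>{0..<int M}. h\<^sup>2 * (dx_plus h u j)\<^sup>2) \<le> (\<Sum>j\<in>{0..<int M}. 2 * (u (j + 1))\<^sup>2 + 2 * (u j)\<^sup>2)"
    by (intro sum_mono *)
  also have "\<dots> = 4 * (\<Sum>j\<in>{0..<int M}. (u j)\<^sup>2)"
    by (simp add: sum.distrib flip: sum_distrib_left) (simp add: sh)
  finally have "h * (h\<^sup>2 * (\<Sum>j\<in>{0..<int M}. (dx_plus h u j)\<^sup>2)) \<le> h * (4 * (\<Sum>j\<in>{0..<int M}. (u j)\<^sup>2))"
    using assms(2) by (intro mult_left_mono) (auto simp: sum_distrib_left)
  thus ?thesis by (simp add: sq_sum_def algebra_simps)
qed

lemma compact_form_bounds:
  assumes "u \<in> grid_space M" "h > 0"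
  shows "2 / 3 * sq_sum M h u \<le> compact_form M h u" "compact_form M h u \<le> sq_sum M h u"
  using sq_sum_dx_plus_le[OF assms] sq_sum_nonneg[of h M "dx_plus h u"] assms(2)
  by (auto simp: compact_form_def)

lemma l2_norm_triangle:
  "h \<ge> 0 \<Longrightarrow> l2_norm M h (\<lambda>j. u j + w j) \<le> l2_norm M h u + l2_norm M h w"
  using L2_set_triangle_ineq[of u w "{0..<int M}"]
  by (simp add: l2_norm_L2_set mult_left_mono flip: distrib_left)

lemma l2_norm_Cauchy_Schwarz:
  assumes "h \<ge> 0"
  shows "h * (\<Sum>j\<in>{0..<int M}. u j * w j) \<le> l2_norm M h u * l2_norm M h w"
proof -
  have "(\<Sum>j\<in>{0..<int M}. u j * w j) \<le> (\<Sum>j\<in>{0..<int M}. \<bar>u j\<bar> * \<bar>w j\<bar>)"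
    by (intro sum_mono) (metis abs_ge_self abs_mult)
  also have "\<dots> \<le> L2_set u {0..<int M} * L2_set w {0..<int M}" by (rule L2_set_mult_ineq)
  finally have "h * (\<Sum>j\<in>{0..<int M}. u j * w j) \<le> h * (L2_set u {0..<int M} * L2_set w {0..<int M})"
    using assms by (rule mult_left_mono)
  also have "\<dots> = (sqrt h * sqrt h) * (L2_set u {0..<int M} * L2_set w {0..<int M})"
    using assms by simp
  finally show ?thesis using assms by (simp only: l2_norm_L2_set mult_ac)
qed

lemma l2_norm_mono:
  assumes "h \<ge> 0" "\<And>j. j \<in> {0..<int M} \<Longrightarrow> \<bar>u j\<bar> \<le> \<bar>w j\<bar>"
  shows "l2_norm M h u \<le> l2_norm M h w"
  unfolding l2_norm_def using assms
  by (intro real_sqrt_le_mono mult_left_mono sum_mono power_mono) auto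

lemma l2_norm_cmult: "h \<ge> 0 \<Longrightarrow> l2_norm M h (\<lambda>j. c * u j) = \<bar>c\<bar> * l2_norm M h u"
  by (simp add: l2_norm_def power_mult_distrib abs_mult real_sqrt_mult flip: sum_distrib_left)

lemma l2_norm_const: "h \<ge> 0 \<Longrightarrow> l2_norm M h (\<lambda>j. c) = \<bar>c\<bar> * sqrt (h * real M)"
  by (simp add: l2_norm_def real_sqrt_mult)

lemma l2_norm_compact_op_le:
  assumes "f \<in> grid_space M" "h > 0"
  shows "l2_norm M h (compact_op h f) \<le> l2_norm M h f"
proof -
  have *: "(compact_op h f j)\<^sup>2 \<le> ((f (j + 1))\<^sup>2 + 10 * (f j)\<^sup>2 + (f (j - 1))\<^sup>2) / 12" for j
  proof -
    have "0 \<le> 10 * (f (j + 1) - f j)\<^sup>2 + (f (j + 1) - f (j - 1))\<^sup>2 + 10 * (f j - f (j - 1))\<^sup>2" by simp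
    hence "(f (j + 1) + 10 * f j + f (j - 1))\<^sup>2 \<le> 12 * ((f (j + 1))\<^sup>2 + 10 * (f j)\<^sup>2 + (f (j - 1))\<^sup>2)"
      by (simp add: power2_eq_square algebra_simps)
    thus ?thesis using assms(2) by (simp add: compact_op_eq power_divide)
  qed
  have g: "(\<lambda>j. (f j)\<^sup>2) \<in> grid_space M" "(\<lambda>j. (f (j - 1))\<^sup>2) \<in> grid_space M"
    using assms(1) grid_space_shift[OF assms(1), of "-1"] by (auto simp: grid_space_def)
  have "(\<Sum>j\<in>{0..<int M}. (compact_op h f j)\<^sup>2)
      \<le> (\<Sum>j\<in>{0..<int M}. ((f (j + 1))\<^sup>2 + 10 * (f j)\<^sup>2 + (f (j - 1))\<^sup>2) / 12)" by (intro sum_mono *)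
  also have "\<dots> = (\<Sum>j\<in>{0..<int M}. (f j)\<^sup>2)"
    using grid_sum_shift[OF g(1)] grid_sum_shift[OF g(2)]
    by (simp add: sum.distrib flip: sum_divide_distrib sum_distrib_left)
  finally show ?thesis using assms(2) unfolding l2_norm_def
    by (intro real_sqrt_le_mono mult_left_mono) auto
qed

text \<open>Compare \<open>|u i|\<close> with the mean of \<open>|u|\<close>: the difference is at most the total variation.\<close>

lemma discrete_sobolev:
  assumes "h > 0" "M \<ge> 1" "i \<in> {0..<int M}"
  shows "\<bar>u i\<bar> \<le> l2_norm M h u / sqrt (h * M) + sqrt (h * M) * l2_norm M h (dx_plus h u)"
proof -
  let ?I = "{0..<int M}"
  define V where "V = (\<Sum>m\<in>?I. \<bar>u (m + 1) - u m\<bar>)"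
  have tele: "\<bar>u n - u m\<bar> \<le> (\<Sum>l\<in>{m..<n}. \<bar>u (l + 1) - u l\<bar>)" if "m \<le> n" for m n
    using that
  proof (induction n rule: int_ge_induct)
    case (step n)
    have "{m..<n + 1} = insert n {m..<n}" using step by auto
    thus ?case using step by simp
  qed simp
  have diff: "\<bar>u n - u m\<bar> \<le> V" if "m \<in> ?I" "n \<in> ?I" for m n
  proof -
    have "\<bar>u n - u m\<bar> \<le> V" if "m \<in> ?I" "n \<in> ?I" "m \<le> n" for m n
    proof -
      have "(\<Sum>l\<in>{m..<n}. \<bar>u (l + 1) - u l\<bar>) \<le> V"
        unfolding V_def using that by (intro sum_mono2) auto
      thus ?thesis using tele[OF that(3)] by linarith
    qed
    from this[of m n] this[of n m] show ?thesis using that by (cases "m \<le> n") auto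
  qed
  have l1: "(\<Sum>m\<in>?I. \<bar>w m\<bar>) \<le> sqrt M * L2_set w ?I" for w :: "int \<Rightarrow> real"
    using L2_set_mult_ineq[of w "\<lambda>_. 1" ?I] by (simp add: L2_set_def mult.commute)
  have "M * \<bar>u i\<bar> = (\<Sum>m\<in>?I. \<bar>u i\<bar>)" by simp
  also have "\<dots> \<le> (\<Sum>m\<in>?I. \<bar>u m\<bar> + V)"
  proof (rule sum_mono)
    fix m assume "m \<in> ?I"
    thus "\<bar>u i\<bar> \<le> \<bar>u m\<bar> + V" using diff[of m i] assms(3) by linarith
  qed
  also have "\<dots> = (\<Sum>m\<in>?I. \<bar>u m\<bar>) + M * V" by (simp add: sum.distrib)
  also have "V = h * (\<Sum>m\<in>?I. \<bar>dx_plus h u m\<bar>)"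
    using assms(1) by (simp add: V_def dx_plus_def sum_distrib_left)
  finally have "M * \<bar>u i\<bar> \<le> (\<Sum>m\<in>?I. \<bar>u m\<bar>) + M * (h * (\<Sum>m\<in>?I. \<bar>dx_plus h u m\<bar>))" .
  also have "\<dots> \<le> sqrt M * L2_set u ?I + M * (h * (sqrt M * L2_set (dx_plus h u) ?I))"
    using assms(1) by (intro add_mono mult_left_mono l1) auto
  also have "\<dots> = M * (l2_norm M h u / sqrt (h * M) + sqrt (h * M) * l2_norm M h (dx_plus h u))"
  proof -
    have "sqrt h * sqrt h = h" "sqrt M * sqrt M = M" "sqrt h > 0" "sqrt M > 0" using assms by auto
    hence *: "M * (x / sqrt M) = sqrt M * x" for x by (simp add: field_simps)
    have "l2_norm M h u / sqrt (h * M) = L2_set u ?I / sqrt M"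
      "sqrt (h * M) * l2_norm M h (dx_plus h u) = h * (sqrt M * L2_set (dx_plus h u) ?I)"
      using assms(1) \<open>sqrt h * sqrt h = h\<close> by (simp_all add: l2_norm_L2_set real_sqrt_mult)
    thus ?thesis using * by (simp only: distrib_left)
  qed
  finally show ?thesis using assms(2) by simp
qed

text \<open>Here \<open>\<eta>\<close> stands for \<open>\<epsilon>\<^bsup>p\<^esup>\<close>. The implicit treatment of the linear part of the
equation makes all terms nonnegative.\<close>

definition scheme_energy :: "nat \<Rightarrow> real \<Rightarrow> real \<Rightarrow> real \<Rightarrow> (nat \<Rightarrow> int \<Rightarrow> real) \<Rightarrow> nat \<Rightarrow> real" where
  "scheme_energy M h k \<eta> e n =
     \<eta>\<^sup>2 * compact_form M h (\<lambda>j. (e (Suc n) j - e n j) / k)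
       + (sq_sum M h (dx_plus h (e (Suc n))) + compact_form M h (e (Suc n))
          + sq_sum M h (dx_plus h (e n)) + compact_form M h (e n)) / 2"

lemma compact_op_cmult: "compact_op h (\<lambda>j. c * u j) j = c * compact_op h u j"
  by (simp add: compact_op_def dx2_def algebra_simps add_divide_distrib diff_divide_distrib)

lemma dx2_cmult: "dx2 h (\<lambda>j. c * u j) j = c * dx2 h u j"
  by (simp add: dx2_def algebra_simps)

text \<open>Test the equation with \<open>e\<^bsub>n+2\<^esub> - e\<^sub>n = k (q\<^bsub>n+1\<^esub> + q\<^sub>n)\<close>: the second time difference is \<open>(q\<^bsub>n+1\<^esub> - q\<^sub>n) / k\<close> and the time average
is \<open>(e\<^bsub>n+2\<^esub> + e\<^sub>n) / 2\<close>, so every term on the left has the form \<open>(x - y)(x + y) = x\<^sup>2 - y\<^sup>2\<close>.\<close>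

lemma scheme_energy_step:
  assumes e: "\<And>n. e n \<in> grid_space M" and "h > 0" "k > 0"
    and eq: "\<And>j. \<eta>\<^sup>2 * compact_op h (ds2 k e (Suc n)) j - dx2 h (time_avg e (Suc n)) j
               + compact_op h (time_avg e (Suc n)) j = R j"
  defines "q \<equiv> \<lambda>n j. (e (Suc n) j - e n j) / k"
  shows "scheme_energy M h k \<eta> e (Suc n) - scheme_energy M h k \<eta> e n
           = k * (h * (\<Sum>j\<in>{0..<int M}. R j * (q (Suc n) j + q n j)))"
proof -
  have h: "h \<noteq> 0" using assms by simp
  have q: "q n \<in> grid_space M" for n using e unfolding q_def by (simp add: grid_space_def)
  let ?w = "e (Suc (Suc n))" and ?u = "e n" and ?I = "{0..<int M}"
  have t: "k * (q (Suc n) j + q n j) = ?w j - ?u j" for j using assms(3) by (simp add: q_def field_simps)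
  have avg: "time_avg e (Suc n) = (\<lambda>j. 1 / 2 * (?w j + ?u j))" by (simp add: time_avg_def fun_eq_iff)
  have ds: "ds2 k e (Suc n) = (\<lambda>j. 1 / k * (q (Suc n) j - q n j))"
    using assms(3) by (simp add: ds2_def fun_eq_iff q_def power2_eq_square field_simps)
  have "R j * (k * (q (Suc n) j + q n j))
      = \<eta>\<^sup>2 * (compact_op h (\<lambda>j. q (Suc n) j - q n j) j * (q (Suc n) j + q n j))
        - 1 / 2 * (dx2 h (\<lambda>j. ?w j + ?u j) j * (?w j - ?u j))
        + 1 / 2 * (compact_op h (\<lambda>j. ?w j + ?u j) j * (?w j - ?u j))" for j
  proof -
    have "\<eta>\<^sup>2 * compact_op h (ds2 k e (Suc n)) j * (k * (q (Suc n) j + q n j))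
        = \<eta>\<^sup>2 * (compact_op h (\<lambda>j. q (Suc n) j - q n j) j * (q (Suc n) j + q n j))"
      unfolding ds compact_op_cmult using assms(3) by simp
    moreover have "(- dx2 h (time_avg e (Suc n)) j + compact_op h (time_avg e (Suc n)) j) * (?w j - ?u j)
        = - 1 / 2 * (dx2 h (\<lambda>j. ?w j + ?u j) j * (?w j - ?u j))
        + 1 / 2 * (compact_op h (\<lambda>j. ?w j + ?u j) j * (?w j - ?u j))"
      unfolding avg dx2_cmult compact_op_cmult by (simp only: distrib_right mult_minus_left mult.assoc)
    moreover have "R j * (k * (q (Suc n) j + q n j))
        = \<eta>\<^sup>2 * compact_op h (ds2 k e (Suc n)) j * (k * (q (Suc n) j + q n j))
        + (- dx2 h (time_avg e (Suc n)) j + compact_op h (time_avg e (Suc n)) j) * (?w j - ?u j)"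
      unfolding eq[symmetric] t[symmetric] by (simp add: algebra_simps)
    ultimately show ?thesis by linarith
  qed
  hence "(\<Sum>j\<in>?I. R j * (k * (q (Suc n) j + q n j)))
      = \<eta>\<^sup>2 * (\<Sum>j\<in>?I. compact_op h (\<lambda>j. q (Suc n) j - q n j) j * (q (Suc n) j + q n j))
        - 1 / 2 * (\<Sum>j\<in>?I. dx2 h (\<lambda>j. ?w j + ?u j) j * (?w j - ?u j))
        + 1 / 2 * (\<Sum>j\<in>?I. compact_op h (\<lambda>j. ?w j + ?u j) j * (?w j - ?u j))"
    by (simp add: sum.distrib sum_subtractf sum_distrib_left)
  moreover have scale: "h * (c * x - 1 / 2 * y + 1 / 2 * z)
      = c * (h * x) - 1 / 2 * (h * y) + 1 / 2 * (h * z)" for c x y z :: real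
    by (simp add: algebra_simps)
  ultimately have "h * (\<Sum>j\<in>?I. R j * (k * (q (Suc n) j + q n j)))
      = \<eta>\<^sup>2 * (h * (\<Sum>j\<in>?I. compact_op h (\<lambda>j. q (Suc n) j - q n j) j * (q (Suc n) j + q n j)))
        - 1 / 2 * (h * (\<Sum>j\<in>?I. dx2 h (\<lambda>j. ?w j + ?u j) j * (?w j - ?u j)))
        + 1 / 2 * (h * (\<Sum>j\<in>?I. compact_op h (\<lambda>j. ?w j + ?u j) j * (?w j - ?u j)))"
    by (simp only: scale)
  also have "\<dots> = \<eta>\<^sup>2 * (compact_form M h (q (Suc n)) - compact_form M h (q n))
        + 1 / 2 * (sq_sum M h (dx_plus h ?w) - sq_sum M h (dx_plus h ?u))
        + 1 / 2 * (compact_form M h ?w - compact_form M h ?u)"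
    unfolding sum_compact_op_diff_mult_sum[OF q q h] sum_compact_op_diff_mult_sum[OF e e h]
      sum_dx2_diff_mult_sum[OF e e h] by (simp only: mult_minus_right diff_minus_eq_add)
  also have "\<dots> = scheme_energy M h k \<eta> e (Suc n) - scheme_energy M h k \<eta> e n"
  proof -
    have "c * (x - y) + 1 / 2 * (D2 - D0) + 1 / 2 * (F2 - F0)
        = (c * x + (D2 + F2 + D1 + F1) / 2) - (c * y + (D1 + F1 + D0 + F0) / 2)"
      for c x y D0 D1 D2 F0 F1 F2 :: real by (simp add: field_simps)
    thus ?thesis unfolding scheme_energy_def q_def by this
  qed
  also have "(\<Sum>j\<in>?I. R j * (k * (q (Suc n) j + q n j))) = k * (\<Sum>j\<in>?I. R j * (q (Suc n) j + q n j))"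
    by (simp add: sum_distrib_left mult.left_commute)
  finally show ?thesis by (simp only: mult.left_commute[of k h])
qed

lemma scheme_energy_controls:
  fixes n :: nat
  assumes e: "\<And>n. e n \<in> grid_space M" and "h > 0" "k > 0" "\<eta> > 0"
  defines "y \<equiv> sqrt (scheme_energy M h k \<eta> e n)"
  shows "0 \<le> scheme_energy M h k \<eta> e n"
    and "l2_norm M h (\<lambda>j. (e (Suc n) j - e n j) / k) \<le> 2 * y / \<eta>"
    and "l2_norm M h (e n) \<le> 2 * y" "l2_norm M h (e (Suc n)) \<le> 2 * y"
    and "l2_norm M h (dx_plus h (e n)) \<le> 2 * y" "l2_norm M h (dx_plus h (e (Suc n))) \<le> 2 * y"
proof -
  define q where "q j = (e (Suc n) j - e n j) / k" for j
  define Y where "Y = scheme_energy M h k \<eta> e n"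
  have qg: "q \<in> grid_space M" using e unfolding q_def[abs_def] by (simp add: grid_space_def)
  note f = compact_form_bounds(1)[OF qg assms(2)] compact_form_bounds(1)[OF e assms(2), of n]
    compact_form_bounds(1)[OF e assms(2), of "Suc n"]
  have nn: "0 \<le> sq_sum M h u" for u using sq_sum_nonneg assms(2) by simp
  have Y: "Y = \<eta>\<^sup>2 * compact_form M h q
       + (sq_sum M h (dx_plus h (e (Suc n))) + compact_form M h (e (Suc n))
          + sq_sum M h (dx_plus h (e n)) + compact_form M h (e n)) / 2"
    by (simp add: Y_def scheme_energy_def q_def[abs_def])
  have "0 \<le> compact_form M h q" using f(1) nn[of q] by linarith
  hence kin: "0 \<le> \<eta>\<^sup>2 * compact_form M h q" by simp
  note n = nn[of "e n"] nn[of "e (Suc n)"] nn[of "dx_plus h (e n)"] nn[of "dx_plus h (e (Suc n))"]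
  show "0 \<le> scheme_energy M h k \<eta> e n" using kin f n unfolding Y_def[symmetric] Y by simp
  have *: "l2_norm M h u \<le> 2 * y" if "sq_sum M h u \<le> 4 * Y" for u
  proof -
    have "l2_norm M h u \<le> sqrt (4 * Y)" unfolding l2_norm_eq using that by (rule real_sqrt_le_mono)
    also have "\<dots> = 2 * y" by (simp add: real_sqrt_mult y_def Y_def)
    finally show ?thesis .
  qed
  show "l2_norm M h (e n) \<le> 2 * y" "l2_norm M h (e (Suc n)) \<le> 2 * y"
    "l2_norm M h (dx_plus h (e n)) \<le> 2 * y" "l2_norm M h (dx_plus h (e (Suc n))) \<le> 2 * y"
    using kin f n by (intro *; simp add: Y; argo)+
  have "\<eta>\<^sup>2 * (2 / 3 * sq_sum M h q) \<le> \<eta>\<^sup>2 * compact_form M h q" using f(1) by (intro mult_left_mono) auto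
  also have "\<dots> \<le> Y" using f n unfolding Y by simp
  finally have "sq_sum M h (\<lambda>j. \<eta> * q j) \<le> 4 * Y"
    using kin f n nn[of "\<lambda>j. \<eta> * q j"]
    by (simp add: sq_sum_def power_mult_distrib algebra_simps flip: sum_distrib_left)
  from *[OF this] have "\<eta> * l2_norm M h q \<le> 2 * y" using assms(2,4) by (simp add: l2_norm_cmult)
  thus "l2_norm M h (\<lambda>j. (e (Suc n) j - e n j) / k) \<le> 2 * y / \<eta>"
    using assms(4) unfolding q_def[abs_def] by (simp add: pos_le_divide_eq mult.commute)
qed

text \<open>With \<open>y\<close> the square root of the energy, the balance reads
\<open>y\<^bsub>n+1\<^esub>\<^sup>2 - y\<^sub>n\<^sup>2 \<le> (2 k / \<eta>) |R| (y\<^bsub>n+1\<^esub> + y\<^sub>n)\<close>, from which the factor \<open>y\<^bsub>n+1\<^esub> + y\<^sub>n\<close> cancels. The part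
of \<open>R\<close> that comes from \<open>f\<close> is bounded by \<open>e\<^bsub>n+1\<^esub>\<close>, which the energy at step \<open>n\<close> already contains; the recursion is
therefore explicit in \<open>y\<^sub>n\<close>.\<close>

lemma scheme_energy_growth:
  assumes e: "\<And>n. e n \<in> grid_space M" and "h > 0" "k > 0" "\<eta> > 0"
    and eq: "\<And>j. \<eta>\<^sup>2 * compact_op h (ds2 k e (Suc n)) j - dx2 h (time_avg e (Suc n)) j
               + compact_op h (time_avg e (Suc n)) j = \<rho> j - \<eta> * compact_op h f j"
    and \<rho>: "\<And>j. \<bar>\<rho> j\<bar> \<le> \<tau>"
    and f: "f \<in> grid_space M" "\<And>j. \<bar>f j\<bar> \<le> L * \<bar>e (Suc n) j\<bar>" and L: "L \<ge> 0"
  defines "y \<equiv> \<lambda>n. sqrt (scheme_energy M h k \<eta> e n)"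
  shows "y (Suc n) \<le> (1 + 4 * L * k) * y n + 2 * k * \<tau> * sqrt (h * M) / \<eta>"
proof -
  define q where "q n j = (e (Suc n) j - e n j) / k" for n j
  define R where "R j = \<rho> j - \<eta> * compact_op h f j" for j
  have y: "sqrt (scheme_energy M h k \<eta> e n) = y n" for n by (simp add: y_def)
  note c = scheme_energy_controls[where e = e, OF e assms(2-4), unfolded y]
  have y0: "0 \<le> y n" for n unfolding y_def using c(1) by simp
  have h0: "h \<ge> 0" using assms(2) by simp
  have y2: "scheme_energy M h k \<eta> e n = (y n)\<^sup>2" for n using c(1) by (simp add: y_def)
  have \<tau>: "\<tau> \<ge> 0" using \<rho>[of 0] by linarith
  \<comment> \<open>The bound for \<open>R = \<rho> - \<eta> A f\<close>: the second term uses \<open>|A f| \<le> |f| \<le> L |e\<^bsub>n+1\<^esub>| \<le> 2 L y\<^sub>n\<close>.\<close>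
  define B where "B = \<tau> * sqrt (h * M) + 2 * \<eta> * L * y n"
  have R: "l2_norm M h R \<le> B"
  proof -
    have "l2_norm M h R \<le> l2_norm M h \<rho> + l2_norm M h (\<lambda>j. (- \<eta>) * compact_op h f j)"
      using l2_norm_triangle[OF h0, of M \<rho> "\<lambda>j. (- \<eta>) * compact_op h f j"] by (simp add: R_def[abs_def])
    also have "l2_norm M h \<rho> \<le> l2_norm M h (\<lambda>_. \<tau>)" using \<rho> \<tau> by (intro l2_norm_mono h0) simp
    also have "\<dots> = \<tau> * sqrt (h * M)" using \<tau> by (simp add: l2_norm_const h0)
    also have "l2_norm M h (\<lambda>j. (- \<eta>) * compact_op h f j) = \<eta> * l2_norm M h (compact_op h f)"
      using assms(4) by (subst l2_norm_cmult[OF h0]) simp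
    also have "l2_norm M h (compact_op h f) \<le> l2_norm M h f" by (rule l2_norm_compact_op_le[OF f(1) assms(2)])
    also have "l2_norm M h f \<le> l2_norm M h (\<lambda>j. L * e (Suc n) j)"
      using f(2) L by (intro l2_norm_mono h0) (simp add: abs_mult)
    also have "\<dots> = L * l2_norm M h (e (Suc n))" using L by (simp add: l2_norm_cmult h0)
    also have "\<dots> \<le> L * (2 * y n)" using c(4)[of n] L by (intro mult_left_mono) auto
    finally show ?thesis using assms(4) by (simp add: B_def algebra_simps)
  qed
  have B0: "0 \<le> B" using R l2_norm_nonneg[OF h0] order_trans by blast
  have "(y (Suc n))\<^sup>2 - (y n)\<^sup>2 = k * (h * (\<Sum>j\<in>{0..<int M}. R j * (q (Suc n) j + q n j)))"
    using scheme_energy_step[where e = e, OF e assms(2,3) eq, folded q_def R_def] by (simp add: y2)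
  also have "\<dots> \<le> k * (l2_norm M h R * l2_norm M h (\<lambda>j. q (Suc n) j + q n j))"
    using assms(3) by (intro mult_left_mono l2_norm_Cauchy_Schwarz h0) auto
  also have "\<dots> \<le> k * (B * (2 * y (Suc n) / \<eta> + 2 * y n / \<eta>))"
  proof -
    have "l2_norm M h (\<lambda>j. q (Suc n) j + q n j) \<le> 2 * y (Suc n) / \<eta> + 2 * y n / \<eta>"
      using l2_norm_triangle[OF h0, of M "q (Suc n)" "q n"] c(2)[of "Suc n"] c(2)[of n]
      by (simp add: q_def[abs_def])
    thus ?thesis using assms(3) R B0 l2_norm_nonneg[OF h0] by (intro mult_left_mono mult_mono) auto
  qed
  also have "\<dots> = 2 * k * B / \<eta> * (y (Suc n) + y n)" by (simp add: algebra_simps add_divide_distrib)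
  finally have le: "(y (Suc n) - y n) * (y (Suc n) + y n) \<le> 2 * k * B / \<eta> * (y (Suc n) + y n)"
    by (simp add: power2_eq_square algebra_simps)
  have "y (Suc n) - y n \<le> 2 * k * B / \<eta>"
  proof (cases "y (Suc n) + y n = 0")
    case True
    hence "y (Suc n) - y n \<le> 0" using y0[of n] y0[of "Suc n"] by linarith
    also have "0 \<le> 2 * k * B / \<eta>" using B0 assms(3,4) by simp
    finally show ?thesis .
  next
    case False
    hence "y (Suc n) + y n > 0" using y0[of n] y0[of "Suc n"] by linarith
    thus ?thesis using le by (rule mult_right_le_imp_le[rotated])
  qed
  also have "2 * k * B / \<eta> = 4 * L * k * y n + 2 * k * \<tau> * sqrt (h * M) / \<eta>"
    using assms(4) by (simp add: B_def field_simps)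
  finally show ?thesis by (simp add: algebra_simps)
qed


section \<open>Consistency of the scheme\<close>

text \<open>Taylor expansion in which a Lipschitz condition replaces the last derivative. Differentiating the remainder of \<open>f i\<close> gives
that of \<open>f (i + 1)\<close>; so the bound follows from the mean value theorem by induction.\<close>

lemma taylor_lipschitz:
  fixes f :: "nat \<Rightarrow> real \<Rightarrow> real"
  assumes deriv: "\<And>i x. i < m \<Longrightarrow> x \<in> {\<alpha>..\<beta>} \<Longrightarrow>
      (f i has_real_derivative f (Suc i) x) (at x within {\<alpha>..\<beta>})"
    and lip: "\<And>x y. x \<in> {\<alpha>..\<beta>} \<Longrightarrow> y \<in> {\<alpha>..\<beta>} \<Longrightarrow> \<bar>f m x - f m y\<bar> \<le> L * \<bar>x - y\<bar>"
    and "L \<ge> 0" "x \<in> {\<alpha>..\<beta>}" "y \<in> {\<alpha>..\<beta>}" "i + n = m"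
  shows "\<bar>f i y - (\<Sum>l\<le>n. f (i + l) x * (y - x) ^ l / fact l)\<bar> \<le> L * \<bar>y - x\<bar> ^ Suc n"
  using assms(5,6)
proof (induction n arbitrary: i y)
  case 0
  thus ?case using lip[of y x] assms(4) by simp
next
  case (Suc n)
  define g where "g t = f i t - (\<Sum>l\<le>Suc n. f (i + l) x * (t - x) ^ l / fact l)" for t
  define g' where "g' t = f (Suc i) t - (\<Sum>l\<le>n. f (Suc i + l) x * (t - x) ^ l / fact l)" for t
  have gx: "g x = 0"
  proof -
    have "(\<Sum>l\<le>Suc n. f (i + l) x * (x - x) ^ l / fact l) = f i x"
      by (subst sum.atMost_Suc_shift) simp
    thus ?thesis by (simp add: g_def)
  qed
  have sub: "closed_segment x y \<subseteq> {\<alpha>..\<beta>}"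
    using assms(4) Suc.prems(1) by (simp add: closed_segment_subset)
  have dg: "(g has_real_derivative g' t) (at t within closed_segment x y)" if t: "t \<in> closed_segment x y" for t
  proof -
    have eq: "(\<Sum>l\<le>Suc n. f (i + l) x * (t - x) ^ l / fact l)
        = f i x + (\<Sum>l\<le>n. f (Suc i + l) x * ((t - x) ^ Suc l / fact (Suc l)))" for t
      by (subst sum.atMost_Suc_shift) simp
    have "((\<lambda>t. f (Suc i + l) x * ((t - x) ^ Suc l / fact (Suc l))) has_real_derivative
        f (Suc i + l) x * (t - x) ^ l / fact l) (at t within closed_segment x y)" for l
    proof -
      have "((\<lambda>t. (t - x) ^ Suc l) has_real_derivative real (Suc l) * (t - x) ^ l)
          (at t within closed_segment x y)"
        by (auto intro!: derivative_eq_intros simp del: power_Suc)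
      from DERIV_cmult[OF DERIV_cdivide[OF this, of "fact (Suc l)"], of "f (Suc i + l) x"]
      show ?thesis by (simp add: fact_Suc del: of_nat_Suc power_Suc)
    qed
    hence "((\<lambda>t. f i x + (\<Sum>l\<le>n. f (Suc i + l) x * ((t - x) ^ Suc l / fact (Suc l)))) has_real_derivative
        0 + (\<Sum>l\<le>n. f (Suc i + l) x * (t - x) ^ l / fact l)) (at t within closed_segment x y)"
      by (intro DERIV_add DERIV_const DERIV_sum)
    hence "((\<lambda>t. f i x + (\<Sum>l\<le>n. f (Suc i + l) x * ((t - x) ^ Suc l / fact (Suc l)))) has_real_derivative
        (\<Sum>l\<le>n. f (Suc i + l) x * (t - x) ^ l / fact l)) (at t within closed_segment x y)"
      by simp
    moreover have "(f i has_real_derivative f (Suc i) t) (at t within closed_segment x y)"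
      using deriv[of i t] t sub Suc.prems(2) by (intro DERIV_subset[OF deriv sub]) auto
    ultimately show ?thesis unfolding g_def g'_def eq by (intro DERIV_diff)
  qed
  have bound: "norm (g' t) \<le> L * \<bar>y - x\<bar> ^ Suc n" if t: "t \<in> closed_segment x y" for t
  proof -
    have "\<bar>g' t\<bar> \<le> L * \<bar>t - x\<bar> ^ Suc n"
      using Suc.IH[of t "Suc i"] t sub Suc.prems(2) by (auto simp: g'_def)
    also have "\<bar>t - x\<bar> \<le> \<bar>y - x\<bar>"
      using dist_in_closed_segment(1)[OF t] segment_bound1[OF t] by (simp add: abs_minus_commute)
    hence "L * \<bar>t - x\<bar> ^ Suc n \<le> L * \<bar>y - x\<bar> ^ Suc n"
      using assms(3) by (intro mult_left_mono power_mono) auto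
    finally show ?thesis by simp
  qed
  have "norm (g y - g x) \<le> L * \<bar>y - x\<bar> ^ Suc n * norm (y - x)"
    by (rule field_differentiable_bound[OF _ dg bound]) auto
  thus ?case unfolding g_def[of y] gx by (simp add: mult_ac g_def)
qed

lemma lipschitz_if_derivative_bounded:
  fixes f :: "real \<Rightarrow> real"
  assumes "\<And>x. x \<in> {\<alpha>..\<beta>} \<Longrightarrow> (f has_real_derivative f' x) (at x within {\<alpha>..\<beta>})"
    and "\<And>x. x \<in> {\<alpha>..\<beta>} \<Longrightarrow> \<bar>f' x\<bar> \<le> L" and "x \<in> {\<alpha>..\<beta>}" "y \<in> {\<alpha>..\<beta>}"
  shows "\<bar>f x - f y\<bar> \<le> L * \<bar>x - y\<bar>"
  using field_differentiable_bound[of "{\<alpha>..\<beta>}" f f' L x y] assms by simp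

lemma power_diff_le:
  fixes x y :: real
  assumes "\<bar>x\<bar> \<le> B" "\<bar>y\<bar> \<le> B"
  shows "\<bar>x ^ n - y ^ n\<bar> \<le> real n * B ^ (n - 1) * \<bar>x - y\<bar>"
proof (rule lipschitz_if_derivative_bounded[where \<alpha> = "- B" and \<beta> = B])
  fix z assume z: "z \<in> {- B..B}"
  show "((\<lambda>x. x ^ n) has_real_derivative real n * z ^ (n - 1)) (at z within {- B..B})"
    by (auto intro!: derivative_eq_intros)
  have "\<bar>z\<bar> ^ (n - 1) \<le> B ^ (n - 1)" using z by (intro power_mono) auto
  thus "\<bar>real n * z ^ (n - 1)\<bar> \<le> real n * B ^ (n - 1)"
    by (simp add: abs_mult power_abs mult_left_mono)
qed (use assms in auto)

lemma power_taylor: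
  fixes x y :: real
  assumes "\<bar>x\<bar> \<le> B" "\<bar>y\<bar> \<le> B"
  shows "\<bar>y ^ (p + 1) - x ^ (p + 1) - real (p + 1) * x ^ p * (y - x)\<bar>
    \<le> real (p + 1) * (real p * B ^ (p - 1)) * (y - x)\<^sup>2"
proof -
  define f where "f i z = (if i = 0 then z ^ (p + 1) else real (p + 1) * z ^ p)" for i :: nat and z :: real
  have B: "B \<ge> 0" using assms by linarith
  have "\<bar>f 0 y - (\<Sum>l\<le>1. f (0 + l) x * (y - x) ^ l / fact l)\<bar>
    \<le> real (p + 1) * (real p * B ^ (p - 1)) * \<bar>y - x\<bar> ^ Suc 1"
  proof (rule taylor_lipschitz[where m = 1 and \<alpha> = "- B" and \<beta> = B])
    fix i and z :: real assume "i < (1::nat)"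
    moreover have "((\<lambda>z. z ^ (p + 1)) has_real_derivative real (p + 1) * z ^ p) (at z within {- B..B})"
      using DERIV_power[OF DERIV_ident, of "p + 1" z "{- B..B}"] by simp
    ultimately show "(f i has_real_derivative f (Suc i) z) (at z within {- B..B})"
      unfolding f_def by simp
  next
    fix z w :: real assume "z \<in> {- B..B}" "w \<in> {- B..B}"
    hence "\<bar>z ^ p - w ^ p\<bar> \<le> real p * B ^ (p - 1) * \<bar>z - w\<bar>" by (intro power_diff_le) auto
    hence "real (p + 1) * \<bar>z ^ p - w ^ p\<bar> \<le> real (p + 1) * (real p * B ^ (p - 1) * \<bar>z - w\<bar>)"
      by (intro mult_left_mono) auto
    moreover have "f 1 z - f 1 w = real (p + 1) * (z ^ p - w ^ p)" by (simp add: f_def algebra_simps)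
    ultimately show "\<bar>f 1 z - f 1 w\<bar> \<le> real (p + 1) * (real p * B ^ (p - 1)) * \<bar>z - w\<bar>"
      by (simp add: abs_mult mult.assoc del: of_nat_add of_nat_Suc)
  qed (use assms B in auto)
  moreover have "(\<Sum>l\<le>1. f (0 + l) x * (y - x) ^ l / fact l)
      = x ^ (p + 1) + real (p + 1) * x ^ p * (y - x)"
    by (simp add: f_def)
  ultimately show ?thesis
    by (simp add: f_def diff_diff_eq flip: power2_eq_square del: of_nat_add of_nat_Suc)
qed

text \<open>The average of \<open>v\<^bsup>p+1\<^esup>\<close> over the times \<open>s - k\<close> and \<open>s + k\<close> deviates from its value at \<open>s\<close> by at most this
constant times \<open>k\<^sup>2 \<epsilon>\<^bsup>-2p\<^esup>\<close>, when \<open>|v| \<le> C\<close>, \<open>|v\<^sub>s| \<le> C \<epsilon>\<^bsup>-p\<^esup>\<close> and \<open>|v\<^sub>s\<^sub>s| \<le> C \<epsilon>\<^bsup>-2p\<^esup>\<close>.\<close>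

definition nonlinearity_const :: "nat \<Rightarrow> real \<Rightarrow> real" where
  "nonlinearity_const p C
     = real (p + 1) * C ^ (p + 1) + real (p + 1) * (real p * C ^ (p - 1)) * C\<^sup>2"

text \<open>Reducing \<open>j\<close> modulo \<open>M\<close> keeps the node in \<open>[a, b]\<close>, where the exact solution is defined, and makes its
samples periodic.\<close>

definition node :: "real \<Rightarrow> real \<Rightarrow> nat \<Rightarrow> int \<Rightarrow> real" where
  "node a h M j = a + of_int (j mod int M) * h"

context smooth_klein_gordon
begin

lemma d_lipschitz:
  assumes "i \<le> 3" "s \<in> {0..T}" "t \<in> {0..T}" "x \<in> {a..b}"
  shows "\<bar>d i s x - d i t x\<bar> \<le> C / \<epsilon> ^ (p * Suc i) * \<bar>s - t\<bar>"
  using assms by (intro lipschitz_if_derivative_bounded[where f = "\<lambda>t. d i t x" and f' = "\<lambda>t. d (Suc i) t x"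
        and \<alpha> = 0 and \<beta> = T] d_derivative d_bound) auto

lemma d_taylor:
  assumes "i + n \<le> 3" "s \<in> {0..T}" "t \<in> {0..T}" "x \<in> {a..b}"
  shows "\<bar>d i t x - (\<Sum>l\<le>n. d (i + l) s x * (t - s) ^ l / fact l)\<bar>
    \<le> C / \<epsilon> ^ (p * Suc (i + n)) * \<bar>t - s\<bar> ^ Suc n"
  using taylor_lipschitz[where f = "\<lambda>i t. d i t x" and m = "i + n" and \<alpha> = 0 and \<beta> = T
      and L = "C / \<epsilon> ^ (p * Suc (i + n))" and x = s and y = t and i = i and n = n]
    assms C_pos \<epsilon>_pos d_derivative d_lipschitz by auto

text \<open>The second difference of \<open>v\<close> is compared with the average of \<open>v\<^sub>s\<^sub>s\<close> over the two outer time levels. There the equation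
turns \<open>v\<^sub>s\<^sub>s\<close> into \<open>v\<^sub>x\<^sub>x\<close>, which the scheme averages over these levels too.\<close>

lemma time_difference_error:
  assumes "k > 0" "s - k \<in> {0..T}" "s \<in> {0..T}" "s + k \<in> {0..T}" "x \<in> {a..b}"
  shows "\<bar>(v x (s + k) - 2 * v x s + v x (s - k)) / k\<^sup>2 - (d 2 (s + k) x + d 2 (s - k) x) / 2\<bar>
    \<le> 3 * (C / \<epsilon> ^ (p * 4)) * k\<^sup>2"
proof -
  define B where "B = C / \<epsilon> ^ (p * 4)"
  have s0: "\<bar>d 0 t x - (d 0 s x + d 1 s x * (t - s) + d 2 s x * (t - s)\<^sup>2 / 2 + d 3 s x * (t - s) ^ 3 / 6)\<bar>
      \<le> B * k ^ 4" if "t \<in> {0..T}" "\<bar>t - s\<bar> = k" for t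
    using d_taylor[of 0 3 s t x] assms that
    by (simp add: B_def numeral_eq_Suc fact_numeral)
  have s2: "\<bar>d 2 t x - (d 2 s x + d 3 s x * (t - s))\<bar> \<le> B * k\<^sup>2" if "t \<in> {0..T}" "\<bar>t - s\<bar> = k" for t
    using d_taylor[of 2 1 s t x] assms that
    by (simp add: B_def numeral_eq_Suc)
  define r1 where "r1 = d 0 (s + k) x - (d 0 s x + d 1 s x * k + d 2 s x * k\<^sup>2 / 2 + d 3 s x * k ^ 3 / 6)"
  define r2 where "r2 = d 0 (s - k) x - (d 0 s x - d 1 s x * k + d 2 s x * k\<^sup>2 / 2 - d 3 s x * k ^ 3 / 6)"
  define q1 where "q1 = d 2 (s + k) x - (d 2 s x + d 3 s x * k)"
  define q2 where "q2 = d 2 (s - k) x - (d 2 s x - d 3 s x * k)"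
  have r: "\<bar>r1\<bar> \<le> B * k ^ 4" "\<bar>r2\<bar> \<le> B * k ^ 4" "\<bar>q1\<bar> \<le> B * k\<^sup>2" "\<bar>q2\<bar> \<le> B * k\<^sup>2"
    using s0[of "s + k"] s0[of "s - k"] s2[of "s + k"] s2[of "s - k"] assms
    by (simp_all add: r1_def r2_def q1_def q2_def)
  have sum: "d 0 (s + k) x - 2 * d 0 s x + d 0 (s - k) x = k\<^sup>2 * d 2 s x + (r1 + r2)"
    by (simp add: r1_def r2_def algebra_simps)
  have "(v x (s + k) - 2 * v x s + v x (s - k)) / k\<^sup>2 - (d 2 (s + k) x + d 2 (s - k) x) / 2
      = (r1 + r2) / k\<^sup>2 - (q1 + q2) / 2"
    using sum assms d_0[of "s + k" x] d_0[of s x] d_0[of "s - k" x]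
    by (simp add: q1_def q2_def field_simps)
  also have "\<bar>\<dots>\<bar> \<le> (\<bar>r1\<bar> + \<bar>r2\<bar>) / k\<^sup>2 + (\<bar>q1\<bar> + \<bar>q2\<bar>) / 2"
  proof -
    have "\<bar>(r1 + r2) / k\<^sup>2\<bar> \<le> (\<bar>r1\<bar> + \<bar>r2\<bar>) / k\<^sup>2" "\<bar>(q1 + q2) / 2\<bar> \<le> (\<bar>q1\<bar> + \<bar>q2\<bar>) / 2"
      using abs_triangle_ineq[of r1 r2] abs_triangle_ineq[of q1 q2]
      by (simp_all add: abs_divide divide_right_mono)
    thus ?thesis by (intro order_trans[OF abs_triangle_ineq4] add_mono)
  qed
  also have "\<dots> \<le> (B * k ^ 4 + B * k ^ 4) / k\<^sup>2 + (B * k\<^sup>2 + B * k\<^sup>2) / 2"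
    using r by (intro add_mono divide_right_mono) auto
  also have "(B * k ^ 4 + B * k ^ 4) / k\<^sup>2 + (B * k\<^sup>2 + B * k\<^sup>2) / 2 = 3 * B * k\<^sup>2"
    using assms(1) by (simp add: field_simps power2_eq_square power4_eq_xxxx)
  finally show ?thesis by (simp add: B_def)
qed

lemma v_bound: "s \<in> {0..T} \<Longrightarrow> x \<in> {a..b} \<Longrightarrow> \<bar>v x s\<bar> \<le> C"
  using d_bound[of 0 s x] d_0[of s x] by simp

lemma nonlinearity_average_error:
  assumes "k > 0" "s - k \<in> {0..T}" "s \<in> {0..T}" "s + k \<in> {0..T}" "x \<in> {a..b}"
  shows "\<bar>(v x (s + k) ^ (p + 1) + v x (s - k) ^ (p + 1)) / 2 - v x s ^ (p + 1)\<bar>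
    \<le> nonlinearity_const p C * (k\<^sup>2 / \<epsilon> ^ (2 * p))"
proof -
  define K where "K = real (p + 1) * (real p * C ^ (p - 1))"
  define P where "P = real (p + 1) * v x s ^ p"
  define \<delta> where "\<delta> t = v x t - v x s" for t
  define \<rho> where "\<rho> t = v x t ^ (p + 1) - v x s ^ (p + 1) - P * \<delta> t" for t
  define W where "W = k\<^sup>2 / \<epsilon> ^ (2 * p)"
  have K: "K \<ge> 0" using C_pos by (simp add: K_def)
  have W: "W \<ge> 0" using \<epsilon>_pos by (simp add: W_def)
  have P: "\<bar>P\<bar> \<le> real (p + 1) * C ^ p"
    using v_bound[OF assms(3,5)] by (auto simp: P_def abs_mult power_abs intro!: mult_left_mono power_mono)
  have \<rho>: "\<bar>\<rho> t\<bar> \<le> K * (C\<^sup>2 * W)" if t: "t \<in> {0..T}" "\<bar>t - s\<bar> = k" for t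
  proof -
    have "\<bar>\<delta> t\<bar> \<le> C / \<epsilon> ^ p * k"
      using d_lipschitz[of 0 t s x] t assms d_0[of s x] d_0[of t x] by (simp add: \<delta>_def)
    hence "\<bar>\<delta> t\<bar>\<^sup>2 \<le> (C / \<epsilon> ^ p * k)\<^sup>2" by (intro power_mono) auto
    also have "\<dots> = C\<^sup>2 * W" by (simp add: W_def power_mult_distrib power_divide power_mult mult.commute[of 2])
    finally have "(\<delta> t)\<^sup>2 \<le> C\<^sup>2 * W" by simp
    moreover have "\<bar>\<rho> t\<bar> \<le> K * (\<delta> t)\<^sup>2"
      unfolding \<rho>_def K_def P_def \<delta>_def using t assms by (intro power_taylor v_bound) auto
    ultimately show ?thesis using K by (meson mult_left_mono order_trans)
  qed
  have lin: "\<bar>\<delta> (s + k) + \<delta> (s - k)\<bar> \<le> 2 * (C * W)"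
  proof -
    have "\<bar>\<delta> t - d 1 s x * (t - s)\<bar> \<le> C * W" if t: "t \<in> {0..T}" "\<bar>t - s\<bar> = k" for t
      using d_taylor[of 0 1 s t x] t assms d_0[of s x] d_0[of t x]
      by (simp add: \<delta>_def W_def numeral_eq_Suc algebra_simps)
    from this[of "s + k"] this[of "s - k"] show ?thesis using assms by simp
  qed
  have "(v x (s + k) ^ (p + 1) + v x (s - k) ^ (p + 1)) / 2 - v x s ^ (p + 1)
      = P * ((\<delta> (s + k) + \<delta> (s - k)) / 2) + (\<rho> (s + k) + \<rho> (s - k)) / 2"
    unfolding \<rho>_def distrib_left add_divide_distrib by (simp add: field_simps)
  also have "\<bar>\<dots>\<bar> \<le> \<bar>P\<bar> * \<bar>(\<delta> (s + k) + \<delta> (s - k)) / 2\<bar> + \<bar>(\<rho> (s + k) + \<rho> (s - k)) / 2\<bar>"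
    by (metis abs_mult abs_triangle_ineq)
  also have "\<dots> \<le> real (p + 1) * C ^ p * (C * W) + K * (C\<^sup>2 * W)"
  proof (intro add_mono mult_mono P)
    show "\<bar>(\<delta> (s + k) + \<delta> (s - k)) / 2\<bar> \<le> C * W" using lin by simp
    show "\<bar>(\<rho> (s + k) + \<rho> (s - k)) / 2\<bar> \<le> K * (C\<^sup>2 * W)"
      using \<rho>[of "s + k"] \<rho>[of "s - k"] assms by simp
  qed (use C_pos in auto)
  also have "\<dots> = nonlinearity_const p C * W"
    by (simp add: nonlinearity_const_def K_def algebra_simps)
  finally show ?thesis by (simp add: W_def)
qed

text \<open>The weights of \<open>A\<close> are those for which the terms \<open>h\<^sup>2 \<partial>\<^sub>x\<^sup>4 v / 12\<close> of \<open>\<delta>\<^sub>x\<^sup>2 v\<close> and \<open>A v\<^sub>x\<^sub>x\<close> agree. At the node \<open>a\<close> the left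
neighbour is \<open>b - h\<close>; periodicity of the derivatives up to order five allows expanding there around \<open>b\<close>.\<close>

lemma compact_difference_error:
  assumes M: "M \<ge> 1" and h: "h = (b - a) / real M" and s: "s \<in> {0..T}"
  shows "\<bar>dx2 h (\<lambda>j. v (node a h M j) s) j - compact_op h (\<lambda>j. G 2 s (node a h M j)) j\<bar>
    \<le> 3 * C * h ^ 4"
proof -
  define m where "m = j mod int M"
  have m: "0 \<le> m" "m < int M" using M by (auto simp: m_def)
  have hpos: "h > 0" using M a_less_b by (simp add: h)
  have hM: "real M * h = b - a" using M by (simp add: h)
  have node_in: "a + of_int i * h \<in> {a..b}" if "0 \<le> i" "i \<le> int M" for i
  proof -
    have "of_int i * h \<le> real M * h" using that hpos by (intro mult_right_mono) auto
    thus ?thesis using that hpos hM by simp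
  qed
  define x where "x = a + of_int m * h"
  \<comment> \<open>The point around which the left neighbour is expanded.\<close>
  define x' where "x' = (if m = 0 then b else x)"
  have x: "x \<in> {a..b}" "x + h \<in> {a..b}"
    using node_in[of m] node_in[of "m + 1"] m by (auto simp: x_def algebra_simps)
  have xl: "x' \<in> {a..b}" "x' - h \<in> {a..b}"
  proof -
    have "b = a + of_int (int M) * h" using hM by simp
    thus "x' \<in> {a..b}" "x' - h \<in> {a..b}"
      using node_in[of "int M"] node_in[of "int M - 1"] node_in[of m] node_in[of "m - 1"] m M
      by (auto simp: x'_def x_def algebra_simps)
  qed
  have Gx': "G l s x' = G l s x" if "l \<le> 5" for l
    using G_periodic[OF that s] by (simp add: x'_def x_def)
  have right: "G l s (node a h M (j + 1)) = G l s (x + h)" if "l \<le> 5" for l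
  proof -
    have "(j + 1) mod int M = (m + 1) mod int M" by (simp add: m_def mod_add_left_eq)
    show ?thesis
    proof (cases "m + 1 = int M")
      case True
      hence "real_of_int m = real M - 1" using arg_cong[OF True, of real_of_int] by simp
      hence "x = a + (real M - 1) * h" unfolding x_def by (simp only:)
      hence "x + h = b" using hM by (simp add: left_diff_distrib)
      thus ?thesis using \<open>(j + 1) mod int M = _\<close> True G_periodic[OF that s] by (simp add: node_def)
    next
      case False
      hence "(m + 1) mod int M = m + 1" using m by (intro mod_pos_pos_trivial) auto
      thus ?thesis using \<open>(j + 1) mod int M = _\<close> by (simp add: node_def x_def algebra_simps)
    qed
  qed
  have left: "node a h M (j - 1) = x' - h"
  proof -
    have 1: "(j - 1) mod int M = (m - 1) mod int M" by (simp add: m_def mod_diff_left_eq)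
    show ?thesis
    proof (cases "m = 0")
      case True
      hence "(m - 1) mod int M = int M - 1" using M by (simp add: zmod_minus1)
      hence "(j - 1) mod int M = int M - 1" by (rule trans[OF 1])
      hence "node a h M (j - 1) = a + (real M - 1) * h" by (simp only: node_def) simp
      thus ?thesis using True hM by (simp add: x'_def left_diff_distrib)
    next
      case False
      hence "(m - 1) mod int M = m - 1" using m by (intro mod_pos_pos_trivial) auto
      hence "(j - 1) mod int M = m - 1" by (rule trans[OF 1])
      thus ?thesis using False by (simp add: node_def x'_def x_def left_diff_distrib)
    qed
  qed
  have mid: "node a h M j = x" by (simp add: node_def x_def m_def)
  have tay: "\<bar>G l s z - (\<Sum>i\<le>5 - l. G (l + i) s y * (z - y) ^ i / fact i)\<bar> \<le> C * \<bar>z - y\<bar> ^ Suc (5 - l)"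
    if "l \<le> 5" "y \<in> {a..b}" "z \<in> {a..b}" for l y z
    using that C_pos s G_derivative G_5_lipschitz
    by (intro taylor_lipschitz[where f = "\<lambda>l. G l s" and m = 5 and \<alpha> = a and \<beta> = b]) auto
  define r1 where "r1 = G 0 s (x + h) - (G 0 s x + G 1 s x * h + G 2 s x * h ^ 2 / 2 + G 3 s x * h ^ 3 / 6
      + G 4 s x * h ^ 4 / 24 + G 5 s x * h ^ 5 / 120)"
  define r2 where "r2 = G 0 s (x' - h) - (G 0 s x - G 1 s x * h + G 2 s x * h ^ 2 / 2 - G 3 s x * h ^ 3 / 6
      + G 4 s x * h ^ 4 / 24 - G 5 s x * h ^ 5 / 120)"
  define q1 where "q1 = G 2 s (x + h) - (G 2 s x + G 3 s x * h + G 4 s x * h ^ 2 / 2 + G 5 s x * h ^ 3 / 6)"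
  define q2 where "q2 = G 2 s (x' - h) - (G 2 s x - G 3 s x * h + G 4 s x * h ^ 2 / 2 - G 5 s x * h ^ 3 / 6)"
  have r: "\<bar>r1\<bar> \<le> C * h ^ 6" "\<bar>r2\<bar> \<le> C * h ^ 6" "\<bar>q1\<bar> \<le> C * h ^ 4" "\<bar>q2\<bar> \<le> C * h ^ 4"
    using tay[of 0 x "x + h"] tay[of 0 x' "x' - h"] tay[of 2 x "x + h"] tay[of 2 x' "x' - h"]
      x xl hpos Gx'[of 0] Gx'[of 1] Gx'[of 2] Gx'[of 3] Gx'[of 4] Gx'[of 5]
    by (simp_all add: r1_def r2_def q1_def q2_def numeral_eq_Suc fact_numeral algebra_simps)
  have "dx2 h (\<lambda>j. v (node a h M j) s) j - compact_op h (\<lambda>j. G 2 s (node a h M j)) j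
      = (r1 + r2) / h\<^sup>2 - (q1 + q2) / 12"
  proof -
    have "v (node a h M (j + 1)) s = G 0 s (x + h)"
    proof -
      have "node a h M (j + 1) \<in> {a..b}"
        unfolding node_def using M
        by (intro node_in pos_mod_sign less_imp_le[OF pos_mod_bound]) auto
      thus ?thesis using right[of 0] G_0[OF s] by simp
    qed
    moreover have "v (node a h M (j - 1)) s = G 0 s (x' - h)" "v (node a h M j) s = G 0 s x"
      using G_0[OF s] x xl left mid by auto
    ultimately show ?thesis
      using hpos right[of 2] unfolding compact_op_eq[OF less_imp_neq[OF hpos, symmetric]] dx2_def left mid
      by (simp add: r1_def r2_def q1_def q2_def field_simps power2_eq_square power3_eq_cube power4_eq_xxxx)
  qed
  also have "\<bar>\<dots>\<bar> \<le> (\<bar>r1\<bar> + \<bar>r2\<bar>) / h\<^sup>2 + (\<bar>q1\<bar> + \<bar>q2\<bar>) / 12"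
  proof -
    have "\<bar>(r1 + r2) / h\<^sup>2\<bar> \<le> (\<bar>r1\<bar> + \<bar>r2\<bar>) / h\<^sup>2" "\<bar>(q1 + q2) / 12\<bar> \<le> (\<bar>q1\<bar> + \<bar>q2\<bar>) / 12"
      using abs_triangle_ineq[of r1 r2] abs_triangle_ineq[of q1 q2]
      by (simp_all add: abs_divide divide_right_mono)
    thus ?thesis by (intro order_trans[OF abs_triangle_ineq4] add_mono)
  qed
  also have "\<dots> \<le> (C * h ^ 6 + C * h ^ 6) / h\<^sup>2 + (C * h ^ 4 + C * h ^ 4) / 12"
    using r by (intro add_mono divide_right_mono) auto
  also have "(C * h ^ 6 + C * h ^ 6) / h\<^sup>2 = 2 * C * h ^ 4"
    using hpos by (simp add: field_simps flip: power_add)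
  also have "2 * C * h ^ 4 + (C * h ^ 4 + C * h ^ 4) / 12 \<le> 3 * C * h ^ 4"
    using C_pos hpos by simp
  finally show ?thesis .
qed

end

lemma node_in:
  assumes "a < b" "M \<ge> 1" "h = (b - a) / real M"
  shows "node a h M j \<in> {a..b}"
proof -
  have m: "0 \<le> j mod int M" "j mod int M < int M" using assms(2) by auto
  have h: "h > 0" using assms by simp
  have "of_int (j mod int M) * h \<le> real M * h" using m h by (intro mult_right_mono) auto
  also have "\<dots> = b - a" using assms(2,3) by simp
  finally show ?thesis using m h by (simp add: node_def)
qed

lemma node_grid_space: "(\<lambda>j. F (node a h M j)) \<in> grid_space M"
  by (simp add: grid_space_def node_def)

lemma compact_op_add: "compact_op h (\<lambda>j. u j + w j) j = compact_op h u j + compact_op h w j"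
  by (simp add: compact_op_def dx2_def add_divide_distrib diff_divide_distrib algebra_simps)

lemma compact_op_diff: "compact_op h (\<lambda>j. u j - w j) j = compact_op h u j - compact_op h w j"
  by (simp add: compact_op_def dx2_def add_divide_distrib diff_divide_distrib algebra_simps)

lemma dx2_add: "dx2 h (\<lambda>j. u j + w j) j = dx2 h u j + dx2 h w j"
  by (simp add: dx2_def add_divide_distrib diff_divide_distrib algebra_simps)

lemma dx2_diff: "dx2 h (\<lambda>j. u j - w j) j = dx2 h u j - dx2 h w j"
  by (simp add: dx2_def add_divide_distrib diff_divide_distrib algebra_simps)

lemma time_avg_eq: "time_avg w n = (\<lambda>j. 1 / 2 * (w (n + 1) j + w (n - 1) j))"
  by (simp add: time_avg_def fun_eq_iff)

lemma abs_compact_op_le: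
  assumes "h \<noteq> 0" "\<And>i. \<bar>u i\<bar> \<le> B"
  shows "\<bar>compact_op h u j\<bar> \<le> B"
  unfolding compact_op_eq[OF assms(1)] using assms(2)[of "j + 1"] assms(2)[of j] assms(2)[of "j - 1"]
  by (simp add: abs_le_iff)

context smooth_klein_gordon
begin

text \<open>Replace \<open>\<delta>\<^sub>x\<^sup>2 v\<close> by \<open>A v\<^sub>x\<^sub>x\<close> at both outer time levels and insert the equation there. What remains is \<open>A Z\<close> with
\<open>Z = \<epsilon>\<^bsup>2p\<^esup> (\<delta>\<^sub>s\<^sup>2 v - v\<^sub>s\<^sub>s) - \<epsilon>\<^bsup>p\<^esup> (v\<^bsup>p+1\<^esup> averaged - v\<^bsup>p+1\<^esup>)\<close>, where \<open>v\<^sub>s\<^sub>s\<close> too is averaged over the outer levels.\<close>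

lemma truncation_error:
  assumes M: "M \<ge> 1" and h: "h = (b - a) / real M" and k: "k > 0" and n: "real (n + 2) * k \<le> T"
  defines "V \<equiv> \<lambda>n j. v (node a h M j) (real n * k)"
  shows "\<bar>(\<epsilon> ^ p)\<^sup>2 * compact_op h (ds2 k V (Suc n)) j - dx2 h (time_avg V (Suc n)) j
      + compact_op h (time_avg V (Suc n)) j + \<epsilon> ^ p * compact_op h (\<lambda>j. V (Suc n) j ^ (p + 1)) j\<bar>
    \<le> (3 * C + nonlinearity_const p C) * (h ^ 4 + k\<^sup>2 / \<epsilon> ^ (2 * p))"
proof -
  have h0: "h \<noteq> 0" using M a_less_b by (simp add: h)
  define s where "s = real (Suc n) * k"
  have sp: "s + k = real (n + 2) * k" and sm: "s - k = real n * k"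
    by (simp_all add: s_def algebra_simps)
  have s: "s - k \<in> {0..T}" "s \<in> {0..T}" "s + k \<in> {0..T}"
    using k n unfolding sp[symmetric] by (auto simp: s_def sm[symmetric] algebra_simps)
  have V: "V (Suc (Suc n)) i = v (node a h M i) (s + k)" "V (Suc n) i = v (node a h M i) s"
    "V n i = v (node a h M i) (s - k)" for i
  proof -
    show "V (Suc (Suc n)) i = v (node a h M i) (s + k)" unfolding V_def sp by simp
    show "V (Suc n) i = v (node a h M i) s" unfolding V_def s_def by simp
    show "V n i = v (node a h M i) (s - k)" unfolding V_def sm by simp
  qed
  have x: "node a h M i \<in> {a..b}" for i by (rule node_in[OF a_less_b M h])
  define \<eta> where "\<eta> = \<epsilon> ^ p"
  have \<eta>: "0 < \<eta>" "\<eta> \<le> 1" using \<epsilon>_pos \<epsilon>_le_1 by (auto simp: \<eta>_def power_le_one)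
  have \<eta>2: "\<epsilon> ^ (2 * p) = \<eta>\<^sup>2" by (simp add: \<eta>_def power_even_eq)
  have \<eta>4: "\<epsilon> ^ (p * 4) = \<eta> ^ 4" by (simp add: \<eta>_def power_mult)
  define g where "g i = 1 / 2 * (G 2 (s + k) (node a h M i) + G 2 (s - k) (node a h M i))" for i
  define A1 where "A1 i = ds2 k V (Suc n) i - (d 2 (s + k) (node a h M i) + d 2 (s - k) (node a h M i)) / 2" for i
  define A2 where "A2 i = (V (Suc (Suc n)) i ^ (p + 1) + V n i ^ (p + 1)) / 2 - V (Suc n) i ^ (p + 1)" for i
  define Z where "Z i = \<eta>\<^sup>2 * A1 i - \<eta> * A2 i" for i
  have A1: "\<bar>A1 i\<bar> \<le> 3 * (C / \<eta> ^ 4) * k\<^sup>2" for i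
    using time_difference_error[OF k s x[of i]] by (simp add: A1_def ds2_def V \<eta>4)
  have A2: "\<bar>A2 i\<bar> \<le> nonlinearity_const p C * (k\<^sup>2 / \<eta>\<^sup>2)" for i
    using nonlinearity_average_error[OF k s x[of i]] by (simp add: A2_def V \<eta>2)
  have N0: "0 \<le> nonlinearity_const p C" using C_pos by (simp add: nonlinearity_const_def)
  have Z: "\<bar>Z i\<bar> \<le> (3 * C + nonlinearity_const p C) * (k\<^sup>2 / \<eta>\<^sup>2)" for i
  proof -
    have "\<bar>Z i\<bar> \<le> \<bar>\<eta>\<^sup>2 * A1 i\<bar> + \<bar>\<eta> * A2 i\<bar>" unfolding Z_def by (rule abs_triangle_ineq4)
    also have "\<bar>\<eta>\<^sup>2 * A1 i\<bar> \<le> \<eta>\<^sup>2 * (3 * (C / \<eta> ^ 4) * k\<^sup>2)"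
      unfolding abs_mult using A1[of i] by (intro mult_mono) auto
    also have "\<dots> = 3 * C * (k\<^sup>2 / \<eta>\<^sup>2)" using \<eta> by (simp add: field_simps power2_eq_square power4_eq_xxxx)
    also have "\<bar>\<eta> * A2 i\<bar> \<le> 1 * (nonlinearity_const p C * (k\<^sup>2 / \<eta>\<^sup>2))"
      unfolding abs_mult using A2[of i] \<eta> by (intro mult_mono) auto
    finally show ?thesis by (simp only: distrib_right mult_1)
  qed
  have key: "\<eta>\<^sup>2 * ds2 k V (Suc n) i + time_avg V (Suc n) i + \<eta> * V (Suc n) i ^ (p + 1) = Z i + g i" for i
  proof -
    have "G 2 t (node a h M i)
        = \<eta>\<^sup>2 * d 2 t (node a h M i) + v (node a h M i) t + \<eta> * v (node a h M i) t ^ (p + 1)"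
      if "t \<in> {0..T}" for t using pde[OF that x[of i]] by (simp add: \<eta>2 \<eta>_def[symmetric])
    thus ?thesis using s unfolding Z_def g_def A1_def A2_def by (simp add: time_avg_def V field_simps)
  qed
  have "\<eta>\<^sup>2 * compact_op h (ds2 k V (Suc n)) j + compact_op h (time_avg V (Suc n)) j
      + \<eta> * compact_op h (\<lambda>j. V (Suc n) j ^ (p + 1)) j
    = compact_op h (\<lambda>i. \<eta>\<^sup>2 * ds2 k V (Suc n) i + time_avg V (Suc n) i + \<eta> * V (Suc n) i ^ (p + 1)) j"
    by (simp only: compact_op_add compact_op_cmult)
  also have "\<dots> = compact_op h Z j + compact_op h g j" unfolding key by (rule compact_op_add)
  also have "compact_op h g j = 1 / 2 * (compact_op h (\<lambda>i. G 2 (s + k) (node a h M i)) j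
      + compact_op h (\<lambda>i. G 2 (s - k) (node a h M i)) j)"
    unfolding g_def[abs_def] compact_op_cmult compact_op_add ..
  finally have A: "\<eta>\<^sup>2 * compact_op h (ds2 k V (Suc n)) j + compact_op h (time_avg V (Suc n)) j
      + \<eta> * compact_op h (\<lambda>j. V (Suc n) j ^ (p + 1)) j
    = compact_op h Z j + 1 / 2 * (compact_op h (\<lambda>i. G 2 (s + k) (node a h M i)) j
      + compact_op h (\<lambda>i. G 2 (s - k) (node a h M i)) j)" .
  have D: "dx2 h (time_avg V (Suc n)) j = 1 / 2 * (dx2 h (\<lambda>j. v (node a h M j) (s + k)) j
      + dx2 h (\<lambda>j. v (node a h M j) (s - k)) j)"
    unfolding time_avg_eq dx2_cmult dx2_add by (simp add: V)
  have combine: "\<bar>X - D + Y + W\<bar> \<le> z + c"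
    if "X + Y + W = Z + 1 / 2 * (g1 + g2)" "D = 1 / 2 * (d1 + d2)"
      "\<bar>Z\<bar> \<le> z" "\<bar>d1 - g1\<bar> \<le> c" "\<bar>d2 - g2\<bar> \<le> c" for X D Y W Z g1 g2 d1 d2 z c :: real
  proof -
    have "2 * X + 2 * Y + 2 * W = 2 * Z + g1 + g2" "2 * D = d1 + d2" using that(1,2) by (simp_all add: field_simps)
    thus ?thesis using that(3-5) by (auto simp: abs_le_iff)
  qed
  have "\<bar>\<eta>\<^sup>2 * compact_op h (ds2 k V (Suc n)) j - dx2 h (time_avg V (Suc n)) j
      + compact_op h (time_avg V (Suc n)) j + \<eta> * compact_op h (\<lambda>j. V (Suc n) j ^ (p + 1)) j\<bar>
    \<le> (3 * C + nonlinearity_const p C) * (k\<^sup>2 / \<eta>\<^sup>2) + 3 * C * h ^ 4"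
    by (rule combine[OF A D abs_compact_op_le[OF h0 Z] compact_difference_error[OF M h s(3)]
          compact_difference_error[OF M h s(1)]])
  also have "3 * C * h ^ 4 \<le> (3 * C + nonlinearity_const p C) * h ^ 4"
    using N0 by (intro mult_right_mono) auto
  finally show ?thesis by (simp add: \<eta>2 \<eta>_def[symmetric] distrib_left)
qed

text \<open>The error of the scheme after the first step.\<close>

definition start_defect :: "real \<Rightarrow> real \<Rightarrow> real" where
  "start_defect k x = v x k - (v x 0 + k * d 1 0 x + k\<^sup>2 / 2 * d 2 0 x)"

lemma start_defect_bound:
  assumes "k \<in> {0..T}" "x \<in> {a..b}"
  shows "\<bar>start_defect k x\<bar> \<le> C / \<epsilon> ^ (p * 3) * k ^ 3"
  using d_taylor[of 0 2 0 k x] assms T_pos d_0[of k x] d_0[of 0 x]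
  by (simp add: start_defect_def numeral_eq_Suc algebra_simps)

text \<open>Taylor expansion of \<open>v(x, s) - v(y, s)\<close> in \<open>s\<close>; this is the place where the mixed derivative \<open>\<partial>\<^sub>x \<partial>\<^sub>s\<^sup>3 v\<close> is needed.\<close>

lemma start_defect_lipschitz:
  assumes "k \<in> {0..T}" "x \<in> {a..b}" "y \<in> {a..b}"
  shows "\<bar>start_defect k x - start_defect k y\<bar> \<le> C / \<epsilon> ^ (p * 3) * \<bar>x - y\<bar> * k ^ 3"
proof -
  define f where "f i t = d i t x - d i t y" for i t
  have df: "(f i has_real_derivative f (Suc i) t) (at t within {0..T})" if "i < 3" "t \<in> {0..T}" for i t
    unfolding f_def[abs_def] using that assms by (intro DERIV_diff d_derivative) auto
  have "\<bar>f 0 k - (\<Sum>l\<le>2. f (0 + l) 0 * (k - 0) ^ l / fact l)\<bar> \<le> C / \<epsilon> ^ (p * 3) * \<bar>x - y\<bar> * \<bar>k - 0\<bar> ^ Suc 2"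
  proof (rule taylor_lipschitz[where m = 2 and \<alpha> = 0 and \<beta> = T])
    show "\<bar>f 2 s - f 2 t\<bar> \<le> C / \<epsilon> ^ (p * 3) * \<bar>x - y\<bar> * \<bar>s - t\<bar>" if "s \<in> {0..T}" "t \<in> {0..T}" for s t
    proof (rule lipschitz_if_derivative_bounded[OF _ _ that])
      show "(f 2 has_real_derivative f 3 t) (at t within {0..T})" if "t \<in> {0..T}" for t
        using df[of 2 t] that by (simp add: numeral_3_eq_3 numeral_2_eq_2)
    qed (use assms d_3_lipschitz in \<open>auto simp: f_def\<close>)
  qed (use assms T_pos C_pos \<epsilon>_pos df in auto)
  thus ?thesis using assms T_pos d_0[of k x] d_0[of 0 x] d_0[of k y] d_0[of 0 y]
    by (simp add: f_def start_defect_def numeral_eq_Suc algebra_simps diff_divide_distrib)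
qed

end


section \<open>Convergence\<close>

text \<open>The Lipschitz constant of \<open>u\<^bsup>p+1\<^esup>\<close> for \<open>|u| \<le> C + 1\<close>, the range of numerical values at distance at most one from the
exact ones.\<close>

definition growth_rate :: "nat \<Rightarrow> real \<Rightarrow> real" where
  "growth_rate p C = real (p + 1) * (C + 1) ^ p"

text \<open>The Gronwall factor times the initial energy and the accumulated truncation error, both relative to the rate
\<open>h\<^sup>4 \<epsilon>\<^bsup>-p\<^esup> + k\<^sup>2 \<epsilon>\<^bsup>-3p\<^esup>\<close>.\<close>

definition energy_const :: "nat \<Rightarrow> real \<Rightarrow> real \<Rightarrow> real \<Rightarrow> real \<Rightarrow> real" where
  "energy_const p a b T C = exp (4 * growth_rate p C * T)
     * (sqrt (2 * (b - a)) * C + 2 * (3 * C + nonlinearity_const p C) * sqrt (b - a) * T)"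

definition sup_const :: "nat \<Rightarrow> real \<Rightarrow> real \<Rightarrow> real \<Rightarrow> real \<Rightarrow> real" where
  "sup_const p a b T C = (2 / sqrt (b - a) + 2 * sqrt (b - a)) * energy_const p a b T C"

lemma linear_growth_bound:
  fixes y :: real
  assumes "y' \<le> (1 + c) * y + r" "y \<le> exp z * u" "c \<ge> 0" "z \<ge> 0" "r \<ge> 0" "u \<ge> 0"
  shows "y' \<le> exp (z + c) * (u + r)"
proof -
  have "(1 + c) * y \<le> exp c * (exp z * u)"
  proof -
    have "(1 + c) * y \<le> (1 + c) * (exp z * u)" using assms by (intro mult_left_mono) auto
    also have "\<dots> \<le> exp c * (exp z * u)" using assms by (intro mult_right_mono exp_ge_add_one_self) auto
    finally show ?thesis .
  qed
  moreover have "1 * r \<le> exp (z + c) * r" using assms by (intro mult_right_mono) auto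
  ultimately show ?thesis using assms(1) by (simp add: exp_add algebra_simps)
qed

lemma sq_sum_le:
  assumes "h \<ge> 0" "\<And>j. j \<in> {0..<int M} \<Longrightarrow> \<bar>u j\<bar> \<le> B"
  shows "sq_sum M h u \<le> h * real M * B\<^sup>2"
proof -
  have "(u j)\<^sup>2 \<le> B\<^sup>2" if "j \<in> {0..<int M}" for j
    using power_mono[OF assms(2)[OF that], of 2] by simp
  hence "(\<Sum>j\<in>{0..<int M}. (u j)\<^sup>2) \<le> real (card {0..<int M}) * B\<^sup>2" by (rule sum_bounded_above)
  hence "h * (\<Sum>j\<in>{0..<int M}. (u j)\<^sup>2) \<le> h * (real M * B\<^sup>2)"
    using assms(1) by (intro mult_left_mono) auto
  thus ?thesis by (simp add: sq_sum_def mult.assoc)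
qed

lemma abs_le_Linf_norm:
  assumes "a < b" "continuous_on {a..b} u" "x \<in> {a..b}"
  shows "ereal \<bar>u x\<bar> \<le> Linf_norm a b u"
proof -
  have *: "\<bar>u x\<bar> \<le> K" if "Linf_norm a b u \<le> ereal K" for K
    by (rule continuous_abs_le_if_test_le[OF assms(1,2) _ assms(3)])
       (rule abs_test_pairing_le[OF continuous_imp_locally_integrable[OF assms(2)] _ that])
  show ?thesis
  proof (cases "Linf_norm a b u")
    case (real K)
    thus ?thesis using *[of K] by simp
  next
    case MInf
    thus ?thesis using *[of "-1"] by simp
  qed simp
qed

text \<open>Applying \<open>A\<close> removes its inverse. The scheme is given for \<open>0 \<le> j < M\<close> and extends to all \<open>j\<close> by periodicity.\<close>

lemma compact_scheme:
  assumes num: "numerical_solution p \<epsilon> a b \<phi> \<gamma> M h k w" and M: "M \<ge> 1" and h: "h \<noteq> 0"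
  shows "(\<epsilon> ^ p)\<^sup>2 * compact_op h (ds2 k w (Suc n)) j - dx2 h (time_avg w (Suc n)) j
      + compact_op h (time_avg w (Suc n)) j + \<epsilon> ^ p * compact_op h (\<lambda>j. w (Suc n) j ^ (p + 1)) j = 0"
proof -
  have w: "w n \<in> grid_space M" for n using num by (simp add: numerical_solution_def)
  define z where "z = compact_inv M h (dx2 h (time_avg w (Suc n)))"
  have avg: "time_avg w (Suc n) \<in> grid_space M"
    using w[of "Suc (Suc n)"] w[of n] by (simp add: grid_space_def time_avg_def)
  note z = compact_inv[OF dx2_grid_space[OF avg, of h] M h, folded z_def]
  define F where "F j = (\<epsilon> ^ p)\<^sup>2 * ds2 k w (Suc n) j - z j + time_avg w (Suc n) j
      + \<epsilon> ^ p * w (Suc n) j ^ (p + 1)" for j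
  have "F \<in> grid_space M"
    using z(1) avg w[of "Suc (Suc n)"] w[of "Suc n"] w[of n] by (simp add: grid_space_def F_def ds2_def)
  moreover have "F j = 0" if "j \<in> {0..int M - 1}" for j
    using num that by (simp add: numerical_solution_def F_def z_def power_even_eq)
  ultimately have F0: "F j = 0" for j
    using grid_space_mod[of F M j] M by (metis atLeastAtMost_iff of_nat_0_less_iff pos_mod_bound
        pos_mod_sign zle_diff1_eq less_le_trans zero_less_one)
  have "compact_op h F j = 0" unfolding compact_op_eq[OF h] F0 by simp
  moreover have "compact_op h F j = (\<epsilon> ^ p)\<^sup>2 * compact_op h (ds2 k w (Suc n)) j - compact_op h z j
      + compact_op h (time_avg w (Suc n)) j + \<epsilon> ^ p * compact_op h (\<lambda>j. w (Suc n) j ^ (p + 1)) j"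
    unfolding F_def[abs_def] by (simp only: compact_op_add compact_op_diff compact_op_cmult)
  ultimately show ?thesis by (simp add: z(2))
qed

locale klein_gordon_scheme = smooth_klein_gordon p \<epsilon> a b T C v d G
  for p :: nat and \<epsilon> a b T C :: real and v :: "real \<Rightarrow> real \<Rightarrow> real" and d G :: "nat \<Rightarrow> real \<Rightarrow> real \<Rightarrow> real" +
  fixes \<phi> \<gamma> :: "real \<Rightarrow> real" and M :: nat and h k :: real and w :: "nat \<Rightarrow> int \<Rightarrow> real"
  assumes M_ge_1: "M \<ge> 1" and h_eq: "h = (b - a) / real M" and k_pos: "0 < k" and k_le_1: "k \<le> 1"
    and scheme: "numerical_solution p \<epsilon> a b \<phi> \<gamma> M h k w"
    and initial: "x \<in> {a..b} \<Longrightarrow> v x 0 = \<phi> x"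
      "x \<in> {a..b} \<Longrightarrow> d 1 0 x = \<gamma> x / \<epsilon> ^ p"
      "x \<in> {a..b} \<Longrightarrow> G 2 0 x = second_deriv a b \<phi> x"
begin

definition exact :: "nat \<Rightarrow> int \<Rightarrow> real" where
  "exact n j = v (node a h M j) (real n * k)"

definition err :: "nat \<Rightarrow> int \<Rightarrow> real" where
  "err n j = exact n j - w n j"

definition rate :: real where
  "rate = h ^ 4 / \<epsilon> ^ p + k\<^sup>2 / \<epsilon> ^ (3 * p)"

lemma h_pos: "h > 0" and hM: "h * real M = b - a"
  using M_ge_1 a_less_b by (simp_all add: h_eq)

lemma eps_pow: "0 < \<epsilon> ^ p" "\<epsilon> ^ p \<le> 1"
  using \<epsilon>_pos \<epsilon>_le_1 by (simp_all add: power_le_one)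

lemma rate_nonneg: "0 \<le> rate"
  using \<epsilon>_pos h_pos by (simp add: rate_def)

lemma w_grid: "w n \<in> grid_space M"
  using scheme by (simp add: numerical_solution_def)

lemma exact_grid: "exact n \<in> grid_space M"
  unfolding exact_def[abs_def] by (rule node_grid_space)

lemma err_grid: "err n \<in> grid_space M"
  using w_grid[of n] exact_grid[of n] by (simp add: grid_space_def err_def)

lemma node_mem: "node a h M j \<in> {a..b}"
  by (rule node_in[OF a_less_b M_ge_1 h_eq])

lemma exact_eq:
  assumes "real n * k \<le> T" "j \<in> {0..int M}"
  shows "exact n j = v (a + of_int j * h) (real n * k)"
proof (cases "j = int M")
  case True
  have t: "real n * k \<in> {0..T}" using assms(1) k_pos by simp
  have "a + of_int j * h = b" using True hM by (simp add: mult.commute)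
  moreover have "v a (real n * k) = v b (real n * k)"
    using G_periodic[of 0, OF _ t] G_0[OF t, of a] G_0[OF t, of b] a_less_b by simp
  ultimately show ?thesis using True by (simp add: exact_def node_def)
next
  case False
  thus ?thesis using assms(2) by (simp add: exact_def node_def)
qed

lemma grid_error_eq:
  assumes "real n * k \<le> T" "j \<in> {0..int M}"
  shows "grid_error a h k v w n j = err n j"
  using exact_eq[OF assms] by (simp add: grid_error_def err_def)

lemma grid_point_mem: "j \<in> {0..int M} \<Longrightarrow> a + of_int j * h \<in> {a..b}"
proof -
  assume j: "j \<in> {0..int M}"
  have "of_int j * h \<le> real M * h" using j h_pos by (intro mult_right_mono) auto
  thus "a + of_int j * h \<in> {a..b}" using j h_pos hM by (simp add: mult.commute)
qed

lemma err_0: "err 0 j = 0"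
proof -
  have *: "err 0 j = 0" if "j \<in> {0..int M}" for j
  proof -
    have "w 0 j = \<phi> (a + of_int j * h)" using scheme that by (simp add: numerical_solution_def Let_def)
    thus ?thesis
      using initial(1)[OF grid_point_mem[OF that]] exact_eq[of 0 j] that T_pos by (simp add: err_def)
  qed
  have "err 0 (j mod int M) = 0" using M_ge_1 by (intro *) (auto intro: less_imp_le pos_mod_bound)
  thus ?thesis by (simp add: grid_space_mod[OF err_grid])
qed

lemma err_1:
  assumes "k \<le> T" "j \<in> {0..int M}"
  shows "err 1 j = start_defect k (a + of_int j * h)"
proof -
  let ?x = "a + of_int j * h"
  note x = grid_point_mem[OF assms(2)]
  have "w 1 j = \<phi> ?x + k / \<epsilon> ^ p * \<gamma> ?x
      + k ^ 2 / (2 * \<epsilon> ^ (2 * p)) * (second_deriv a b \<phi> ?x - \<phi> ?x - \<epsilon> ^ p * \<phi> ?x ^ (p + 1))"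
    using scheme assms(2) by (simp add: numerical_solution_def Let_def)
  also have "second_deriv a b \<phi> ?x - \<phi> ?x - \<epsilon> ^ p * \<phi> ?x ^ (p + 1) = \<epsilon> ^ (2 * p) * d 2 0 ?x"
    using pde[of 0 ?x] initial[OF x] x T_pos by simp
  finally have "w 1 j = v ?x 0 + k * d 1 0 ?x + k\<^sup>2 / 2 * d 2 0 ?x"
    using initial[OF x] \<epsilon>_pos by simp
  thus ?thesis using exact_eq[of 1 j] assms by (simp add: err_def start_defect_def)
qed

definition energy_root :: "nat \<Rightarrow> real" where
  "energy_root n = sqrt (scheme_energy M h k (\<epsilon> ^ p) err n)"

text \<open>The error vanishes at time zero and is \<open>O(k\<^sup>3 \<epsilon>\<^bsup>-3p\<^esup>)\<close> after one step, together with its gradient. The kinetic part of the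
energy divides the error by \<open>k\<close>, which leaves \<open>k\<^sup>2 \<epsilon>\<^bsup>-3p\<^esup>\<close>.\<close>

lemma initial_energy:
  assumes "k \<le> T"
  shows "energy_root 0 \<le> sqrt (2 * (b - a)) * C * rate"
proof -
  define B where "B = C / \<epsilon> ^ (p * 3)"
  have B: "B \<ge> 0" using C_pos \<epsilon>_pos by (simp add: B_def)
  have kT: "k \<in> {0..T}" using assms k_pos by simp
  have h0: "h \<ge> 0" using h_pos by simp
  have e1: "\<bar>err 1 j\<bar> \<le> B * k ^ 3" if "j \<in> {0..<int M}" for j
    using err_1[OF assms, of j] start_defect_bound[OF kT grid_point_mem[of j]] that by (simp add: B_def)
  have q: "\<bar>(err (Suc 0) j - err 0 j) / k\<bar> \<le> B * k\<^sup>2" if "j \<in> {0..<int M}" for j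
    using e1[OF that] k_pos by (simp add: err_0 pos_divide_le_eq power2_eq_square power3_eq_cube mult.assoc)
  have dx: "\<bar>dx_plus h (err 1) j\<bar> \<le> B * k ^ 3" if "j \<in> {0..<int M}" for j
  proof -
    have "\<bar>err 1 (j + 1) - err 1 j\<bar> \<le> B * h * k ^ 3"
      using start_defect_lipschitz[OF kT grid_point_mem[of "j + 1"] grid_point_mem[of j]]
        err_1[OF assms, of j] err_1[OF assms, of "j + 1"] that h_pos
      by (simp add: B_def algebra_simps)
    thus ?thesis using h_pos by (simp add: dx_plus_def pos_divide_le_eq mult.commute mult.left_commute)
  qed
  have qg: "(\<lambda>j. (err (Suc 0) j - err 0 j) / k) \<in> grid_space M"
    using err_grid[of "Suc 0"] err_grid[of 0] by (simp add: grid_space_def)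
  have z: "sq_sum M h (dx_plus h (err 0)) = 0" "compact_form M h (err 0) = 0"
    by (simp_all add: compact_form_def sq_sum_def dx_plus_def err_0)
  have "scheme_energy M h k (\<epsilon> ^ p) err 0
      \<le> 1 * (h * real M * (B * k\<^sup>2)\<^sup>2) + (h * real M * (B * k ^ 3)\<^sup>2 + h * real M * (B * k ^ 3)\<^sup>2 + 0 + 0) / 2"
    unfolding scheme_energy_def z
  proof (intro add_mono divide_right_mono mult_mono)
    show "(\<epsilon> ^ p)\<^sup>2 \<le> 1" using eps_pow by (simp add: power_le_one)
    show "compact_form M h (\<lambda>j. (err (Suc 0) j - err 0 j) / k) \<le> h * real M * (B * k\<^sup>2)\<^sup>2"
      using compact_form_bounds(2)[OF qg h_pos] sq_sum_le[OF h0 q] by (rule order_trans)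
    show "0 \<le> compact_form M h (\<lambda>j. (err (Suc 0) j - err 0 j) / k)"
      using compact_form_bounds(1)[OF qg h_pos] sq_sum_nonneg[OF h0, of M "\<lambda>j. (err (Suc 0) j - err 0 j) / k"]
      by linarith
    show "sq_sum M h (dx_plus h (err (Suc 0))) \<le> h * real M * (B * k ^ 3)\<^sup>2"
      using sq_sum_le[where u = "dx_plus h (err 1)" and M = M, OF h0 dx] by simp
    show "compact_form M h (err (Suc 0)) \<le> h * real M * (B * k ^ 3)\<^sup>2"
      using compact_form_bounds(2)[OF err_grid[of "Suc 0"] h_pos]
        sq_sum_le[where u = "err 1" and M = M, OF h0 e1] by simp
  qed (use h_pos in auto)
  also have "\<dots> = (b - a) * (B * k\<^sup>2)\<^sup>2 * (1 + k\<^sup>2)"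
  proof -
    have "1 * (X * (B * k\<^sup>2)\<^sup>2) + (X * (B * k ^ 3)\<^sup>2 + X * (B * k ^ 3)\<^sup>2 + 0 + 0) / 2
        = X * (B * k\<^sup>2)\<^sup>2 * (1 + k\<^sup>2)" for X :: real
      by (simp add: field_simps power2_eq_square power3_eq_cube)
    thus ?thesis unfolding hM .
  qed
  also have "\<dots> \<le> (b - a) * (B * k\<^sup>2)\<^sup>2 * 2"
  proof -
    have "k\<^sup>2 \<le> 1" using k_pos k_le_1 by (simp add: power_le_one)
    thus ?thesis using a_less_b by (intro mult_left_mono) auto
  qed
  also have "\<dots> = 2 * (b - a) * (B * k\<^sup>2)\<^sup>2" by (simp only: mult_ac)
  finally have "energy_root 0 \<le> sqrt (2 * (b - a) * (B * k\<^sup>2)\<^sup>2)"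
    unfolding energy_root_def by (rule real_sqrt_le_mono)
  also have "\<dots> = sqrt (2 * (b - a)) * C * (k\<^sup>2 / \<epsilon> ^ (3 * p))"
  proof -
    have "sqrt (2 * (b - a) * (B * k\<^sup>2)\<^sup>2) = sqrt (2 * (b - a)) * (B * k\<^sup>2)"
      using B unfolding real_sqrt_mult by simp
    thus ?thesis by (simp add: B_def mult.commute[of p])
  qed
  also have "\<dots> \<le> sqrt (2 * (b - a)) * C * rate"
    using C_pos a_less_b h_pos \<epsilon>_pos by (intro mult_left_mono) (auto simp: rate_def)
  finally show ?thesis .
qed

lemma energy_growth:
  assumes n: "real (n + 2) * k \<le> T" and close: "\<And>j. \<bar>err (Suc n) j\<bar> \<le> 1"
  shows "energy_root (Suc n) \<le> (1 + 4 * growth_rate p C * k) * energy_root n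
    + 2 * k * ((3 * C + nonlinearity_const p C) * sqrt (b - a)) * rate"
proof -
  define \<tau> where "\<tau> = (3 * C + nonlinearity_const p C) * (h ^ 4 + k\<^sup>2 / \<epsilon> ^ (2 * p))"
  define \<rho> where "\<rho> j = (\<epsilon> ^ p)\<^sup>2 * compact_op h (ds2 k exact (Suc n)) j - dx2 h (time_avg exact (Suc n)) j
      + compact_op h (time_avg exact (Suc n)) j + \<epsilon> ^ p * compact_op h (\<lambda>j. exact (Suc n) j ^ (p + 1)) j" for j
  define f where "f j = exact (Suc n) j ^ (p + 1) - w (Suc n) j ^ (p + 1)" for j
  have t: "real (Suc n) * k \<in> {0..T}" using n k_pos by (auto simp: algebra_simps)
  have \<rho>: "\<bar>\<rho> j\<bar> \<le> \<tau>" for j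
    using truncation_error[OF M_ge_1 h_eq k_pos n, of j] unfolding \<rho>_def \<tau>_def exact_def[abs_def] .
  have fg: "f \<in> grid_space M"
    using exact_grid[of "Suc n"] w_grid[of "Suc n"] by (simp add: grid_space_def f_def)
  have V: "\<bar>exact (Suc n) j\<bar> \<le> C" for j unfolding exact_def by (rule v_bound[OF t node_mem])
  have fL: "\<bar>f j\<bar> \<le> growth_rate p C * \<bar>err (Suc n) j\<bar>" for j
  proof -
    have "\<bar>w (Suc n) j\<bar> \<le> C + 1" using V[of j] close[of j] by (simp add: err_def)
    moreover have "\<bar>exact (Suc n) j\<bar> \<le> C + 1" using V[of j] by simp
    ultimately have "\<bar>exact (Suc n) j ^ (p + 1) - w (Suc n) j ^ (p + 1)\<bar>
        \<le> real (p + 1) * (C + 1) ^ (p + 1 - 1) * \<bar>exact (Suc n) j - w (Suc n) j\<bar>"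
      by (intro power_diff_le)
    thus ?thesis by (simp add: f_def growth_rate_def err_def)
  qed
  have ds: "ds2 k err (Suc n) = (\<lambda>j. ds2 k exact (Suc n) j - ds2 k w (Suc n) j)"
    by (simp add: ds2_def err_def fun_eq_iff diff_divide_distrib[symmetric] algebra_simps)
  have avg: "time_avg err (Suc n) = (\<lambda>j. time_avg exact (Suc n) j - time_avg w (Suc n) j)"
    by (simp add: time_avg_def err_def fun_eq_iff diff_divide_distrib[symmetric] algebra_simps)
  have eq: "(\<epsilon> ^ p)\<^sup>2 * compact_op h (ds2 k err (Suc n)) j - dx2 h (time_avg err (Suc n)) j
      + compact_op h (time_avg err (Suc n)) j = \<rho> j - \<epsilon> ^ p * compact_op h f j" for j
    using compact_scheme[OF scheme M_ge_1 less_imp_neq[OF h_pos, symmetric], of n j]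
    unfolding ds avg compact_op_diff dx2_diff \<rho>_def f_def[abs_def] by (simp add: algebra_simps)
  have L: "0 \<le> growth_rate p C" using C_pos by (simp add: growth_rate_def)
  have "energy_root (Suc n) \<le> (1 + 4 * growth_rate p C * k) * energy_root n
      + 2 * k * \<tau> * sqrt (h * real M) / \<epsilon> ^ p"
    unfolding energy_root_def
    by (rule scheme_energy_growth[where e = err, OF err_grid h_pos k_pos eps_pow(1) eq \<rho> fg fL L])
  also have "2 * k * \<tau> * sqrt (h * real M) / \<epsilon> ^ p
      = 2 * k * ((3 * C + nonlinearity_const p C) * sqrt (b - a)) * rate"
  proof -
    have "(h ^ 4 + k\<^sup>2 / \<epsilon> ^ (2 * p)) / \<epsilon> ^ p = rate"
      by (simp add: rate_def add_divide_distrib power_add[symmetric])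
    hence "\<tau> / \<epsilon> ^ p = (3 * C + nonlinearity_const p C) * rate"
      unfolding \<tau>_def by (simp only: times_divide_eq_right[symmetric])
    moreover have "2 * k * \<tau> * sqrt (h * real M) / \<epsilon> ^ p = 2 * k * sqrt (h * real M) * (\<tau> / \<epsilon> ^ p)" by simp
    ultimately show ?thesis by (simp only: hM) (simp add: mult_ac)
  qed
  finally show ?thesis .
qed

lemma err_norms:
  shows "l2_norm M h (err (Suc n)) + l2_norm M h (dx_plus h (err (Suc n))) \<le> 4 * energy_root n"
    and "\<bar>err (Suc n) j\<bar> \<le> (2 / sqrt (b - a) + 2 * sqrt (b - a)) * energy_root n"
proof -
  note c = scheme_energy_controls[where e = err and n = n, OF err_grid h_pos k_pos eps_pow(1),
      folded energy_root_def]
  show "l2_norm M h (err (Suc n)) + l2_norm M h (dx_plus h (err (Suc n))) \<le> 4 * energy_root n"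
    using c(4,6) by linarith
  have "\<bar>err (Suc n) j\<bar> = \<bar>err (Suc n) (j mod int M)\<bar>" by (simp add: grid_space_mod[OF err_grid])
  also have "\<dots> \<le> l2_norm M h (err (Suc n)) / sqrt (h * M)
      + sqrt (h * M) * l2_norm M h (dx_plus h (err (Suc n)))"
    using M_ge_1 by (intro discrete_sobolev h_pos) auto
  also have "\<dots> \<le> 2 * energy_root n / sqrt (h * M) + sqrt (h * M) * (2 * energy_root n)"
    using c(4,6) h_pos by (intro add_mono divide_right_mono mult_left_mono) auto
  also have "\<dots> = (2 / sqrt (b - a) + 2 * sqrt (b - a)) * energy_root n"
    unfolding hM by (simp add: distrib_right)
  finally show "\<bar>err (Suc n) j\<bar> \<le> (2 / sqrt (b - a) + 2 * sqrt (b - a)) * energy_root n" .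
qed

text \<open>Induction over the time steps. The bound at step \<open>n\<close> keeps \<open>w\<^bsub>n+1\<^esub>\<close> within distance one of the exact solution,
hence the nonlinearity Lipschitz, which is all that the next step needs.\<close>

lemma energy_bound:
  assumes small: "sup_const p a b T C * rate \<le> 1" and "real (Suc n) * k \<le> T"
  shows "energy_root n \<le> energy_const p a b T C * rate"
proof -
  define L where "L = growth_rate p C"
  define K1 where "K1 = 2 * ((3 * C + nonlinearity_const p C) * sqrt (b - a))"
  define K0 where "K0 = sqrt (2 * (b - a)) * C"
  have nn: "0 \<le> L" "0 \<le> K1" "0 \<le> K0"
    using C_pos a_less_b by (simp_all add: L_def K1_def K0_def growth_rate_def nonlinearity_const_def)
  have ec: "energy_const p a b T C = exp (4 * L * T) * (K0 + K1 * T)"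
    by (simp add: energy_const_def L_def K0_def K1_def mult_ac)
  \<comment> \<open>The discrete Gronwall majorant.\<close>
  define W where "W n = exp (4 * L * (real n * k)) * ((K0 + K1 * (real n * k)) * rate)" for n
  have W_le: "W n \<le> energy_const p a b T C * rate" if "real n * k \<le> T" for n
  proof -
    have "exp (4 * L * (real n * k)) * (K0 + K1 * (real n * k)) \<le> exp (4 * L * T) * (K0 + K1 * T)"
      using that nn k_pos by (intro mult_mono add_mono) (auto intro!: mult_left_mono)
    hence "exp (4 * L * (real n * k)) * (K0 + K1 * (real n * k)) * rate \<le> exp (4 * L * T) * (K0 + K1 * T) * rate"
      using rate_nonneg by (rule mult_right_mono)
    thus ?thesis by (simp add: W_def ec mult.assoc)
  qed
  have "energy_root n \<le> W n"
    using assms(2)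
  proof (induction n)
    case 0
    thus ?case using initial_energy by (simp add: W_def K0_def)
  next
    case (Suc n)
    have n1: "real (Suc n) * k \<le> T"
    proof -
      have "real (Suc n) * k \<le> real (Suc (Suc n)) * k" using k_pos by (intro mult_right_mono) auto
      thus ?thesis using Suc.prems by linarith
    qed
    hence IH: "energy_root n \<le> W n" by (rule Suc.IH)
    have n0: "real n * k \<le> T"
    proof -
      have "real n * k \<le> real (Suc n) * k" using k_pos by (intro mult_right_mono) auto
      thus ?thesis using n1 by linarith
    qed
    have "\<bar>err (Suc n) j\<bar> \<le> 1" for j
    proof -
      have "\<bar>err (Suc n) j\<bar> \<le> (2 / sqrt (b - a) + 2 * sqrt (b - a)) * energy_root n" by (rule err_norms(2))
      also have "\<dots> \<le> (2 / sqrt (b - a) + 2 * sqrt (b - a)) * (energy_const p a b T C * rate)"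
        using order_trans[OF IH W_le[OF n0]] a_less_b by (intro mult_left_mono) auto
      also have "\<dots> \<le> 1" using small by (simp add: sup_const_def mult.assoc)
      finally show ?thesis .
    qed
    hence "energy_root (Suc n) \<le> (1 + 4 * L * k) * energy_root n + K1 * k * rate"
      using energy_growth[of n] Suc.prems by (simp add: L_def K1_def ac_simps del: distrib_left_numeral)
    hence "energy_root (Suc n) \<le> exp (4 * L * (real n * k) + 4 * L * k)
        * ((K0 + K1 * (real n * k)) * rate + K1 * k * rate)"
      by (rule linear_growth_bound) (use IH nn k_pos rate_nonneg in \<open>auto simp: W_def\<close>)
    also have "\<dots> = W (Suc n)"
      by (simp add: W_def algebra_simps)
    finally show ?case .
  qed
  also have "W n \<le> energy_const p a b T C * rate"
  proof (rule W_le)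
    have "real n * k \<le> real (Suc n) * k" using k_pos by (intro mult_right_mono) auto
    thus "real n * k \<le> T" using assms(2) by linarith
  qed
  finally show ?thesis .
qed

lemma error_bound:
  assumes small: "sup_const p a b T C * rate \<le> 1" and n: "real n * k \<le> T"
  shows "l2_norm M h (err n) + l2_norm M h (dx_plus h (err n)) \<le> 4 * energy_const p a b T C * rate"
    and "\<bar>err n j\<bar> \<le> 1"
proof -
  have ec: "0 \<le> energy_const p a b T C"
    using C_pos a_less_b T_pos by (simp add: energy_const_def nonlinearity_const_def)
  have "l2_norm M h (err n) + l2_norm M h (dx_plus h (err n)) \<le> 4 * energy_const p a b T C * rate
      \<and> \<bar>err n j\<bar> \<le> 1"
  proof (cases n)
    case 0
    thus ?thesis using ec rate_nonneg by (simp add: l2_norm_def dx_plus_def err_0)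
  next
    case (Suc m)
    hence y: "energy_root m \<le> energy_const p a b T C * rate" using energy_bound[OF small] n by simp
    have "\<bar>err n j\<bar> \<le> (2 / sqrt (b - a) + 2 * sqrt (b - a)) * (energy_const p a b T C * rate)"
      unfolding Suc using y a_less_b by (intro order_trans[OF err_norms(2)] mult_left_mono) auto
    also have "\<dots> \<le> 1" using small by (simp add: sup_const_def mult.assoc)
    finally show ?thesis using err_norms(1)[of m] y unfolding Suc by linarith
  qed
  thus "l2_norm M h (err n) + l2_norm M h (dx_plus h (err n)) \<le> 4 * energy_const p a b T C * rate"
    "\<bar>err n j\<bar> \<le> 1" by blast+
qed

lemma numerical_bound:
  assumes small: "sup_const p a b T C * rate \<le> 1" and n: "real n * k \<le> T"
  shows "l2_norm M h (grid_error a h k v w n) + l2_norm M h (dx_plus h (grid_error a h k v w n))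
      \<le> 4 * energy_const p a b T C * rate"
    and "\<exists>x\<in>{a..b}. linf_norm M (w n) \<le> \<bar>v x (real n * k)\<bar> + 1"
proof -
  have "l2_norm M h (grid_error a h k v w n) = l2_norm M h (err n)"
    unfolding l2_norm_def using grid_error_eq[OF n] by simp
  moreover have "l2_norm M h (dx_plus h (grid_error a h k v w n)) = l2_norm M h (dx_plus h (err n))"
    unfolding l2_norm_def dx_plus_def using grid_error_eq[OF n] by simp
  ultimately show "l2_norm M h (grid_error a h k v w n) + l2_norm M h (dx_plus h (grid_error a h k v w n))
      \<le> 4 * energy_const p a b T C * rate"
    using error_bound(1)[OF assms] by simp
  have "linf_norm M (w n) \<in> (\<lambda>j. \<bar>w n j\<bar>) ` {0..<int M}"
    unfolding linf_norm_def using M_ge_1 by (intro Max_in) auto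
  then obtain j where "linf_norm M (w n) = \<bar>w n j\<bar>" by blast
  also have "\<bar>w n j\<bar> \<le> \<bar>v (node a h M j) (real n * k)\<bar> + 1"
    using error_bound(2)[OF assms, of j] by (simp add: err_def exact_def)
  finally show "\<exists>x\<in>{a..b}. linf_norm M (w n) \<le> \<bar>v x (real n * k)\<bar> + 1"
    using node_mem by blast
qed

end

theorem theorem5p2:
  fixes p :: nat and T0 a b :: real and \<phi> \<gamma> :: "real \<Rightarrow> real"
    and v :: "real \<Rightarrow> real \<Rightarrow> real \<Rightarrow> real" and M0 :: ereal
  assumes "p \<ge> 1" and "T0 > 0" and "a < b"
    and solution: "\<And>\<epsilon>. 0 < \<epsilon> \<Longrightarrow> \<epsilon> \<le> 1 \<Longrightarrow> klein_gordon_solution p \<epsilon> a b T0 \<phi> \<gamma> (v \<epsilon>)"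
    and regularity: "\<And>\<epsilon>. 0 < \<epsilon> \<Longrightarrow> \<epsilon> \<le> 1 \<Longrightarrow>
        (\<lambda>s x. v \<epsilon> x s) \<in> C_space 0 T0 (sobolev_periodic a b 6) (sobolev_norm a b 6)
                      \<inter> C_space 2 T0 (sobolev a b 4) (sobolev_norm a b 4)
                      \<inter> C_space 4 T0 (sobolev a b 2) (sobolev_norm a b 2)"
    and bounds: "\<exists>C>0. \<forall>\<epsilon>. 0 < \<epsilon> \<and> \<epsilon> \<le> 1 \<longrightarrow> mixed_derivs_bounded p a b T0 \<epsilon> (v \<epsilon>) C"
    and M0: "M0 = (SUP \<epsilon>\<in>{0<..1}. SUP s\<in>{0..T0}. Linf_norm a b (\<lambda>x. v \<epsilon> x s))"
  shows "\<exists>h0>0. \<exists>k0>0. \<exists>C>0. \<forall>\<epsilon> (M::nat) h k w.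
      0 < \<epsilon> \<and> \<epsilon> \<le> 1 \<and> M \<ge> 1 \<and> h = (b - a) / of_nat M \<and> k > 0 \<and>
      numerical_solution p \<epsilon> a b \<phi> \<gamma> M h k w \<and>
      h \<le> h0 * \<epsilon> powr (of_nat p / 4) \<and>
      k \<le> k0 * \<epsilon> powr (3 * of_nat p / 2) \<and>
      (sigma_max p T0 k M w > 1 / \<epsilon> ^ p \<longrightarrow>
         k < 2 * \<epsilon> ^ p / sqrt (\<epsilon> ^ p * sigma_max p T0 k M w - 1))
      \<longrightarrow> (\<forall>n::nat. of_nat n \<le> T0 / k \<longrightarrow>
            l2_norm M h (grid_error a h k (v \<epsilon>) w n)
              + l2_norm M h (dx_plus h (grid_error a h k (v \<epsilon>) w n))
              \<le> C * (h ^ 4 / \<epsilon> ^ p + k ^ 2 / \<epsilon> ^ (3 * p)) \<and>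
            ereal (linf_norm M (w n)) \<le> 1 + M0)"
proof -
  obtain C where C: "C > 0" and bd: "\<And>\<epsilon>. 0 < \<epsilon> \<Longrightarrow> \<epsilon> \<le> 1 \<Longrightarrow> mixed_derivs_bounded p a b T0 \<epsilon> (v \<epsilon>) C"
    using bounds by blast
  define K where "K = sup_const p a b T0 C"
  define E where "E = energy_const p a b T0 C"
  have E: "0 \<le> E"
    using C \<open>a < b\<close> \<open>T0 > 0\<close> by (simp add: E_def energy_const_def nonlinearity_const_def)
  have K: "0 \<le> K" using E \<open>a < b\<close> by (simp add: K_def sup_const_def E_def)
  \<comment> \<open>With \<open>h\<^sub>0 = k\<^sub>0 = \<delta>\<close> both parts of the rate are at most \<open>\<delta>\<close>, so that \<open>K\<close> times the rate is at most one.\<close>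
  define \<delta> where "\<delta> = 1 / (2 * K + 1)"
  have \<delta>: "0 < \<delta>" "\<delta> \<le> 1" "K * (2 * \<delta>) \<le> 1" using K by (auto simp: \<delta>_def field_simps)
  have main: "l2_norm M h (grid_error a h k (v \<epsilon>) w n) + l2_norm M h (dx_plus h (grid_error a h k (v \<epsilon>) w n))
        \<le> (4 * E + 1) * (h ^ 4 / \<epsilon> ^ p + k ^ 2 / \<epsilon> ^ (3 * p)) \<and>
      ereal (linf_norm M (w n)) \<le> 1 + M0"
    if \<epsilon>: "0 < \<epsilon>" "\<epsilon> \<le> 1" and M: "M \<ge> 1" "h = (b - a) / of_nat M" and k: "k > 0"
      and num: "numerical_solution p \<epsilon> a b \<phi> \<gamma> M h k w"
      and hs: "h \<le> \<delta> * \<epsilon> powr (of_nat p / 4)" and ks: "k \<le> \<delta> * \<epsilon> powr (3 * of_nat p / 2)"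
      and n: "of_nat n \<le> T0 / k"
    for \<epsilon> M h k w n
  proof -
    have reg: "(\<lambda>s x. v \<epsilon> x s) \<in> C_space 0 T0 (sobolev_periodic a b 6) (sobolev_norm a b 6)"
      using regularity[OF \<epsilon>] by blast
    obtain d G where dG: "smooth_klein_gordon p \<epsilon> a b T0 C (v \<epsilon>) d G"
      "\<And>x. x \<in> {a..b} \<Longrightarrow> v \<epsilon> x 0 = \<phi> x"
      "\<And>x. x \<in> {a..b} \<Longrightarrow> d 1 0 x = \<gamma> x / \<epsilon> ^ p"
      "\<And>x. x \<in> {a..b} \<Longrightarrow> G 2 0 x = second_deriv a b \<phi> x"
      by (rule smooth_klein_gordon_exists[OF \<open>a < b\<close> \<open>T0 > 0\<close> \<epsilon> C solution[OF \<epsilon>] reg bd[OF \<epsilon>]]) (rule that)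
    have h0: "h > 0" using M \<open>a < b\<close> by simp
    have "\<epsilon> powr (3 * of_nat p / 2) \<le> 1" using \<epsilon> by (intro powr_le1) auto
    hence "\<delta> * \<epsilon> powr (3 * of_nat p / 2) \<le> 1 * 1" using \<delta> by (intro mult_mono) auto
    hence k1: "k \<le> 1" using ks by simp
    interpret klein_gordon_scheme p \<epsilon> a b T0 C "v \<epsilon>" d G \<phi> \<gamma> M h k w
      using dG M k k1 num \<open>p \<ge> 1\<close> by (intro klein_gordon_scheme.intro klein_gordon_scheme_axioms.intro) auto
    have h4: "h ^ 4 / \<epsilon> ^ p \<le> \<delta>"
    proof -
      have "h ^ 4 \<le> (\<delta> * \<epsilon> powr (of_nat p / 4)) ^ 4" using hs h0 by (intro power_mono) auto
      also have "\<dots> = \<delta> ^ 4 * \<epsilon> ^ p"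
        using \<epsilon>(1) by (simp add: power_mult_distrib powr_power powr_realpow)
      also have "\<dots> \<le> \<delta> * \<epsilon> ^ p"
        using \<delta> \<epsilon>(1) power_decreasing[of 1 4 \<delta>] by (intro mult_right_mono) auto
      finally show ?thesis using \<epsilon>(1) by (simp add: pos_divide_le_eq)
    qed
    have k2: "k ^ 2 / \<epsilon> ^ (3 * p) \<le> \<delta>"
    proof -
      have "k ^ 2 \<le> (\<delta> * \<epsilon> powr (3 * of_nat p / 2)) ^ 2" using ks k by (intro power_mono) auto
      also have "\<dots> = \<delta> ^ 2 * \<epsilon> powr (real (3 * p))"
        using \<epsilon>(1) by (simp add: power_mult_distrib powr_power)
      also have "\<epsilon> powr (real (3 * p)) = \<epsilon> ^ (3 * p)" using \<epsilon>(1) by (rule powr_realpow)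
      also have "\<delta> ^ 2 * \<epsilon> ^ (3 * p) \<le> \<delta> * \<epsilon> ^ (3 * p)"
        using \<delta> \<epsilon>(1) power_decreasing[of 1 2 \<delta>] by (intro mult_right_mono) auto
      finally show ?thesis using \<epsilon>(1) by (simp add: pos_divide_le_eq)
    qed
    have "K * rate \<le> K * (2 * \<delta>)" using h4 k2 K by (intro mult_left_mono) (auto simp: rate_def)
    hence small: "sup_const p a b T0 C * rate \<le> 1" using \<delta>(3) by (simp add: K_def)
    have nk: "real n * k \<le> T0" using n k by (simp add: pos_le_divide_eq)
    have "4 * E * rate \<le> (4 * E + 1) * rate" using rate_nonneg by (intro mult_right_mono) auto
    hence 1: "l2_norm M h (grid_error a h k (v \<epsilon>) w n) + l2_norm M h (dx_plus h (grid_error a h k (v \<epsilon>) w n))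
        \<le> (4 * E + 1) * rate"
      using numerical_bound(1)[OF small nk] by (simp add: E_def)
    obtain x where x: "x \<in> {a..b}" "linf_norm M (w n) \<le> \<bar>v \<epsilon> x (real n * k)\<bar> + 1"
      using numerical_bound(2)[OF small nk] by blast
    have t: "real n * k \<in> {0..T0}" using nk k by simp
    have "continuous_on {a..b} (G 0 (real n * k))"
      using G_derivative[of 0, OF _ t] by (intro DERIV_continuous_on) auto
    hence cont: "continuous_on {a..b} (\<lambda>x. v \<epsilon> x (real n * k))"
      by (rule continuous_on_eq) (rule G_0[OF t])
    have "ereal \<bar>v \<epsilon> x (real n * k)\<bar> \<le> Linf_norm a b (\<lambda>x. v \<epsilon> x (real n * k))"
      by (rule abs_le_Linf_norm[OF \<open>a < b\<close> cont x(1)])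
    also have "\<dots> \<le> (SUP s\<in>{0..T0}. Linf_norm a b (\<lambda>x. v \<epsilon> x s))" using t by (rule SUP_upper)
    also have "\<dots> \<le> M0" unfolding M0 using \<epsilon> by (intro SUP_upper) auto
    finally have sup: "1 + ereal \<bar>v \<epsilon> x (real n * k)\<bar> \<le> 1 + M0" by (rule add_left_mono)
    have "ereal (linf_norm M (w n)) \<le> 1 + ereal \<bar>v \<epsilon> x (real n * k)\<bar>"
      using x(2) by (simp add: one_ereal_def add.commute)
    hence "ereal (linf_norm M (w n)) \<le> 1 + M0" using sup by (rule order_trans)
    thus ?thesis using 1 unfolding rate_def by blast
  qed
  show ?thesis
  proof (intro exI conjI allI impI)
    show "0 < \<delta>" "0 < \<delta>" "0 < 4 * E + 1" using \<delta>(1) E by simp_all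
  qed (use main in blast)+
qed

end
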